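(* Let $X$ be a finite set, let $Q$ be an irreducible and reversible Markov kernel on $X$ with stationary probability measure $\pi$, and let $\kappa\in\mathbb{R}$. Suppose that $Q$ has entropic curvature at least $\kappa$, i.e. $\operatorname{Ric}(Q)\ge\kappa$ (with $\theta$ the logarithmic mean). Then for all $x\in X$, all functions $f:X\to\mathbb{R}$, all $t\ge 0$ and all $\varepsilon>0$, $$\Gamma(P_tf)(x)\,\pi(x)\;\le\;\frac{e^{-2\kappa t}}{2\,\theta(1,\varepsilon)}\Big[(P_t\Gamma(f))(x)\,\pi(x)+\varepsilon\sum_{y\in N(x)}(P_t\Gamma(f))(y)\,\pi(y)\Big],$$ where $\Gamma(f)(x):=\sum_{y\in X}(f(y)-f(x))^2Q(x,y)$.
   Context: Markov chain. $X$ is a finite set and $Q:X\times X\to[0,\infty)$ is a Markov kernel: $\sum_{y\in X}Q(x,y)=1$ for all $x$. $Q$ is irreducible, with unique stationary probability measure $\pi$ on $X$, and reversible: $Q(x,y)\pi(x)=Q(y,x)\pi(y)$ for all $x,y\in X$. Write $x\sim y$ if and only if $Q(x,y)>0$, and $N(x)=\{y\in X: x\sim y\}$. $C(X)$ is the set of functions $X\to\mathbb{R}$. Operators. For $f\in C(X)$ and $V:X\times X\to\mathbb{R}$: $\nabla f(x,y)=f(y)-f(x)$; $\nabla\cdot V(x)=\frac12\sum_{y\in X}(V(x,y)-V(y,x))Q(x,y)$; $\Delta f(x)=\sum_{y\in X}(f(y)-f(x))Q(x,y)$; $P_t=e^{t\Delta}$ ($t\ge0$) is the heat semigroup. Logarithmic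 mean. $\theta(a,b)=\frac{a-b}{\log a-\log b}$ for $a,b>0$, $a\neq b$, extended continuously by $\theta(a,a)=a$ and $\theta(a,0)=\theta(0,a)=0$ for $a\ge 0$. Probability densities and entropy. $\mathscr{D}(X)=\{\rho:X\to[0,\infty):\sum_{x\in X}\pi(x)\rho(x)=1\}$. For $\rho\in\mathscr{D}(X)$ put $\hat\rho(x,y)=\theta(\rho(x),\rho(y))$ and $\mathcal{H}(\rho)=\sum_{x\in X}\rho(x)\log\rho(x)\,\pi(x)$ (with $0\log 0=0$). For $f\in C(X)$ put $\mathcal{A}(\rho,f)=\frac12\sum_{x,y\in X}(f(y)-f(x))^2\hat\rho(x,y)Q(x,y)\pi(x)$. Discrete transport metric. For $\bar\rho_0,\bar\rho_1\in\mathscr{D}(X)$, $\mathcal{W}(\bar\rho_0,\bar\rho_1)=\inf\big\{\int_0^1\mathcal{A}(\rho_t,f_t)\,dt\big\}^{1/2}$, where the infimum is over all pairs of sufficiently regular curves $(\rho_t)_{t\in[0,1]}$ in $\mathscr{D}(X)$ and $(f_t)_{t\in[0,1]}$ in $C(X)$ (say, $\rho$ continuous and piecewise $C^1$ and $f$ measurable in $t$) with $\rho_0=\bar\rho_0$, $\rho_1=\bar\rho_1$ that satisfy the continuity equation $\partial_t\rho_t+\nabla\cdot(\hat\rho_t\nabla f_t)=0$ (for a.e. $t$). $\mathcal{W}$ is a metric on $\mathscr{D}(X)$. A constant speed geodesic is a curve $(\rho_t)_{t\in[0,1]}$ in $\mathscr{D}(X)$ with $\mathcal{W}(\rho_s,\rho_t)=|s-t|\,\mathcal{W}(\rho_0,\rho_1)$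 for all $s,t\in[0,1]$. Entropic curvature. $Q$ has entropic curvature at least $\kappa\in\mathbb{R}$, written $\operatorname{Ric}(Q)\ge\kappa$, if and only if for every constant speed geodesic $(\rho_t)_{t\in[0,1]}$ in $(\mathscr{D}(X),\mathcal{W})$ and every $t\in[0,1]$, $$\mathcal{H}(\rho_t)\le(1-t)\mathcal{H}(\rho_0)+t\,\mathcal{H}(\rho_1)-\frac{\kappa}{2}t(1-t)\mathcal{W}(\rho_0,\rho_1)^2.$$ *)

theory Defs
  imports "HOL-Analysis.Analysis"
begin

text \<open>The finite set \<open>X\<close> is the universe of a type of class \<^class>\<open>finite\<close>; it is automatically
  nonempty, as it must be to carry a probability measure.\<close>

definition markov_kernel :: "('a::finite \<Rightarrow> 'a \<Rightarrow> real) \<Rightarrow> bool" where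
  "markov_kernel Q \<longleftrightarrow> (\<forall>x y. 0 \<le> Q x y) \<and> (\<forall>x. (\<Sum>y\<in>UNIV. Q x y) = 1)"

definition adjacent :: "('a::finite \<Rightarrow> 'a \<Rightarrow> real) \<Rightarrow> 'a \<Rightarrow> 'a \<Rightarrow> bool" where
  "adjacent Q x y \<longleftrightarrow> 0 < Q x y"

definition nbrs :: "('a::finite \<Rightarrow> 'a \<Rightarrow> real) \<Rightarrow> 'a \<Rightarrow> 'a set" where
  "nbrs Q x = {y. adjacent Q x y}"

definition irreducible_kernel :: "('a::finite \<Rightarrow> 'a \<Rightarrow> real) \<Rightarrow> bool" where
  "irreducible_kernel Q \<longleftrightarrow> (\<forall>x y. (adjacent Q)\<^sup>*\<^sup>* x y)"

definition stationary_distribution :: "('a::finite \<Rightarrow> 'a \<Rightarrow> real) \<Rightarrow> ('a \<Rightarrow> real) \<Rightarrow> bool" where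
  "stationary_distribution Q \<pi> \<longleftrightarrow>
     (\<forall>x. 0 \<le> \<pi> x) \<and> (\<Sum>x\<in>UNIV. \<pi> x) = 1 \<and> (\<forall>y. (\<Sum>x\<in>UNIV. \<pi> x * Q x y) = \<pi> y)"

definition reversible :: "('a::finite \<Rightarrow> 'a \<Rightarrow> real) \<Rightarrow> ('a \<Rightarrow> real) \<Rightarrow> bool" where
  "reversible Q \<pi> \<longleftrightarrow> (\<forall>x y. Q x y * \<pi> x = Q y x * \<pi> y)"

definition grad :: "('a \<Rightarrow> real) \<Rightarrow> 'a \<Rightarrow> 'a \<Rightarrow> real" where
  "grad f x y = f y - f x"

definition divergence :: "('a::finite \<Rightarrow> 'a \<Rightarrow> real) \<Rightarrow> ('a \<Rightarrow> 'a \<Rightarrow> real) \<Rightarrow> 'a \<Rightarrow> real" where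
  "divergence Q V x = 1/2 * (\<Sum>y\<in>UNIV. (V x y - V y x) * Q x y)"

definition laplacian :: "('a::finite \<Rightarrow> 'a \<Rightarrow> real) \<Rightarrow> ('a \<Rightarrow> real) \<Rightarrow> 'a \<Rightarrow> real" where
  "laplacian Q f x = (\<Sum>y\<in>UNIV. (f y - f x) * Q x y)"

text \<open>The operator exponential \<open>exp (t \<Delta>)\<close>, written as its power series applied to \<open>f\<close>. On a
  finite space \<open>\<Delta>\<close> is bounded, so the series converges absolutely for every \<open>t\<close>.\<close>

definition heat :: "('a::finite \<Rightarrow> 'a \<Rightarrow> real) \<Rightarrow> real \<Rightarrow> ('a \<Rightarrow> real) \<Rightarrow> 'a \<Rightarrow> real" where
  "heat Q t f x = (\<Sum>n. t ^ n / fact n * (laplacian Q ^^ n) f x)"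

definition Gam :: "('a::finite \<Rightarrow> 'a \<Rightarrow> real) \<Rightarrow> ('a \<Rightarrow> real) \<Rightarrow> 'a \<Rightarrow> real" where
  "Gam Q f x = (\<Sum>y\<in>UNIV. (f y - f x)\<^sup>2 * Q x y)"

text \<open>Only used for nonnegative arguments.\<close>

definition log_mean :: "real \<Rightarrow> real \<Rightarrow> real" where
  "log_mean a b =
     (if a = b then a else if a = 0 \<or> b = 0 then 0 else (a - b) / (ln a - ln b))"

definition densities :: "('a::finite \<Rightarrow> real) \<Rightarrow> ('a \<Rightarrow> real) set" where
  "densities \<pi> = {\<rho>. (\<forall>x. 0 \<le> \<rho> x) \<and> (\<Sum>x\<in>UNIV. \<pi> x * \<rho> x) = 1}"

definition hat :: "('a \<Rightarrow> real) \<Rightarrow> 'a \<Rightarrow> 'a \<Rightarrow> real" where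
  "hat \<rho> x y = log_mean (\<rho> x) (\<rho> y)"

text \<open>The convention \<open>0 log 0 = 0\<close> needs no case distinction because of the factor \<open>\<rho> x\<close>.\<close>

definition rel_entropy :: "('a::finite \<Rightarrow> real) \<Rightarrow> ('a \<Rightarrow> real) \<Rightarrow> real" where
  "rel_entropy \<pi> \<rho> = (\<Sum>x\<in>UNIV. \<rho> x * ln (\<rho> x) * \<pi> x)"

definition act ::
  "('a::finite \<Rightarrow> 'a \<Rightarrow> real) \<Rightarrow> ('a \<Rightarrow> real) \<Rightarrow> ('a \<Rightarrow> real) \<Rightarrow> ('a \<Rightarrow> real) \<Rightarrow> real" where
  "act Q \<pi> \<rho> f =
     1/2 * (\<Sum>x\<in>UNIV. \<Sum>y\<in>UNIV. (f y - f x)\<^sup>2 * hat \<rho> x y * Q x y * \<pi> x)"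

text \<open>Since \<open>X\<close> is finite, regularity of the curves is imposed coordinatewise. Recall that
  \<^const>\<open>piecewise_C1_differentiable_on\<close> includes continuity on the whole interval.\<close>

definition admissible ::
  "('a::finite \<Rightarrow> 'a \<Rightarrow> real) \<Rightarrow> ('a \<Rightarrow> real) \<Rightarrow> ('a \<Rightarrow> real) \<Rightarrow> ('a \<Rightarrow> real) \<Rightarrow>
    (real \<Rightarrow> 'a \<Rightarrow> real) \<Rightarrow> (real \<Rightarrow> 'a \<Rightarrow> real) \<Rightarrow> bool" where
  "admissible Q \<pi> \<rho>0 \<rho>1 \<rho> f \<longleftrightarrow>
     (\<forall>t\<in>{0..1}. \<rho> t \<in> densities \<pi>) \<and> \<rho> 0 = \<rho>0 \<and> \<rho> 1 = \<rho>1 \<and>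
     (\<forall>x. (\<lambda>t. \<rho> t x) piecewise_C1_differentiable_on {0..1}) \<and>
     (\<forall>x. (\<lambda>t. f t x) \<in> borel_measurable (lebesgue_on {0..1})) \<and>
     (AE t in lebesgue_on {0..1}. \<forall>x.
        ((\<lambda>s. \<rho> s x) has_real_derivative
           - divergence Q (\<lambda>y z. hat (\<rho> t) y z * grad (f t) y z) x) (at t within {0..1}))"

text \<open>The infimum is taken in \<open>[0, \<infinity>]\<close>, so that curves of infinite action are harmless. It is
  finite for irreducible reversible kernels, hence \<^const>\<open>enn2real\<close> then loses nothing.\<close>

definition transport_dist ::
  "('a::finite \<Rightarrow> 'a \<Rightarrow> real) \<Rightarrow> ('a \<Rightarrow> real) \<Rightarrow> ('a \<Rightarrow> real) \<Rightarrow> ('a \<Rightarrow> real) \<Rightarrow> real" where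
  "transport_dist Q \<pi> \<rho>0 \<rho>1 =
     sqrt (enn2real (Inf {\<integral>\<^sup>+ t. ennreal (act Q \<pi> (\<rho> t) (f t)) \<partial>lebesgue_on {0..1} | \<rho> f.
                            admissible Q \<pi> \<rho>0 \<rho>1 \<rho> f}))"

definition constant_speed_geodesic ::
  "('a::finite \<Rightarrow> 'a \<Rightarrow> real) \<Rightarrow> ('a \<Rightarrow> real) \<Rightarrow> (real \<Rightarrow> 'a \<Rightarrow> real) \<Rightarrow> bool" where
  "constant_speed_geodesic Q \<pi> \<rho> \<longleftrightarrow>
     (\<forall>t\<in>{0..1}. \<rho> t \<in> densities \<pi>) \<and>
     (\<forall>s\<in>{0..1}. \<forall>t\<in>{0..1}.
        transport_dist Q \<pi> (\<rho> s) (\<rho> t) = \<bar>s - t\<bar> * transport_dist Q \<pi> (\<rho> 0) (\<rho> 1))"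

definition entropic_curvature_ge ::
  "('a::finite \<Rightarrow> 'a \<Rightarrow> real) \<Rightarrow> ('a \<Rightarrow> real) \<Rightarrow> real \<Rightarrow> bool" where
  "entropic_curvature_ge Q \<pi> \<kappa> \<longleftrightarrow>
     (\<forall>\<rho>. constant_speed_geodesic Q \<pi> \<rho> \<longrightarrow>
        (\<forall>t\<in>{0..1}. rel_entropy \<pi> (\<rho> t) \<le>
           (1 - t) * rel_entropy \<pi> (\<rho> 0) + t * rel_entropy \<pi> (\<rho> 1)
             - \<kappa> / 2 * t * (1 - t) * (transport_dist Q \<pi> (\<rho> 0) (\<rho> 1))\<^sup>2))"

end

theory Submission
  imports Defs
begin

text \<open>
  The theorem is a pointwise form of the gradient estimate
  \<open>A(\<rho>, P\<^sub>t f) \<le> exp(-2 \<kappa> t) / 2 * \<langle>P\<^sub>t \<Gamma>(f), \<rho>\<rangle>\<close> for strictly positive \<open>\<rho>\<close> (lemma \<open>act_heat_le\<close>):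
  take for \<open>\<rho>\<close> a small perturbation of the function that is \<open>1\<close> at \<open>x\<close>, \<open>\<epsilon>\<close> at the other neighbours of
  \<open>x\<close> and \<open>0\<close> elsewhere. On the left every edge at \<open>x\<close> then has weight at least \<open>\<theta>(1, \<epsilon>)\<close> and is counted
  in both directions.

  The gradient estimate is dual to infinitesimal contraction of the heat flow in the transport
  distance. On strictly positive densities \<open>\<W>\<close> is the Riemannian distance of the squared norm
  \<open>cost \<rho> v = \<langle>\<psi>, v\<rangle>\<close>, where \<open>\<psi>\<close> solves \<open>- div(\<rho>^ \<nabla>\<psi>) = v\<close>; the dual formula
  \<open>cost \<rho> v = sup\<^sub>\<phi> (2 \<langle>\<phi>, v\<rangle> - A(\<rho>, \<phi>))\<close> turns a bound for \<open>cost\<close> along the flow into a bound for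
  \<open>A\<close>. So it suffices that \<open>\<W>\<^sup>2\<close> between two nearby densities decays like \<open>exp(-2 \<kappa> t)\<close>.

  Contraction follows from convexity of the entropy by a first-order argument. Let \<open>\<gamma>\<close> be a geodesic of
  length \<open>d\<close> from \<open>x\<close> to \<open>y\<close>, cut it at the times \<open>\<tau>\<close> and \<open>1 - \<tau>\<close>, keep the middle part and let
  only the two ends move by one Euler step \<open>x + t \<Delta>x\<close>, \<open>y + t \<Delta>y\<close> of the heat equation. Since
  \<open>\<theta>(a,b) (log a - log b) = a - b\<close>, the potential of \<open>\<Delta>x\<close> is \<open>- log x\<close>, so that the step changes the squared
  length of the first piece by \<open>2 t \<langle>log x, \<gamma>\<^sub>\<tau> - x\<rangle>\<close>, up to \<open>O(t\<^sup>2)\<close>, and this is at most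
  \<open>2 t (H(\<gamma>\<^sub>\<tau>) - H(x))\<close> because \<open>H\<close> is a convex function of the density. Adding the other end and using convexity of
  \<open>H\<close> along \<open>\<gamma>\<close> yields \<open>\<W>\<^sup>2 \<le> (1 - 2 \<kappa> t) d\<^sup>2 + o(t)\<close> if \<open>\<tau>\<close> is of the order of \<open>sqrt t\<close>
  (lemmas \<open>euler_contraction_raw\<close> and \<open>euler_contraction\<close>). Iterating \<open>N\<close> steps of size \<open>T / N\<close> and letting
  \<open>N\<close> tend to infinity gives the heat flow.

  Two facts about \<open>\<W>\<close> enter. It agrees locally with the length of polygonal chains: a chain
  can be traversed at constant speed (\<open>chain_dist\<close>), and a curve of small action can be cut into a
  chain of almost the same length (\<open>fine_chain\<close>). Nearby points are joined by
  a constant speed geodesic (\<open>geodesic_exists\<close>), a limit of ever finer chains of almost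
  minimal length. Reference densities are compared throughout by monotonicity and homogeneity of
  the logarithmic mean: if \<open>\<rho> \<le> c \<rho>'\<close> pointwise, then \<open>A(\<rho>, \<cdot>) \<le> c A(\<rho>', \<cdot>)\<close>.
\<close>

section \<open>The logarithmic mean\<close>

lemma log_mean_commute: "log_mean a b = log_mean b a"
proof -
  have "(a - b) / (ln a - ln b) = (b - a) / (ln b - ln a)"
    by (metis minus_diff_eq minus_divide_divide)
  then show ?thesis by (auto simp: log_mean_def)
qed

text \<open>This identity makes the heat equation the gradient flow of the entropy: it cancels the
  logarithmic mean against the gradient of \<open>log \<rho>\<close>.\<close>

lemma log_mean_mult_diff_ln:
  assumes "0 < a" "0 < b"
  shows "log_mean a b * (ln a - ln b) = a - b"
  using assms by (auto simp: log_mean_def)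

lemma log_mean_nonneg:
  assumes "0 \<le> a" "0 \<le> b"
  shows "0 \<le> log_mean a b"
proof (cases "a = b \<or> a = 0 \<or> b = 0")
  case False
  then have "0 < a" "0 < b" using assms by auto
  then consider "a < b" "ln a < ln b" | "b < a" "ln b < ln a"
    using False by (metis ln_less_cancel_iff neq_iff)
  then show ?thesis
    using False by cases (auto simp: log_mean_def divide_nonpos_nonpos)
qed (use assms in \<open>auto simp: log_mean_def\<close>)

lemma log_mean_pos:
  assumes "0 < a" "0 < b"
  shows "0 < log_mean a b"
proof -
  have "log_mean a b \<noteq> 0"
    using assms by (auto simp: log_mean_def)
  then show ?thesis
    using log_mean_nonneg[of a b] assms by auto
qed

lemma log_mean_scale:
  assumes "0 < c" "0 \<le> a" "0 \<le> b"
  shows "log_mean (c * a) (c * b) = c * log_mean a b"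
proof (cases "a = b \<or> a = 0 \<or> b = 0")
  case False
  then have "ln (c * a) - ln (c * b) = ln a - ln b"
    using assms by (simp add: ln_mult)
  then show ?thesis
    using False assms by (simp add: log_mean_def algebra_simps flip: right_diff_distrib)
qed (use assms in \<open>auto simp: log_mean_def\<close>)

lemma log_mean_exp_slope: "p \<noteq> q \<Longrightarrow> log_mean (exp p) (exp q) = (exp p - exp q) / (p - q)"
  by (simp add: log_mean_def)

lemma exp_tangent: "exp q * (p - q) \<le> exp p - exp (q::real)"
proof -
  have "exp q * (1 + (p - q)) \<le> exp q * exp (p - q)"
    by (intro mult_left_mono exp_ge_add_one_self) auto
  also have "\<dots> = exp p" by (simp flip: exp_add)
  finally show ?thesis by (simp add: algebra_simps)
qed

text \<open>In logarithmic variables the mean is a difference quotient of \<open>exp\<close>, so it is monotone because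
  \<open>exp\<close> is convex.\<close>

lemma log_mean_exp_mono:
  assumes "p \<le> p'"
  shows "log_mean (exp p) (exp q) \<le> log_mean (exp p') (exp q)"
proof -
  have cvx: "convex_on UNIV (exp :: real \<Rightarrow> real)"
    by (rule exp_convex)
  have up: "exp q \<le> (exp r - exp q) / (r - q)" if "q < r" for r
    using exp_tangent[of q r] that by (simp add: field_simps)
  have down: "(exp r - exp q) / (r - q) \<le> exp q" if "r < q" for r
    using exp_tangent[of q r] that by (simp add: field_simps)
  consider "p = p'" | "p < p'" "p' < q" | "p < p'" "p' = q" | "p < q" "q < p'" | "p < p'" "p = q"
    | "p < p'" "q < p" using assms by linarith
  then show ?thesis
  proof cases
    case 2
    then show ?thesis
      using convex_on_slope_le(2)[OF cvx, of p q p']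
      by (simp add: log_mean_exp_slope)
  next
    case 3 then show ?thesis using down[of p] by (simp add: log_mean_exp_slope log_mean_def[of "exp q" "exp q"])
  next
    case 4 then show ?thesis using down[of p] up[of p'] by (simp add: log_mean_exp_slope)
  next
    case 5 then show ?thesis using up[of p'] by (simp add: log_mean_exp_slope log_mean_def[of "exp q" "exp q"])
  next
    case 6
    have "(exp q - exp p) / (q - p) \<le> (exp q - exp p') / (q - p')"
      using convex_on_slope_le(1)[OF cvx, of q p' p] 6 by simp
    moreover have "(exp q - exp p) / (q - p) = (exp p - exp q) / (p - q)"
      "(exp q - exp p') / (q - p') = (exp p' - exp q) / (p' - q)"
      by (metis minus_diff_eq minus_divide_divide)+
    ultimately show ?thesis using 6 by (simp add: log_mean_exp_slope)
  qed auto
qed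

lemma log_mean_mono1:
  assumes "0 \<le> a" "a \<le> a'" "0 \<le> b"
  shows "log_mean a b \<le> log_mean a' b"
proof (cases "a = 0 \<or> b = 0")
  case True
  then show ?thesis
    using assms log_mean_nonneg[of a' b] by (auto simp: log_mean_def)
next
  case False
  then have "log_mean (exp (ln a)) (exp (ln b)) \<le> log_mean (exp (ln a')) (exp (ln b))"
    using assms by (intro log_mean_exp_mono) auto
  then show ?thesis using False assms by simp
qed

lemma log_mean_mono:
  assumes "0 \<le> a" "a \<le> a'" "0 \<le> b" "b \<le> b'"
  shows "log_mean a b \<le> log_mean a' b'"
  using log_mean_mono1[of a a' b] log_mean_mono1[of b b' a'] assms
  by (simp add: log_mean_commute[of a'])

text \<open>In logarithmic variables this is the trapezoidal estimate for the integral of \<open>exp\<close>.\<close>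

lemma log_mean_exp_le_mean:
  assumes "q < p"
  shows "log_mean (exp p) (exp q) \<le> (exp p + exp q) / 2"
proof -
  let ?g = "\<lambda>s::real. s * (exp s + 1) - 2 * (exp s - 1)"
  \<comment> \<open>\<open>?g s\<close> is twice the error of the trapezoidal rule for \<open>exp\<close> on \<open>[0, s]\<close>.\<close>
  have "?g 0 \<le> ?g (p - q)"
  proof (rule DERIV_nonneg_imp_nondecreasing[of 0 "p - q" ?g])
    fix s :: real assume "0 \<le> s" "s \<le> p - q"
    have "(?g has_real_derivative 1 + (s - 1) * exp s) (at s)"
      by (auto intro!: derivative_eq_intros simp: algebra_simps)
    moreover have "0 \<le> 1 + (s - 1) * exp s"
    proof -
      have "(1 - s) * exp s \<le> exp (- s) * exp s"
        using exp_ge_add_one_self[of "- s"] by (intro mult_right_mono) auto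
      then show ?thesis by (simp add: algebra_simps flip: exp_add)
    qed
    ultimately show "\<exists>y. (?g has_real_derivative y) (at s) \<and> 0 \<le> y" by blast
  qed (use assms in simp)
  then have "exp q * (2 * (exp (p - q) - 1)) \<le> exp q * ((p - q) * (exp (p - q) + 1))"
    by (intro mult_left_mono) auto
  then have "2 * (exp q * exp (p - q) - exp q) \<le> (p - q) * (exp q * exp (p - q) + exp q)"
    by (simp add: algebra_simps)
  then have "2 * (exp p - exp q) \<le> (p - q) * (exp p + exp q)"
    by (simp flip: exp_add)
  then show ?thesis
    using assms by (simp add: log_mean_exp_slope field_simps)
qed

lemma log_mean_le_arith_mean:
  assumes "0 \<le> a" "0 \<le> b"
  shows "log_mean a b \<le> (a + b) / 2"
proof (cases "a = b \<or> a = 0 \<or> b = 0")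
  case True then show ?thesis using assms by (auto simp: log_mean_def)
next
  case False
  then have pos: "0 < a" "0 < b" using assms by auto
  consider "ln b < ln a" | "ln a < ln b" using False pos by (metis ln_less_cancel_iff neq_iff)
  then show ?thesis
    using log_mean_exp_le_mean[of "ln b" "ln a"] log_mean_exp_le_mean[of "ln a" "ln b"] pos
    by cases (auto simp: log_mean_commute[of a b] add.commute)
qed

lemma borel_measurable_log_mean [measurable (raw)]:
  assumes [measurable]: "u \<in> borel_measurable M" "v \<in> borel_measurable M"
  shows "(\<lambda>x. log_mean (u x) (v x)) \<in> borel_measurable M"
  unfolding log_mean_def by measurable

lemma hat_commute: "hat \<rho> x y = hat \<rho> y x"
  by (simp add: hat_def log_mean_commute)

text \<open>The form in which the logarithmic mean of two reference densities is compared: only the ratio of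
  the densities matters.\<close>

lemma hat_le_scaled:
  assumes "0 < c" "\<And>x. 0 \<le> \<rho> x" "\<And>x. \<rho> x \<le> c * \<rho>' x"
  shows "hat \<rho> x y \<le> c * hat \<rho>' x y"
proof -
  have nn: "0 \<le> \<rho>' z" for z
    using assms(2)[of z] assms(3)[of z] assms(1) by (metis order_trans zero_le_mult_iff not_less)
  have "hat \<rho> x y \<le> log_mean (c * \<rho>' x) (c * \<rho>' y)"
    unfolding hat_def using assms by (intro log_mean_mono) auto
  then show ?thesis using assms(1) nn by (simp add: log_mean_scale hat_def)
qed

section \<open>Integrals of derivatives and a compactness principle\<close>

text \<open>Jensen's inequality for the square, with weights \<open>\<tau>\<close>, \<open>1 - 2 \<tau>\<close>, \<open>\<tau>\<close> at the points
  \<open>a / \<tau>\<close>, \<open>b\<close>, \<open>c / \<tau>\<close>.\<close>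

lemma weighted_square_le:
  fixes a b c \<tau> :: real
  assumes "0 < \<tau>" "2 * \<tau> \<le> 1"
  shows "(a + (1 - 2 * \<tau>) * b + c)\<^sup>2 \<le> a\<^sup>2 / \<tau> + (1 - 2 * \<tau>) * b\<^sup>2 + c\<^sup>2 / \<tau>"
proof -
  define p where "p = a / \<tau>"
  define q where "q = c / \<tau>"
  have ac: "a = \<tau> * p" "c = \<tau> * q" using assms by (auto simp: p_def q_def)
  have "\<tau> * p\<^sup>2 + (1 - 2 * \<tau>) * b\<^sup>2 + \<tau> * q\<^sup>2 - (\<tau> * p + (1 - 2 * \<tau>) * b + \<tau> * q)\<^sup>2
      = \<tau> * (1 - 2 * \<tau>) * (p - b)\<^sup>2 + \<tau> * \<tau> * (p - q)\<^sup>2 + \<tau> * (1 - 2 * \<tau>) * (q - b)\<^sup>2"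
    by (simp add: power2_eq_square algebra_simps)
  moreover have "0 \<le> \<tau> * (1 - 2 * \<tau>) * (p - b)\<^sup>2 + \<tau> * \<tau> * (p - q)\<^sup>2 + \<tau> * (1 - 2 * \<tau>) * (q - b)\<^sup>2"
    using assms by (intro add_nonneg_nonneg mult_nonneg_nonneg) auto
  moreover have "a\<^sup>2 / \<tau> = \<tau> * p\<^sup>2" "c\<^sup>2 / \<tau> = \<tau> * q\<^sup>2"
    using assms by (auto simp: ac power2_eq_square)
  ultimately show ?thesis unfolding ac(1,2) by (simp add: ac)
qed

lemma ennreal_lessD: "ennreal a < ennreal b \<Longrightarrow> a < b"
  by (metis ennreal_leI not_le)

lemma null_lebesgue_finite: "finite F \<Longrightarrow> AE t in lebesgue. (t::real) \<notin> F"
  by (intro AE_not_in null_sets_completionI finite_imp_null_set_lborel)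

text \<open>A continuous function that is continuously differentiable off a finite set can have a derivative
  that is not Lebesgue integrable. The increment is still controlled by the integral of the
  positive part of the derivative, which is what \<^const>\<open>ennreal\<close> extracts.\<close>

lemma nn_integral_derivative_ge:
  fixes u u' :: "real \<Rightarrow> real"
  assumes ab: "a \<le> b" and cont: "continuous_on {a..b} u" and fin: "finite S"
    and der: "\<And>t. t \<in> {a<..<b} - S \<Longrightarrow> (u has_real_derivative u' t) (at t)"
    and meas [measurable]: "u' \<in> borel_measurable borel"
  shows "ennreal (u b - u a) \<le> (\<integral>\<^sup>+ t. ennreal (u' t) * indicator {a<..<b} t \<partial>lborel)"
proof -
  let ?g = "\<lambda>t. max 0 (u' t) * indicator {a<..<b} t"
  let ?I = "\<integral>\<^sup>+ t. ennreal (?g t) \<partial>lborel"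
  have eq: "ennreal (u' t) * indicator {a<..<b} t = ennreal (?g t)" for t
    by (auto simp: indicator_def max_def ennreal_neg)
  show ?thesis
  proof (cases ?I)
    case (real r)
    have "(?g has_integral r) UNIV"
      using real by (intro nn_integral_has_integral) auto
    moreover have "(\<lambda>t. if t \<in> {a<..<b} then max 0 (u' t) else 0) = ?g"
      by (auto simp: fun_eq_iff indicator_def)
    ultimately have up: "((\<lambda>t. max 0 (u' t)) has_integral r) {a<..<b}"
      by (subst has_integral_restrict_UNIV[symmetric]) simp
    have "(u' has_integral (u b - u a)) {a..b}"
      by (rule fundamental_theorem_of_calculus_interior_strong[OF fin ab _ cont])
        (use der in \<open>auto simp: has_real_derivative_iff_has_vector_derivative\<close>)
    then have "(u' has_integral (u b - u a)) {a<..<b}"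
      by (simp add: has_integral_Icc_iff_Ioo)
    from has_integral_le[OF this up] have "u b - u a \<le> r" by simp
    then show ?thesis unfolding eq real(2) by (rule ennreal_leI)
  next
    case top
    then show ?thesis unfolding eq by simp
  qed
qed

lemma ennreal_sum_le: "ennreal (sum r A) \<le> (\<Sum>i\<in>A. ennreal (r i))"
proof -
  have "ennreal (sum r A) \<le> ennreal (\<Sum>i\<in>A. max 0 (r i))"
    by (intro ennreal_leI sum_mono) auto
  also have "\<dots> = (\<Sum>i\<in>A. ennreal (max 0 (r i)))"
    by (intro sum_ennreal[symmetric]) auto
  also have "\<dots> = (\<Sum>i\<in>A. ennreal (r i))"
    by (intro sum.cong refl) (auto simp: max_def ennreal_neg)
  finally show ?thesis .
qed

text \<open>One exceptional set and one Borel measurable velocity for all coordinates of the curve. The set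
  contains the end points, so that the derivatives are taken at interior points.\<close>

lemma piecewise_C1_velocity:
  fixes \<rho> :: "real \<Rightarrow> 'b::finite \<Rightarrow> real"
  assumes "\<And>x. (\<lambda>t. \<rho> t x) piecewise_C1_differentiable_on {a..b}"
  obtains F D where "finite F" "a \<in> F" "b \<in> F"
    "\<And>t x. t \<in> {a..b} - F \<Longrightarrow> ((\<lambda>s. \<rho> s x) has_real_derivative D t x) (at t)"
    "\<And>x. (\<lambda>t. D t x) \<in> borel_measurable borel"
proof -
  have "\<exists>F D. finite F \<and> (\<forall>t\<in>{a..b} - F. ((\<lambda>s. \<rho> s x) has_vector_derivative D t) (at t)) \<and>
      continuous_on ({a..b} - F) D" for x
    using assms[of x] unfolding piecewise_C1_differentiable_on_def C1_differentiable_on_def by blast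
  then obtain F D where FD: "\<And>x. finite (F x)"
    "\<And>x t. t \<in> {a..b} - F x \<Longrightarrow> ((\<lambda>s. \<rho> s x) has_vector_derivative D x t) (at t)"
    "\<And>x. continuous_on ({a..b} - F x) (D x)"
    by metis
  define G where "G = {a, b} \<union> (\<Union>x. F x)"
  define E where "E = (\<lambda>t x. indicator ({a..b} - G) t *\<^sub>R D x t)"
  have G: "finite G" "a \<in> G" "b \<in> G" using FD(1) by (auto simp: G_def)
  moreover have "((\<lambda>s. \<rho> s x) has_real_derivative E t x) (at t)" if "t \<in> {a..b} - G" for t x
  proof -
    have "((\<lambda>s. \<rho> s x) has_vector_derivative D x t) (at t)"
      using that by (intro FD(2)) (auto simp: G_def)
    then show ?thesis
      using that by (simp add: has_real_derivative_iff_has_vector_derivative E_def)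
  qed
  moreover have "(\<lambda>t. E t x) \<in> borel_measurable borel" for x
    unfolding E_def
  proof (rule borel_measurable_continuous_on_indicator)
    show "{a..b} - G \<in> sets borel"
      using G(1) by (intro sets.Diff borel_closed finite_imp_closed closed_atLeastAtMost)
    show "continuous_on ({a..b} - G) (D x)"
      by (rule continuous_on_subset[OF FD(3)[of x]]) (auto simp: G_def)
  qed
  ultimately show thesis by (rule that)
qed

lemma compact_bounded_functions:
  "compact {g :: 'i \<Rightarrow> 'b::finite \<Rightarrow> real. \<forall>t z. g t z \<in> {-M..M}}"
proof -
  have 1: "compact (PiE UNIV (\<lambda>_::'b. {-M..M::real}))"
    using compactin_PiE[of "\<lambda>_::'b. euclidean :: real topology" UNIV "\<lambda>_. {-M..M}"]
    by (simp add: euclidean_product_topology)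
  have "compact (PiE UNIV (\<lambda>_::'i. PiE UNIV (\<lambda>_::'b. {-M..M::real})))"
    using compactin_PiE[of "\<lambda>_::'i. euclidean :: ('b \<Rightarrow> real) topology" UNIV
        "\<lambda>_. PiE UNIV (\<lambda>_::'b. {-M..M::real})"] 1
    by (simp add: euclidean_product_topology)
  moreover have "PiE UNIV (\<lambda>_::'i. PiE UNIV (\<lambda>_::'b. {-M..M::real})) = {g. \<forall>t z. g t z \<in> {-M..M}}"
    by (auto simp: PiE_iff)
  ultimately show ?thesis by simp
qed

text \<open>A cluster point in the product topology, by Tychonoff's theorem. It is approximated along the
  sequence at any finitely many arguments simultaneously; the distance between two points of a limit
  curve involves two of them.\<close>

lemma cluster_function:
  fixes g :: "nat \<Rightarrow> 'i \<Rightarrow> 'b::finite \<Rightarrow> real"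
  assumes bound: "\<And>k t z. \<bar>g k t z\<bar> \<le> M"
  obtains \<gamma> where "\<forall>t u \<epsilon> N. 0 < \<epsilon> \<longrightarrow>
    (\<exists>k\<ge>N. \<forall>z. \<bar>g k t z - \<gamma> t z\<bar> < \<epsilon> \<and> \<bar>g k u z - \<gamma> u z\<bar> < \<epsilon>)"
proof -
  let ?K = "{g :: 'i \<Rightarrow> 'b \<Rightarrow> real. \<forall>t z. g t z \<in> {-M..M}}"
  have "\<forall>k. g k \<in> ?K"
    using bound by (simp add: abs_le_iff minus_le_iff)
  then have "eventually (\<lambda>h. h \<in> ?K) (filtermap g sequentially)"
    by (simp add: eventually_filtermap)
  moreover have "filtermap g sequentially \<noteq> bot" by (simp add: filtermap_bot_iff)
  ultimately obtain \<gamma> where \<gamma>: "inf (nhds \<gamma>) (filtermap g sequentially) \<noteq> bot"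
    using compact_bounded_functions[of M] unfolding compact_filter by blast
  have cl: "\<exists>k\<ge>N. \<forall>z. \<bar>g k t z - \<gamma> t z\<bar> < \<epsilon> \<and> \<bar>g k u z - \<gamma> u z\<bar> < \<epsilon>" if \<epsilon>: "0 < \<epsilon>" for t u \<epsilon> N
  proof -
    let ?V = "\<lambda>p. {v :: 'b \<Rightarrow> real. \<forall>z\<in>UNIV. v z \<in> ball (\<gamma> p z) \<epsilon>}"
    let ?U = "{h. \<forall>p\<in>{t, u}. h p \<in> ?V p}"
    have "open (?V p)" for p
      by (rule product_topology_basis'[where x = "\<lambda>z. z"]) auto
    then have "open ?U"
      by (intro product_topology_basis'[where x = "\<lambda>p. p"]) auto
    moreover have "\<gamma> \<in> ?U" using \<epsilon> by simp
    ultimately have "eventually (\<lambda>h. h \<in> ?U) (nhds \<gamma>)" by (rule eventually_nhds_in_open)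
    moreover have "eventually (\<lambda>h. \<exists>k\<ge>N. h = g k) (filtermap g sequentially)"
      unfolding eventually_filtermap using eventually_ge_at_top[of N] by eventually_elim blast
    ultimately have "eventually (\<lambda>h. h \<in> ?U \<and> (\<exists>k\<ge>N. h = g k)) (inf (nhds \<gamma>) (filtermap g sequentially))"
      unfolding eventually_inf by blast
    then obtain h where "h \<in> ?U" "\<exists>k\<ge>N. h = g k"
      using eventually_happens'[OF \<gamma>] by blast
    then show ?thesis by (auto simp: dist_real_def abs_minus_commute)
  qed
  show thesis by (rule that[of \<gamma>]) (use cl in blast)
qed

section \<open>The Riemannian structure of a reversible chain\<close>

locale reversible_chain =
  fixes Q :: "'a::finite \<Rightarrow> 'a \<Rightarrow> real" and \<pi> :: "'a \<Rightarrow> real"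
  assumes markov: "markov_kernel Q"
    and irreducible: "irreducible_kernel Q"
    and stationary: "stationary_distribution Q \<pi>"
    and reversible: "reversible Q \<pi>"
begin

abbreviation \<A> :: "('a \<Rightarrow> real) \<Rightarrow> ('a \<Rightarrow> real) \<Rightarrow> real" where
  "\<A> \<equiv> act Q \<pi>"

abbreviation \<W> :: "('a \<Rightarrow> real) \<Rightarrow> ('a \<Rightarrow> real) \<Rightarrow> real" where
  "\<W> \<equiv> transport_dist Q \<pi>"

abbreviation path_action :: "(real \<Rightarrow> 'a \<Rightarrow> real) \<Rightarrow> (real \<Rightarrow> 'a \<Rightarrow> real) \<Rightarrow> ennreal" where
  "path_action \<rho> f \<equiv> \<integral>\<^sup>+ t. ennreal (act Q \<pi> (\<rho> t) (f t)) \<partial>lebesgue_on {0..1}"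

lemma Q_nonneg: "0 \<le> Q x y"
  using markov by (auto simp: markov_kernel_def)

lemma Q_sum: "(\<Sum>y\<in>UNIV. Q x y) = 1"
  using markov by (auto simp: markov_kernel_def)

lemma pi_sum: "(\<Sum>x\<in>UNIV. \<pi> x) = 1"
  using stationary by (auto simp: stationary_distribution_def)

lemma detailed_balance: "Q x y * \<pi> x = Q y x * \<pi> y"
  using reversible by (auto simp: reversible_def)

lemma pi_pos: "0 < \<pi> x"
proof -
  have nn: "0 \<le> \<pi> z" for z
    using stationary by (auto simp: stationary_distribution_def)
  obtain z where z: "0 < \<pi> z"
    using pi_sum nn by (metis less_eq_real_def sum.neutral zero_neq_one)
  have "(adjacent Q)\<^sup>*\<^sup>* z x"
    using irreducible by (auto simp: irreducible_kernel_def)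
  then show ?thesis
  proof (induction rule: rtranclp_induct)
    case (step u w)
    then have "0 < Q u w * \<pi> u"
      by (simp add: adjacent_def)
    then have "0 < Q w u * \<pi> w"
      using detailed_balance[of u w] by simp
    then show ?case
      using nn[of w] by (metis less_eq_real_def mult_zero_right order_less_irrefl)
  qed (rule z)
qed

lemma pi_nonneg: "0 \<le> \<pi> x"
  using pi_pos[of x] by simp

text \<open>Detailed balance in the form of an exchange of the two end points of an edge.\<close>

lemma sum_balance:
  "(\<Sum>x\<in>UNIV. \<Sum>y\<in>UNIV. F x y * Q x y * \<pi> x) = (\<Sum>x\<in>UNIV. \<Sum>y\<in>UNIV. F y x * Q x y * \<pi> x)"
  for F :: "'a \<Rightarrow> 'a \<Rightarrow> real"
  by (subst sum.swap) (simp add: mult.assoc detailed_balance)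

definition inner :: "('a \<Rightarrow> real) \<Rightarrow> ('a \<Rightarrow> real) \<Rightarrow> real" where
  "inner u v = (\<Sum>x\<in>UNIV. u x * v x * \<pi> x)"

abbreviation mean :: "('a \<Rightarrow> real) \<Rightarrow> real" where
  "mean v \<equiv> inner (\<lambda>_. 1) v"

text \<open>The operator \<open>\<psi> \<mapsto> - div(\<rho>^ \<nabla>\<psi>)\<close>. A tangent vector \<open>v\<close> at \<open>\<rho>\<close> is the velocity
  \<open>flow \<rho> \<psi>\<close> of a potential \<open>\<psi>\<close>.\<close>

definition flow :: "('a \<Rightarrow> real) \<Rightarrow> ('a \<Rightarrow> real) \<Rightarrow> 'a \<Rightarrow> real" where
  "flow \<rho> \<psi> x = (\<Sum>y\<in>UNIV. hat \<rho> x y * (\<psi> x - \<psi> y) * Q x y)"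

lemma inner_commute: "inner u v = inner v u"
  by (simp add: inner_def mult.commute)

lemma inner_add_right: "inner u (\<lambda>x. v x + w x) = inner u v + inner u w"
  by (simp add: inner_def algebra_simps sum.distrib)

lemma inner_diff_right: "inner u (\<lambda>x. v x - w x) = inner u v - inner u w"
  by (simp add: inner_def algebra_simps sum_subtractf)

lemma inner_scale_right: "inner u (\<lambda>x. c * v x) = c * inner u v"
  by (simp add: inner_def sum_distrib_left mult_ac)

lemma inner_diff_left: "inner (\<lambda>x. v x - w x) u = inner v u - inner w u"
  by (simp add: inner_def algebra_simps sum_subtractf)

lemma inner_add_left: "inner (\<lambda>x. v x + w x) u = inner v u + inner w u"
  by (simp add: inner_def algebra_simps sum.distrib)

lemma inner_scale_left: "inner (\<lambda>x. c * v x) u = c * inner v u"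
  by (simp add: inner_def sum_distrib_left mult_ac)

lemma flow_diff: "flow \<rho> (\<lambda>x. v x - w x) = (\<lambda>x. flow \<rho> v x - flow \<rho> w x)"
  by (simp add: flow_def fun_eq_iff algebra_simps sum.distrib sum_subtractf)

lemma flow_scale: "flow \<rho> (\<lambda>x. c * v x) = (\<lambda>x. c * flow \<rho> v x)"
  by (simp add: flow_def fun_eq_iff algebra_simps sum_distrib_left)

text \<open>Integration by parts: symmetrise over the two end points of every edge.\<close>

lemma inner_flow:
  "inner \<phi> (flow \<rho> \<psi>) =
     1/2 * (\<Sum>x\<in>UNIV. \<Sum>y\<in>UNIV. ((\<phi> y - \<phi> x) * (\<psi> y - \<psi> x) * hat \<rho> x y) * Q x y * \<pi> x)"
proof -
  let ?F = "\<lambda>x y. \<phi> x * (\<psi> x - \<psi> y) * hat \<rho> x y"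
  have 1: "inner \<phi> (flow \<rho> \<psi>) = (\<Sum>x\<in>UNIV. \<Sum>y\<in>UNIV. ?F x y * Q x y * \<pi> x)"
    by (simp add: inner_def flow_def sum_distrib_left sum_distrib_right mult_ac)
  have "2 * inner \<phi> (flow \<rho> \<psi>)
      = (\<Sum>x\<in>UNIV. \<Sum>y\<in>UNIV. ?F x y * Q x y * \<pi> x) + (\<Sum>x\<in>UNIV. \<Sum>y\<in>UNIV. ?F y x * Q x y * \<pi> x)"
    using 1 sum_balance[of ?F] by simp
  also have "\<dots> = (\<Sum>x\<in>UNIV. \<Sum>y\<in>UNIV. ((\<phi> y - \<phi> x) * (\<psi> y - \<psi> x) * hat \<rho> x y) * Q x y * \<pi> x)"
    by (simp add: sum.distrib[symmetric] hat_commute[of \<rho> y x for x y] flip: sum.distrib)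
      (intro sum.cong refl, simp add: algebra_simps hat_commute[of \<rho>])
  finally show ?thesis by simp
qed

lemma act_eq_inner_flow: "\<A> \<rho> \<psi> = inner \<psi> (flow \<rho> \<psi>)"
  by (simp add: inner_flow act_def power2_eq_square)

lemma inner_flow_commute: "inner \<phi> (flow \<rho> \<psi>) = inner \<psi> (flow \<rho> \<phi>)"
  by (simp add: inner_flow mult_ac)

lemma inner_one_flow: "mean (flow \<rho> \<psi>) = 0"
  by (simp add: inner_flow)

lemma act_nonneg:
  assumes "\<And>x. 0 \<le> \<rho> x"
  shows "0 \<le> \<A> \<rho> \<psi>"
  unfolding act_def hat_def
  by (intro mult_nonneg_nonneg sum_nonneg) (auto simp: Q_nonneg pi_nonneg log_mean_nonneg assms)

lemma act_scale: "\<A> \<rho> (\<lambda>x. c * \<psi> x) = c\<^sup>2 * \<A> \<rho> \<psi>"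
  by (simp add: act_eq_inner_flow inner_scale_left inner_scale_right flow_scale power2_eq_square)

lemma act_diff:
  "\<A> \<rho> (\<lambda>x. \<phi> x - \<psi> x) =
     \<A> \<rho> \<phi> - 2 * inner \<phi> (flow \<rho> \<psi>) + \<A> \<rho> \<psi>"
  using inner_flow_commute[of \<phi> \<rho> \<psi>]
  by (simp add: act_eq_inner_flow flow_diff inner_diff_left inner_diff_right)

lemma act_le_scaled:
  assumes "0 < c" "\<And>x. 0 \<le> \<rho> x" "\<And>x. \<rho> x \<le> c * \<rho>' x"
  shows "\<A> \<rho> \<psi> \<le> c * \<A> \<rho>' \<psi>"
proof -
  have "(\<Sum>x\<in>UNIV. \<Sum>y\<in>UNIV. (\<psi> y - \<psi> x)\<^sup>2 * hat \<rho> x y * Q x y * \<pi> x)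
     \<le> (\<Sum>x\<in>UNIV. \<Sum>y\<in>UNIV. (\<psi> y - \<psi> x)\<^sup>2 * (c * hat \<rho>' x y) * Q x y * \<pi> x)"
    by (intro sum_mono mult_right_mono mult_left_mono hat_le_scaled assms) (auto simp: Q_nonneg pi_nonneg)
  also have "\<dots> = c * (\<Sum>x\<in>UNIV. \<Sum>y\<in>UNIV. (\<psi> y - \<psi> x)\<^sup>2 * hat \<rho>' x y * Q x y * \<pi> x)"
    by (simp add: sum_distrib_left mult_ac)
  finally show ?thesis by (simp add: act_def)
qed

text \<open>The arithmetic mean dominates the logarithmic mean, and by detailed balance both of its summands
  contribute the same.\<close>

lemma act_le_Gam:
  assumes "\<And>x. 0 \<le> \<rho> x"
  shows "\<A> \<rho> \<psi> \<le> 1/2 * inner (Gam Q \<psi>) \<rho>"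
proof -
  let ?F = "\<lambda>x y. (\<psi> y - \<psi> x)\<^sup>2 * \<rho> x"
  have "(\<Sum>x\<in>UNIV. \<Sum>y\<in>UNIV. (\<psi> y - \<psi> x)\<^sup>2 * hat \<rho> x y * Q x y * \<pi> x)
     \<le> (\<Sum>x\<in>UNIV. \<Sum>y\<in>UNIV. (\<psi> y - \<psi> x)\<^sup>2 * ((\<rho> x + \<rho> y) / 2) * Q x y * \<pi> x)"
    unfolding hat_def
    by (intro sum_mono mult_right_mono mult_left_mono log_mean_le_arith_mean assms)
      (auto simp: Q_nonneg pi_nonneg)
  also have "\<dots> = 1/2 * ((\<Sum>x\<in>UNIV. \<Sum>y\<in>UNIV. ?F x y * Q x y * \<pi> x)
                      + (\<Sum>x\<in>UNIV. \<Sum>y\<in>UNIV. ?F y x * Q x y * \<pi> x))"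
    by (simp add: sum_distrib_left flip: sum.distrib)
      (intro sum.cong refl, simp add: algebra_simps power2_commute)
  also have "\<dots> = (\<Sum>x\<in>UNIV. \<Sum>y\<in>UNIV. ?F x y * Q x y * \<pi> x)"
    using sum_balance[of ?F] by simp
  also have "\<dots> = inner (Gam Q \<psi>) \<rho>"
    by (simp add: inner_def Gam_def sum_distrib_left sum_distrib_right mult_ac)
  finally show ?thesis by (simp add: act_def)
qed

text \<open>The continuity equation reads \<open>\<rho>' = flow \<rho> f\<close>.\<close>

lemma continuity_flux: "- divergence Q (\<lambda>y z. hat \<rho> y z * grad f y z) x = flow \<rho> f x"
proof -
  have "(\<Sum>y\<in>UNIV. (hat \<rho> x y * grad f x y - hat \<rho> y x * grad f y x) * Q x y)
      = (\<Sum>y\<in>UNIV. - 2 * (hat \<rho> x y * (f x - f y) * Q x y))"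
    by (intro sum.cong refl) (simp add: grad_def hat_commute[of \<rho> _ x] algebra_simps)
  also have "\<dots> = - 2 * flow \<rho> f x"
    unfolding flow_def by (rule sum_distrib_left[symmetric])
  finally show ?thesis
    by (simp add: divergence_def)
qed

subsection \<open>Inverting the flow operator\<close>

text \<open>Irreducibility enters here: a function without gradient along the edges is constant.\<close>

lemma act_zero_imp_const:
  assumes pos: "\<And>x. 0 < \<rho> x" and zero: "\<A> \<rho> \<psi> = 0"
  shows "\<psi> x = \<psi> y"
proof -
  have nn: "0 \<le> (\<psi> y - \<psi> x)\<^sup>2 * hat \<rho> x y * Q x y * \<pi> x" for x y
    unfolding hat_def
    by (intro mult_nonneg_nonneg) (auto simp: Q_nonneg pi_nonneg log_mean_nonneg less_imp_le[OF pos])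
  have "(\<Sum>x\<in>UNIV. \<Sum>y\<in>UNIV. (\<psi> y - \<psi> x)\<^sup>2 * hat \<rho> x y * Q x y * \<pi> x) = 0"
    using zero by (simp add: act_def)
  then have terms: "(\<psi> y - \<psi> x)\<^sup>2 * hat \<rho> x y * Q x y * \<pi> x = 0" for x y
    by (simp add: sum_nonneg_eq_0_iff nn sum_nonneg)
  then have adj: "\<psi> x = \<psi> y" if "adjacent Q x y" for x y
  proof -
    have "0 < hat \<rho> x y * Q x y * \<pi> x"
      using that pi_pos[of x] log_mean_pos[OF pos[of x] pos[of y]]
      by (simp add: adjacent_def hat_def)
    then show ?thesis
      using terms[of y x] by (auto simp: mult.assoc)
  qed
  have "(adjacent Q)\<^sup>*\<^sup>* x y"
    using irreducible by (auto simp: irreducible_kernel_def)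
  then show ?thesis
    by (induction rule: rtranclp_induct) (auto dest: adj)
qed

text \<open>The matrix of \<open>\<psi> \<mapsto> flow \<rho> \<psi> + \<langle>1, \<psi>\<rangle>\<close>. The kernel of the flow operator consists of the
  constants and its range of the functions of mean zero; adding the mean removes the kernel.\<close>

definition flow_matrix :: "('a \<Rightarrow> real) \<Rightarrow> real^'a^'a" where
  "flow_matrix \<rho> =
     (\<chi> x y. (if x = y then \<Sum>z\<in>UNIV. hat \<rho> x z * Q x z else 0) - hat \<rho> x y * Q x y + \<pi> y)"

lemma flow_matrix_mult:
  "(flow_matrix \<rho> *v w) $ x = flow \<rho> (\<lambda>y. w $ y) x + (\<Sum>y\<in>UNIV. w $ y * \<pi> y)"
proof -
  let ?D = "\<Sum>z\<in>UNIV. hat \<rho> x z * Q x z"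
  have "(flow_matrix \<rho> *v w) $ x =
      (\<Sum>y\<in>UNIV. (if y = x then ?D * w $ x else 0) - hat \<rho> x y * Q x y * w $ y + w $ y * \<pi> y)"
    unfolding flow_matrix_def matrix_vector_mult_def vec_lambda_beta
    by (intro sum.cong refl) (auto simp: algebra_simps)
  also have "\<dots> = ?D * w $ x - (\<Sum>y\<in>UNIV. hat \<rho> x y * Q x y * w $ y) + (\<Sum>y\<in>UNIV. w $ y * \<pi> y)"
    by (simp add: sum.distrib sum_subtractf)
  also have "?D * w $ x - (\<Sum>y\<in>UNIV. hat \<rho> x y * Q x y * w $ y) = flow \<rho> (\<lambda>y. w $ y) x"
    unfolding flow_def sum_distrib_right sum_subtractf[symmetric]
    by (intro sum.cong refl) (simp add: left_diff_distrib right_diff_distrib mult_ac)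
  finally show ?thesis .
qed

lemma flow_matrix_eq_imp:
  assumes "flow_matrix \<rho> *v w = (\<chi> x. v x)" and "mean v = 0"
  shows "(\<Sum>y\<in>UNIV. w $ y * \<pi> y) = 0" and "flow \<rho> (\<lambda>y. w $ y) = v"
proof -
  let ?m = "\<Sum>y\<in>UNIV. w $ y * \<pi> y"
  have eq: "flow \<rho> (\<lambda>y. w $ y) x + ?m = v x" for x
    using assms(1) flow_matrix_mult[of \<rho> w x] by simp
  then have v: "v = (\<lambda>x. flow \<rho> (\<lambda>y. w $ y) x + ?m * 1)" by auto
  have "mean v = ?m"
    by (subst v, simp only: inner_add_right inner_scale_right inner_one_flow)
      (simp add: inner_def pi_sum)
  then show "?m = 0" using assms(2) by simp
  then show "flow \<rho> (\<lambda>y. w $ y) = v" using eq by auto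
qed

lemma det_flow_matrix:
  assumes pos: "\<And>x. 0 < \<rho> x"
  shows "det (flow_matrix \<rho>) \<noteq> 0"
proof -
  have "w = 0" if w: "flow_matrix \<rho> *v w = 0" for w
  proof -
    have w': "flow_matrix \<rho> *v w = (\<chi> x. (\<lambda>_. 0) x)"
      using w by (simp add: vec_eq_iff)
    have fl: "flow \<rho> (\<lambda>y. w $ y) = (\<lambda>_. 0)" and m: "(\<Sum>y\<in>UNIV. w $ y * \<pi> y) = 0"
      using flow_matrix_eq_imp[OF w'] by (auto simp: inner_def)
    have "\<A> \<rho> (\<lambda>y. w $ y) = 0"
      by (simp add: act_eq_inner_flow fl inner_def)
    from act_zero_imp_const[of \<rho>, OF pos this] have c: "w $ x = w $ y" for x y .
    have "w $ x = 0" for x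
    proof -
      have "(\<Sum>y\<in>UNIV. w $ y * \<pi> y) = (\<Sum>y\<in>UNIV. w $ x * \<pi> y)"
        by (intro sum.cong refl) (metis c)
      also have "\<dots> = w $ x"
        using pi_sum by (simp flip: sum_distrib_left)
      finally show ?thesis using m by simp
    qed
    then show ?thesis by (simp add: vec_eq_iff)
  qed
  then have "invertible (flow_matrix \<rho>)"
    by (meson invertible_left_inverse matrix_left_invertible_ker)
  then show ?thesis by (simp add: invertible_det_nz)
qed

text \<open>Cramer's rule for the solution of \<open>flow \<rho> \<psi> = v\<close>. This formula is measurable in \<open>\<rho>\<close> and
  \<open>v\<close> because determinants are polynomials in the entries.\<close>

definition potential :: "('a \<Rightarrow> real) \<Rightarrow> ('a \<Rightarrow> real) \<Rightarrow> 'a \<Rightarrow> real" where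
  "potential \<rho> v x =
     det (\<chi> i j. if j = x then v i else flow_matrix \<rho> $ i $ j) / det (flow_matrix \<rho>)"

lemma flow_potential:
  assumes pos: "\<And>x. 0 < \<rho> x" and "mean v = 0"
  shows "flow \<rho> (potential \<rho> v) = v"
proof -
  have "flow_matrix \<rho> *v (\<chi> x. potential \<rho> v x) = (\<chi> x. v x)"
    by (subst cramer[OF det_flow_matrix[OF pos]]) (simp add: vec_eq_iff potential_def cong: if_cong)
  from flow_matrix_eq_imp(2)[OF this assms(2)] show ?thesis by simp
qed

lemma borel_measurable_potential:
  assumes r: "\<And>x. (\<lambda>t. r t x) \<in> borel_measurable M" and v: "\<And>x. (\<lambda>t. v t x) \<in> borel_measurable M"
  shows "(\<lambda>t. potential (r t) (v t) x) \<in> borel_measurable M"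
proof -
  have h: "(\<lambda>t. hat (r t) y z) \<in> borel_measurable M" for y z
    unfolding hat_def by (intro borel_measurable_log_mean r)
  have m: "(\<lambda>t. flow_matrix (r t) $ y $ z) \<in> borel_measurable M" for y z
    unfolding flow_matrix_def
    by (cases "y = z") (auto intro!: borel_measurable_add borel_measurable_diff borel_measurable_sum
        borel_measurable_times h)
  have e: "(\<lambda>t. if z = x then v t y else flow_matrix (r t) $ y $ z) \<in> borel_measurable M" for y z
    by (cases "z = x") (auto intro: m v)
  show ?thesis
    unfolding potential_def det_def
    by (intro borel_measurable_divide borel_measurable_sum borel_measurable_times
        borel_measurable_prod borel_measurable_const m) (simp add: e)
qed

subsection \<open>The squared norm of a tangent vector\<close>

text \<open>The squared Riemannian norm of the tangent vector \<open>v\<close> at \<open>\<rho>\<close>.\<close>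

definition cost :: "('a \<Rightarrow> real) \<Rightarrow> ('a \<Rightarrow> real) \<Rightarrow> real" where
  "cost \<rho> v = inner (potential \<rho> v) v"

lemma cost_eq_inner:
  assumes pos: "\<And>x. 0 < \<rho> x" and fl: "flow \<rho> \<psi> = v"
  shows "cost \<rho> v = inner \<psi> v"
proof -
  have "mean v = 0" using inner_one_flow[of \<rho> \<psi>] fl by simp
  then have "flow \<rho> (potential \<rho> v) = v" by (intro flow_potential pos)
  then show ?thesis
    using inner_flow_commute[of "potential \<rho> v" \<rho> \<psi>] fl by (simp add: cost_def)
qed

lemma cost_eq_act:
  assumes pos: "\<And>x. 0 < \<rho> x" and fl: "flow \<rho> \<psi> = v"
  shows "cost \<rho> v = \<A> \<rho> \<psi>"
  using cost_eq_inner[OF assms] fl by (simp add: act_eq_inner_flow)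

text \<open>Nonnegativity of \<open>A(\<rho>, \<phi> - \<psi>)\<close> for the potential \<open>\<psi>\<close> of \<open>v\<close>; equality holds at
  \<open>\<phi> = \<psi>\<close>.\<close>

lemma cost_dual:
  assumes pos: "\<And>x. 0 < \<rho> x" and mz: "mean v = 0"
  shows "2 * inner \<phi> v - \<A> \<rho> \<phi> \<le> cost \<rho> v"
proof -
  let ?\<psi> = "potential \<rho> v"
  have fl: "flow \<rho> ?\<psi> = v" by (intro flow_potential assms)
  have "0 \<le> \<A> \<rho> (\<lambda>x. \<phi> x - ?\<psi> x)"
    by (intro act_nonneg less_imp_le pos)
  then show ?thesis
    using cost_eq_act[OF pos fl] by (simp add: act_diff fl)
qed

lemma cost_nonneg:
  assumes pos: "\<And>x. 0 < \<rho> x" and mz: "mean v = 0"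
  shows "0 \<le> cost \<rho> v"
  using cost_eq_act[OF pos flow_potential[OF pos mz]] act_nonneg[OF less_imp_le[OF pos]] by simp

lemma cost_scale:
  assumes pos: "\<And>x. 0 < \<rho> x" and mz: "mean v = 0"
  shows "cost \<rho> (\<lambda>x. c * v x) = c\<^sup>2 * cost \<rho> v"
proof -
  let ?\<psi> = "potential \<rho> v"
  have "flow \<rho> (\<lambda>x. c * ?\<psi> x) = (\<lambda>x. c * v x)"
    by (simp add: flow_scale flow_potential[OF assms])
  from cost_eq_act[OF pos this] cost_eq_act[OF pos flow_potential[OF assms]]
  show ?thesis by (simp add: act_scale)
qed

text \<open>The dual formula reverses the comparison of actions. A larger reference density makes it
  cheaper to realise a given velocity.\<close>

lemma cost_antimono:
  assumes pos: "\<And>x. 0 < \<rho> x" and pos': "\<And>x. 0 < \<rho>' x" and mz: "mean v = 0"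
    and c: "0 < c" and le: "\<And>x. \<rho> x \<le> c * \<rho>' x"
  shows "cost \<rho>' v \<le> c * cost \<rho> v"
proof -
  let ?\<psi> = "potential \<rho>' v"
  have fl: "flow \<rho>' ?\<psi> = v" by (intro flow_potential pos' mz)
  have c': "cost \<rho>' v = inner ?\<psi> v" "cost \<rho>' v = \<A> \<rho>' ?\<psi>"
    using cost_eq_inner[OF pos' fl] cost_eq_act[OF pos' fl] by auto
  have "2 * ((1/c) * inner ?\<psi> v) - (1/c)\<^sup>2 * \<A> \<rho> ?\<psi> \<le> cost \<rho> v"
    using cost_dual[OF pos mz, of "\<lambda>x. (1/c) * ?\<psi> x"] unfolding inner_scale_left act_scale .
  then have "2 * (cost \<rho>' v / c) \<le> cost \<rho> v + \<A> \<rho> ?\<psi> / c\<^sup>2"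
    by (simp add: c'(1) power_divide)
  also have "\<A> \<rho> ?\<psi> / c\<^sup>2 \<le> (c * cost \<rho>' v) / c\<^sup>2"
    unfolding c'(2) by (intro divide_right_mono act_le_scaled c le less_imp_le[OF pos]) auto
  also have "(c * cost \<rho>' v) / c\<^sup>2 = cost \<rho>' v / c"
    using c by (simp add: power2_eq_square)
  finally have "cost \<rho>' v / c \<le> cost \<rho> v" unfolding mult_2 by simp
  then show ?thesis using c by (simp add: field_simps)
qed

text \<open>By monotonicity in the density it is enough to consider the constant density, where the potential
  depends linearly on \<open>v\<close>.\<close>

lemma cost_le_sup_norm:
  obtains C where "0 < C" and
    "\<forall>\<rho> v s h. 0 < s \<longrightarrow> (\<forall>x. s \<le> \<rho> x) \<longrightarrow> mean v = 0 \<longrightarrow> (\<forall>x. \<bar>v x\<bar> \<le> h) \<longrightarrow>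
       cost \<rho> v \<le> C\<^sup>2 * h\<^sup>2 / s"
proof -
  let ?one = "\<lambda>_::'a. 1::real"
  obtain B where B: "flow_matrix ?one ** B = mat 1"
    using det_flow_matrix[of ?one] by (auto simp: invertible_det_nz[symmetric] invertible_def)
  define C where "C = sqrt (\<Sum>x\<in>UNIV. \<Sum>y\<in>UNIV. \<bar>B $ x $ y\<bar>) + 1"
  have C2: "(\<Sum>x\<in>UNIV. \<Sum>y\<in>UNIV. \<bar>B $ x $ y\<bar>) \<le> C\<^sup>2"
  proof -
    have "sqrt (\<Sum>x\<in>UNIV. \<Sum>y\<in>UNIV. \<bar>B $ x $ y\<bar>) \<le> C" by (simp add: C_def)
    then show ?thesis by (rule sqrt_le_D)
  qed
  show thesis
  proof
    show "0 < C" unfolding C_def by (intro add_nonneg_pos) (auto intro!: sum_nonneg)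
    show "\<forall>\<rho> v s h. 0 < s \<longrightarrow> (\<forall>x. s \<le> \<rho> x) \<longrightarrow> mean v = 0 \<longrightarrow>
        (\<forall>x. \<bar>v x\<bar> \<le> h) \<longrightarrow> cost \<rho> v \<le> C\<^sup>2 * h\<^sup>2 / s"
    proof (intro allI impI)
      fix \<rho> v :: "'a \<Rightarrow> real" and s h :: real
      assume s: "0 < s" and all: "\<forall>x. s \<le> \<rho> x" "\<forall>x. \<bar>v x\<bar> \<le> h" and mz: "mean v = 0"
      have \<rho>: "s \<le> \<rho> x" and h: "\<bar>v x\<bar> \<le> h" for x using all by auto
      have h0: "0 \<le> h" using h[of undefined] by simp
      have pos: "0 < \<rho> x" for x using s \<rho>[of x] by simp
      let ?w = "B *v (\<chi> x. v x)"
      have "flow_matrix ?one *v ?w = (\<chi> x. v x)"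
        by (simp add: matrix_vector_mul_assoc B)
      then have fl: "flow ?one (\<lambda>y. ?w $ y) = v"
        by (rule flow_matrix_eq_imp(2)) (rule mz)
      have "cost \<rho> v \<le> (1/s) * cost ?one v"
        by (intro cost_antimono pos mz) (use s \<rho> in \<open>auto simp: field_simps\<close>)
      also have "cost ?one v = inner (\<lambda>y. ?w $ y) v"
        by (rule cost_eq_inner[OF _ fl]) simp
      also have "\<dots> \<le> (\<Sum>x\<in>UNIV. (\<Sum>y\<in>UNIV. \<bar>B $ x $ y\<bar>) * h * h)"
        unfolding inner_def
      proof (intro sum_mono)
        fix x
        have "\<pi> x \<le> 1"
          using member_le_sum[of x UNIV \<pi>] pi_nonneg pi_sum by auto
        have "\<bar>?w $ x\<bar> \<le> (\<Sum>y\<in>UNIV. \<bar>B $ x $ y\<bar> * h)"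
          unfolding matrix_vector_mult_def vec_lambda_beta
          by (intro order_trans[OF sum_abs] sum_mono) (simp add: abs_mult h mult_left_mono)
        then have w: "\<bar>?w $ x\<bar> \<le> (\<Sum>y\<in>UNIV. \<bar>B $ x $ y\<bar>) * h"
          by (simp add: sum_distrib_right)
        have "?w $ x * v x * \<pi> x \<le> \<bar>?w $ x * v x\<bar> * 1"
          using pi_nonneg[of x] \<open>\<pi> x \<le> 1\<close> by (intro mult_mono) auto
        also have "\<dots> \<le> ((\<Sum>y\<in>UNIV. \<bar>B $ x $ y\<bar>) * h) * h"
          unfolding abs_mult mult_1_right
          by (intro mult_mono w h) (auto intro!: mult_nonneg_nonneg sum_nonneg h0)
        finally show "?w $ x * v x * \<pi> x \<le> (\<Sum>y\<in>UNIV. \<bar>B $ x $ y\<bar>) * h * h" .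
      qed
      also have "\<dots> = (\<Sum>x\<in>UNIV. \<Sum>y\<in>UNIV. \<bar>B $ x $ y\<bar>) * h\<^sup>2"
        unfolding power2_eq_square mult.assoc by (rule sum_distrib_right[symmetric])
      also have "\<dots> \<le> C\<^sup>2 * h\<^sup>2" by (intro mult_right_mono C2) auto
      finally show "cost \<rho> v \<le> C\<^sup>2 * h\<^sup>2 / s"
        using s by (simp add: divide_right_mono)
    qed
  qed
qed

section \<open>Curves and the transport distance\<close>

lemma density_velocity_mean_zero:
  assumes dens: "\<And>s. s \<in> {a..b} \<Longrightarrow> \<rho> s \<in> densities \<pi>" and t: "a < t" "t < b"
    and der: "\<And>x. ((\<lambda>s. \<rho> s x) has_real_derivative v x) (at t)"
  shows "mean v = 0"
proof -
  have "((\<lambda>s. \<Sum>x\<in>UNIV. \<rho> s x * \<pi> x) has_real_derivative (\<Sum>x\<in>UNIV. v x * \<pi> x)) (at t)"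
    by (auto intro!: derivative_eq_intros der)
  moreover have "((\<lambda>s. \<Sum>x\<in>UNIV. \<rho> s x * \<pi> x) has_real_derivative 0) (at t)"
  proof (rule has_field_derivative_transform_within_open[where S = "{a<..<b}"])
    show "((\<lambda>s. 1) has_real_derivative 0) (at t)" by simp
    show "1 = (\<Sum>x\<in>UNIV. \<rho> s x * \<pi> x)" if "s \<in> {a<..<b}" for s
      using dens[of s] that by (simp add: densities_def mult.commute)
  qed (use t in auto)
  ultimately have "(\<Sum>x\<in>UNIV. v x * \<pi> x) = 0" by (rule DERIV_unique)
  then show ?thesis by (simp add: inner_def)
qed

text \<open>The dual description of the action, tested with one function \<open>\<phi> i\<close> on each time interval: at
  almost every time \<open>A(\<rho>, f) \<ge> 2 \<langle>\<phi>, \<rho>'\<rangle> - A(\<rho>, \<phi>)\<close>. All later lower bounds for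
  \<open>\<W>\<close> are instances.\<close>

lemma action_lower_bound:
  assumes adm: "admissible Q \<pi> x y \<rho> f" and mono: "mono \<tau>"
    and ends: "0 \<le> \<tau> 0" "\<tau> n \<le> 1"
    and bound: "\<And>i t. i < n \<Longrightarrow> t \<in> {\<tau> i..\<tau> (Suc i)} \<Longrightarrow> \<A> (\<rho> t) (\<phi> i) \<le> c i"
  shows "ennreal (\<Sum>i<n. 2 * inner (\<phi> i) (\<lambda>z. \<rho> (\<tau> (Suc i)) z - \<rho> (\<tau> i) z) - c i * (\<tau> (Suc i) - \<tau> i))
    \<le> path_action \<rho> f"
proof -
  have pw: "(\<lambda>t. \<rho> t z) piecewise_C1_differentiable_on {0..1}" for z
    using adm by (simp add: admissible_def)
  have dens: "\<rho> t \<in> densities \<pi>" if "t \<in> {0..1}" for t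
    using adm that by (simp add: admissible_def)
  have ode: "AE t in lebesgue. t \<in> {0..1} \<longrightarrow>
     (\<forall>z. ((\<lambda>s. \<rho> s z) has_real_derivative flow (\<rho> t) (f t) z) (at t within {0..1}))"
    using adm unfolding admissible_def continuity_flux by (simp add: AE_restrict_space_iff)
  obtain F D where F: "finite F" "0 \<in> F" "1 \<in> F"
    and der: "\<And>t z. t \<in> {0..1} - F \<Longrightarrow> ((\<lambda>s. \<rho> s z) has_real_derivative D t z) (at t)"
    and meas: "\<And>z. (\<lambda>t. D t z) \<in> borel_measurable borel"
    using piecewise_C1_velocity[of \<rho> 0 1] pw by metis
  define u where "u = (\<lambda>i t. 2 * inner (\<phi> i) (\<rho> t) - c i * t)"
  define u' where "u' = (\<lambda>i t. 2 * inner (\<phi> i) (D t) - c i)"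
  have meas': "u' i \<in> borel_measurable borel" for i
    unfolding u'_def inner_def
    by (intro borel_measurable_diff borel_measurable_times borel_measurable_sum borel_measurable_const meas)
  have \<tau>01: "0 \<le> \<tau> i \<and> \<tau> i \<le> 1" if "i \<le> n" for i
    using that ends monoD[OF mono, of 0 i] monoD[OF mono, of i n] by simp
  have piece: "ennreal (u i (\<tau> (Suc i)) - u i (\<tau> i))
      \<le> (\<integral>\<^sup>+ t. ennreal (u' i t) * indicator {\<tau> i<..<\<tau> (Suc i)} t \<partial>lborel)" if i: "i < n" for i
  proof (rule nn_integral_derivative_ge[OF _ _ F(1) _ meas'])
    show "\<tau> i \<le> \<tau> (Suc i)" using monoD[OF mono, of i "Suc i"] by simp
    have sub: "{\<tau> i..\<tau> (Suc i)} \<subseteq> {0..1}" using \<tau>01[of i] \<tau>01[of "Suc i"] i by auto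
    have "continuous_on {\<tau> i..\<tau> (Suc i)} (\<lambda>t. \<rho> t z)" for z
      using pw[of z] sub unfolding piecewise_C1_differentiable_on_def by (meson continuous_on_subset)
    then show "continuous_on {\<tau> i..\<tau> (Suc i)} (u i)"
      unfolding u_def inner_def by (intro continuous_intros)
    fix t assume "t \<in> {\<tau> i<..<\<tau> (Suc i)} - F"
    then have "t \<in> {0..1} - F" using sub by auto
    then show "(u i has_real_derivative u' i t) (at t)"
      unfolding u_def u'_def inner_def
      by (auto intro!: derivative_eq_intros der simp: mult_ac)
  qed
  have diff: "2 * inner (\<phi> i) (\<lambda>z. \<rho> (\<tau> (Suc i)) z - \<rho> (\<tau> i) z) - c i * (\<tau> (Suc i) - \<tau> i)
      = u i (\<tau> (Suc i)) - u i (\<tau> i)" for i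
    by (simp add: u_def inner_diff_right algebra_simps)
  have "ennreal (\<Sum>i<n. u i (\<tau> (Suc i)) - u i (\<tau> i)) \<le> (\<Sum>i<n. ennreal (u i (\<tau> (Suc i)) - u i (\<tau> i)))"
    by (rule ennreal_sum_le)
  also have "\<dots> \<le> (\<Sum>i<n. \<integral>\<^sup>+ t. ennreal (u' i t) * indicator {\<tau> i<..<\<tau> (Suc i)} t \<partial>lborel)"
    by (intro sum_mono piece) auto
  also have "\<dots> = (\<integral>\<^sup>+ t. (\<Sum>i<n. ennreal (u' i t) * indicator {\<tau> i<..<\<tau> (Suc i)} t) \<partial>lborel)"
    using meas' by (intro nn_integral_sum[symmetric]) auto
  also have "\<dots> = (\<integral>\<^sup>+ t. (\<Sum>i<n. ennreal (u' i t) * indicator {\<tau> i<..<\<tau> (Suc i)} t) \<partial>lebesgue)"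
    by (simp add: nn_integral_completion)
  also have "\<dots> \<le> (\<integral>\<^sup>+ t. ennreal (\<A> (\<rho> t) (f t)) * indicator {0..1} t \<partial>lebesgue)"
  proof (rule nn_integral_mono_AE)
    show "AE t in lebesgue. (\<Sum>i<n. ennreal (u' i t) * indicator {\<tau> i<..<\<tau> (Suc i)} t)
        \<le> ennreal (\<A> (\<rho> t) (f t)) * indicator {0..1} t"
      using ode null_lebesgue_finite[OF F(1)]
    proof eventually_elim
      case (elim t)
      show ?case
      proof (cases "\<exists>i<n. t \<in> {\<tau> i<..<\<tau> (Suc i)}")
        case False
        then have "(\<Sum>i<n. ennreal (u' i t) * indicator {\<tau> i<..<\<tau> (Suc i)} t) = 0"
          by (intro sum.neutral) (auto simp: indicator_def)
        then show ?thesis by simp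
      next
        case True
        then obtain i where i: "i < n" "t \<in> {\<tau> i<..<\<tau> (Suc i)}" by blast
        have t01: "t \<in> {0..1}" using i \<tau>01[of i] \<tau>01[of "Suc i"] by auto
        have t: "0 < t" "t < 1" using i \<tau>01[of i] \<tau>01[of "Suc i"] by auto
        have nn: "0 \<le> \<rho> t z" for z using dens[OF t01] by (simp add: densities_def)
        have other: "t \<notin> {\<tau> j<..<\<tau> (Suc j)}" if "j \<noteq> i" for j
          using i(2) that monoD[OF mono, of "Suc i" j] monoD[OF mono, of "Suc j" i]
          by (cases "j < i") auto
        have "(\<Sum>j<n. ennreal (u' j t) * indicator {\<tau> j<..<\<tau> (Suc j)} t)
            = (\<Sum>j<n. if j = i then ennreal (u' i t) else 0)"
          by (intro sum.cong refl) (use i other in \<open>auto simp: indicator_def\<close>)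
        also have "\<dots> = ennreal (u' i t)" using i by simp
        also have "\<dots> \<le> ennreal (\<A> (\<rho> t) (f t))"
        proof (rule ennreal_leI)
          have "D t = flow (\<rho> t) (f t)"
          proof
            fix z
            have "at t within {0..1} = at t"
              using t by (intro at_within_interior) auto
            then have "((\<lambda>s. \<rho> s z) has_real_derivative flow (\<rho> t) (f t) z) (at t)"
              using elim t01 by auto
            moreover have "((\<lambda>s. \<rho> s z) has_real_derivative D t z) (at t)"
              using der elim t01 by auto
            ultimately show "D t z = flow (\<rho> t) (f t) z" by (metis DERIV_unique)
          qed
          moreover have "0 \<le> \<A> (\<rho> t) (\<lambda>z. \<phi> i z - f t z)" by (rule act_nonneg) (rule nn)
          moreover have "\<A> (\<rho> t) (\<phi> i) \<le> c i" using bound[of i t] i by auto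
          ultimately show "u' i t \<le> \<A> (\<rho> t) (f t)"
            by (simp add: u'_def act_diff)
        qed
        finally show ?thesis using t01 by simp
      qed
    qed
  qed
  also have "\<dots> = path_action \<rho> f"
    by (subst nn_integral_restrict_space) auto
  finally show ?thesis unfolding diff .
qed

lemma transport_dist_le:
  assumes "admissible Q \<pi> x y \<rho> f" "0 \<le> L"
    and "path_action \<rho> f \<le> ennreal (L\<^sup>2)"
  shows "\<W> x y \<le> L"
proof -
  let ?S = "{path_action \<rho> f | \<rho> f. admissible Q \<pi> x y \<rho> f}"
  have "Inf ?S \<le> ennreal (L\<^sup>2)"
    using assms by (intro Inf_lower2[OF _ assms(3)]) blast
  then have "enn2real (Inf ?S) \<le> enn2real (ennreal (L\<^sup>2))"
    by (intro enn2real_mono) auto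
  then show ?thesis
    using assms(2) unfolding transport_dist_def by (intro real_le_lsqrt) auto
qed

text \<open>The hypothesis that some curve has finite action excludes an infinite infimum, which
  \<^const>\<open>enn2real\<close> would map to \<open>0\<close>.\<close>

lemma transport_dist_lessE:
  assumes "admissible Q \<pi> x y \<rho>\<^sub>0 f\<^sub>0"
    and "path_action \<rho>\<^sub>0 f\<^sub>0 < top"
    and less: "\<W> x y < w"
  obtains \<rho> f where "admissible Q \<pi> x y \<rho> f"
    "path_action \<rho> f < ennreal (w\<^sup>2)"
proof -
  let ?S = "{path_action \<rho> f | \<rho> f. admissible Q \<pi> x y \<rho> f}"
  have "Inf ?S \<le> path_action \<rho>\<^sub>0 f\<^sub>0"
    using assms by (intro Inf_lower) blast
  then have fin: "Inf ?S < top" using assms(2) by (rule le_less_trans)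
  have "sqrt (enn2real (Inf ?S)) < w" using less by (simp add: transport_dist_def)
  then have "(sqrt (enn2real (Inf ?S)))\<^sup>2 < w\<^sup>2"
    by (intro power_strict_mono) auto
  then have "enn2real (Inf ?S) < w\<^sup>2" by simp
  then have "ennreal (enn2real (Inf ?S)) < ennreal (w\<^sup>2)"
    by (simp add: ennreal_less_iff)
  then have "Inf ?S < ennreal (w\<^sup>2)" using fin by (simp add: ennreal_enn2real)
  then obtain a where "a \<in> ?S" "a < ennreal (w\<^sup>2)" unfolding Inf_less_iff by blast
  then show thesis using that by blast
qed

lemma transport_dist_nonneg: "0 \<le> \<W> x y"
  by (simp add: transport_dist_def)

section \<open>The transport distance as a length\<close>

text \<open>The length of the segment from \<open>x\<close> to \<open>y\<close>, measured at the pointwise minimum of its end points.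
  This choice is symmetric and bounds the speed on the whole segment from above, since every point of
  the segment dominates the minimum.\<close>

definition ell :: "('a \<Rightarrow> real) \<Rightarrow> ('a \<Rightarrow> real) \<Rightarrow> real" where
  "ell x y = sqrt (cost (\<lambda>z. min (x z) (y z)) (\<lambda>z. y z - x z))"

definition region :: "real \<Rightarrow> ('a \<Rightarrow> real) set" where
  "region s = {\<rho> \<in> densities \<pi>. \<forall>z. s \<le> \<rho> z}"

lemma region_pos: "\<rho> \<in> region s \<Longrightarrow> 0 < s \<Longrightarrow> 0 < \<rho> z"
  by (force simp: region_def dest: spec[of _ z])

lemma region_mono: "\<rho> \<in> region s \<Longrightarrow> s' \<le> s \<Longrightarrow> \<rho> \<in> region s'"
  unfolding region_def by (auto intro: order_trans)

lemma inner_one_density: "\<rho> \<in> densities \<pi> \<Longrightarrow> mean \<rho> = 1"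
  by (simp add: densities_def inner_def mult.commute)

lemma region_diff_mean_zero:
  "x \<in> region s \<Longrightarrow> y \<in> region s' \<Longrightarrow> mean (\<lambda>z. y z - x z) = 0"
  by (simp add: inner_diff_right inner_one_density region_def)

lemma ell_commute:
  assumes "x \<in> region s" "y \<in> region s" "0 < s"
  shows "ell x y = ell y x"
proof -
  have "cost (\<lambda>z. min (y z) (x z)) (\<lambda>z. - 1 * (y z - x z))
      = (- 1)\<^sup>2 * cost (\<lambda>z. min (y z) (x z)) (\<lambda>z. y z - x z)"
    by (intro cost_scale region_diff_mean_zero[OF assms(1,2)])
      (use assms region_pos in auto)
  then show ?thesis by (simp add: ell_def min.commute)
qed

lemma ell_nonneg:
  assumes "x \<in> region s" "y \<in> region s" "0 < s"
  shows "0 \<le> ell x y"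
  unfolding ell_def
  by (intro real_sqrt_ge_zero cost_nonneg region_diff_mean_zero[OF assms(1,2)])
    (use assms region_pos in auto)

subsection \<open>Curves of bounded speed\<close>

text \<open>The potentials of the velocities turn a curve of strictly positive densities into an admissible
  pair.\<close>

lemma bounded_speed_curve:
  assumes dens: "\<And>t. t \<in> {0..1} \<Longrightarrow> \<rho> t \<in> densities \<pi>"
    and pos: "\<And>t z. t \<in> {0..1} \<Longrightarrow> 0 < \<rho> t z"
    and pw: "\<And>z. (\<lambda>t. \<rho> t z) piecewise_C1_differentiable_on {0..1}"
    and fin: "finite F\<^sub>0"
    and speed: "\<And>t. t \<in> {0<..<1} - F\<^sub>0 \<Longrightarrow>
      \<exists>v. (\<forall>z. ((\<lambda>s. \<rho> s z) has_real_derivative v z) (at t)) \<and> cost (\<rho> t) v \<le> L\<^sup>2"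
  obtains f where "admissible Q \<pi> (\<rho> 0) (\<rho> 1) \<rho> f"
    "path_action \<rho> f \<le> ennreal (L\<^sup>2)"
proof -
  obtain F D where F: "finite F" "0 \<in> F" "1 \<in> F"
    and der: "\<And>t z. t \<in> {0..1} - F \<Longrightarrow> ((\<lambda>s. \<rho> s z) has_real_derivative D t z) (at t)"
    and meas: "\<And>z. (\<lambda>t. D t z) \<in> borel_measurable borel"
    using piecewise_C1_velocity[of \<rho> 0 1] pw by metis
  define f where "f = (\<lambda>t. potential (\<rho> t) (D t))"
  have ae: "AE t in lebesgue_on {0..1}. t \<in> {0..1} - (F \<union> F\<^sub>0)"
    using null_lebesgue_finite[of "F \<union> F\<^sub>0"] F(1) fin
    by (subst AE_restrict_space_iff) auto
  have good: "flow (\<rho> t) (f t) = D t \<and> \<A> (\<rho> t) (f t) \<le> L\<^sup>2"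
    if t: "t \<in> {0..1} - (F \<union> F\<^sub>0)" for t
  proof -
    have t': "0 < t" "t < 1" using t F by (auto simp: less_le)
    have mz: "mean (D t) = 0"
      by (rule density_velocity_mean_zero[OF dens t']) (use der t in auto)
    have p: "0 < \<rho> t z" for z using pos t by auto
    have fl: "flow (\<rho> t) (f t) = D t"
      unfolding f_def by (intro flow_potential p mz)
    obtain v where v: "\<And>z. ((\<lambda>s. \<rho> s z) has_real_derivative v z) (at t)" "cost (\<rho> t) v \<le> L\<^sup>2"
      using speed[of t] t t' by auto
    have "v = D t"
      using v(1) der t by (metis DERIV_unique DiffD1 DiffD2 DiffI UnCI ext)
    then show ?thesis using cost_eq_act[of "\<rho> t", OF p fl] fl v(2) by simp
  qed
  have "admissible Q \<pi> (\<rho> 0) (\<rho> 1) \<rho> f"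
    unfolding admissible_def continuity_flux
  proof (intro conjI ballI allI refl dens pw)
    fix z
    show "(\<lambda>t. f t z) \<in> borel_measurable (lebesgue_on {0..1})"
      unfolding f_def
    proof (rule borel_measurable_potential)
      show "(\<lambda>t. \<rho> t y) \<in> borel_measurable (lebesgue_on {0..1})" for y
        using pw[of y] unfolding piecewise_C1_differentiable_on_def
        by (intro continuous_imp_measurable_on_sets_lebesgue) auto
      show "(\<lambda>t. D t y) \<in> borel_measurable (lebesgue_on {0..1})" for y
        by (intro measurable_restrict_space1 measurable_completion) (simp add: meas)
    qed
  next
    show "AE t in lebesgue_on {0..1}. \<forall>z.
        ((\<lambda>s. \<rho> s z) has_real_derivative flow (\<rho> t) (f t) z) (at t within {0..1})"
      using ae
    proof eventually_elim
      case (elim t)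
      then show ?case using good[OF elim] der[of t] by (auto intro: has_field_derivative_at_within)
    qed
  qed
  moreover have "path_action \<rho> f
      \<le> (\<integral>\<^sup>+ t. ennreal (L\<^sup>2) \<partial>lebesgue_on {0..1::real})"
  proof (rule nn_integral_mono_AE)
    show "AE t in lebesgue_on {0..1}. ennreal (\<A> (\<rho> t) (f t)) \<le> ennreal (L\<^sup>2)"
      using ae by eventually_elim (use good in \<open>auto intro: ennreal_leI\<close>)
  qed
  moreover have "(\<integral>\<^sup>+ t. ennreal (L\<^sup>2) \<partial>lebesgue_on {0..1::real}) = ennreal (L\<^sup>2)"
    by (simp add: emeasure_restrict_space)
  ultimately show thesis using that by metis
qed

text \<open>Curves of speed at most \<open>1\<close> on \<open>[0, T]\<close>. With this parametrisation lengths add up under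
  concatenation, and only the final rescaling to \<open>[0, 1]\<close> produces the square of the length.\<close>

definition arc :: "('a \<Rightarrow> real) \<Rightarrow> ('a \<Rightarrow> real) \<Rightarrow> real \<Rightarrow> bool" where
  "arc x y T \<longleftrightarrow> 0 < T \<and> (\<exists>\<rho>. \<rho> 0 = x \<and> \<rho> T = y \<and>
     (\<forall>t\<in>{0..T}. \<rho> t \<in> densities \<pi> \<and> (\<forall>z. 0 < \<rho> t z)) \<and>
     (\<forall>z. (\<lambda>t. \<rho> t z) piecewise_C1_differentiable_on {0..T}) \<and>
     (\<exists>F. finite F \<and> (\<forall>t\<in>{0<..<T} - F. \<exists>v.
        (\<forall>z. ((\<lambda>s. \<rho> s z) has_real_derivative v z) (at t)) \<and> cost (\<rho> t) v \<le> 1)))"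

lemma arc_admissible:
  assumes "arc x y T"
  obtains \<rho> f where "admissible Q \<pi> x y \<rho> f"
    "path_action \<rho> f \<le> ennreal (T\<^sup>2)"
proof -
  obtain \<rho> F where T: "0 < T" and ends: "\<rho> 0 = x" "\<rho> T = y"
    and dens: "\<And>t. t \<in> {0..T} \<Longrightarrow> \<rho> t \<in> densities \<pi>" "\<And>t z. t \<in> {0..T} \<Longrightarrow> 0 < \<rho> t z"
    and pw: "\<And>z. (\<lambda>t. \<rho> t z) piecewise_C1_differentiable_on {0..T}"
    and F: "finite F"
    and speed: "\<And>t. t \<in> {0<..<T} - F \<Longrightarrow> \<exists>v.
        (\<forall>z. ((\<lambda>s. \<rho> s z) has_real_derivative v z) (at t)) \<and> cost (\<rho> t) v \<le> 1"
    using assms unfolding arc_def by blast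
  define \<sigma> where "\<sigma> = (\<lambda>t. \<rho> (T * t))"
  have in_T: "T * t \<in> {0..T}" if "t \<in> {0..1}" for t
    using that T by (auto intro: mult_left_le)
  have pw': "(\<lambda>t. \<sigma> t z) piecewise_C1_differentiable_on {0..1}" for z
  proof -
    have "((\<lambda>t. \<rho> t z) \<circ> (\<lambda>x. T *\<^sub>R x + 0)) piecewise_C1_differentiable_on {0..1}"
      by (rule piecewise_C1_differentiable_affine)
        (rule piecewise_C1_differentiable_on_subset[OF pw[of z]], use in_T in auto)
    then show ?thesis by (simp add: \<sigma>_def o_def)
  qed
  have speed': "\<exists>v. (\<forall>z. ((\<lambda>s. \<sigma> s z) has_real_derivative v z) (at t)) \<and> cost (\<sigma> t) v \<le> T\<^sup>2"
    if t: "t \<in> {0<..<1} - (\<lambda>s. s / T) ` F" for t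
  proof -
    have "T * t \<in> {0<..<T} - F"
    proof -
      have "T * t \<notin> F" using t T by (force simp: image_iff)
      then show ?thesis using t T by auto
    qed
    from speed[OF this] obtain v where v: "\<And>z. ((\<lambda>s. \<rho> s z) has_real_derivative v z) (at (T * t))"
      "cost (\<rho> (T * t)) v \<le> 1" by blast
    have "((\<lambda>s. \<sigma> s z) has_real_derivative T * v z) (at t)" for z
    proof -
      have "((\<lambda>s. T * s) has_real_derivative T) (at t)"
        by (auto intro!: derivative_eq_intros)
      from DERIV_chain2[OF v(1) this] show ?thesis by (simp add: \<sigma>_def mult.commute)
    qed
    moreover have "cost (\<sigma> t) (\<lambda>z. T * v z) \<le> T\<^sup>2"
    proof -
      have mz: "mean v = 0"
        by (rule density_velocity_mean_zero[OF dens(1) _ _ v(1)]) (use t T in auto)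
      have "cost (\<sigma> t) (\<lambda>z. T * v z) = T\<^sup>2 * cost (\<sigma> t) v"
        by (intro cost_scale mz) (use dens(2) in_T t in \<open>auto simp: \<sigma>_def\<close>)
      also have "\<dots> \<le> T\<^sup>2 * 1"
        using v(2) by (intro mult_left_mono) (auto simp: \<sigma>_def)
      finally show ?thesis by simp
    qed
    ultimately show ?thesis by (intro exI[of _ "\<lambda>z. T * v z"]) auto
  qed
  obtain f where "admissible Q \<pi> (\<sigma> 0) (\<sigma> 1) \<sigma> f"
    "path_action \<sigma> f \<le> ennreal (T\<^sup>2)"
    by (rule bounded_speed_curve[of \<sigma> "(\<lambda>s. s / T) ` F" T])
      (use dens in_T pw' F speed' in \<open>auto simp: \<sigma>_def\<close>)
  then show thesis using that ends by (simp add: \<sigma>_def)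
qed

lemma arc_dist: "arc x y T \<Longrightarrow> \<W> x y \<le> T"
  by (rule arc_admissible[of x y T]) (auto intro!: transport_dist_le simp: arc_def)

lemma arc_segment:
  assumes x: "x \<in> region s" and y: "y \<in> region s" and s: "0 < s" and T: "0 < T" "ell x y \<le> T"
  shows "arc x y T"
proof -
  define \<rho> where "\<rho> = (\<lambda>t z. x z + (t / T) * (y z - x z))"
  let ?m = "\<lambda>z. min (x z) (y z)"
  let ?v = "\<lambda>z. (1 / T) * (y z - x z)"
  have mz: "mean (\<lambda>z. y z - x z) = 0" by (rule region_diff_mean_zero[OF x y])
  have mpos: "0 < ?m z" for z using region_pos[OF x s] region_pos[OF y s] by simp
  have conv: "?m z \<le> \<rho> t z" if "t \<in> {0..T}" for t z
  proof -
    have "\<rho> t z = (1 - t / T) * x z + (t / T) * y z" by (simp add: \<rho>_def algebra_simps)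
    moreover have "?m z \<le> (1 - t / T) * x z + (t / T) * y z"
    proof -
      have "(1 - t / T) * ?m z \<le> (1 - t / T) * x z" "(t / T) * ?m z \<le> (t / T) * y z"
        using that T(1) by (intro mult_left_mono; simp)+
      then show ?thesis by (simp add: algebra_simps)
    qed
    ultimately show ?thesis by simp
  qed
  have dens: "\<rho> t \<in> densities \<pi>" and pos: "0 < \<rho> t z" if "t \<in> {0..T}" for t z
  proof -
    show p: "0 < \<rho> t z" for z using conv[OF that, of z] mpos[of z] by linarith
    have "(\<Sum>z\<in>UNIV. \<pi> z * \<rho> t z) = mean (\<lambda>z. x z + (t / T) * (y z - x z))"
      by (simp add: inner_def \<rho>_def mult.commute)
    also have "\<dots> = 1"
      unfolding inner_add_right inner_scale_right mz
      using x by (simp add: inner_one_density region_def)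
    finally show "\<rho> t \<in> densities \<pi>" using p by (simp add: densities_def less_imp_le)
  qed
  have der: "((\<lambda>s. \<rho> s z) has_real_derivative ?v z) (at t)" for t z
    unfolding \<rho>_def using T(1) by (auto intro!: derivative_eq_intros)
  have pw: "(\<lambda>t. \<rho> t z) piecewise_C1_differentiable_on {0..T}" for z
    by (intro C1_differentiable_imp_piecewise)
      (use der[of z] in \<open>auto simp: C1_differentiable_on_def has_real_derivative_iff_has_vector_derivative
        intro!: exI[of _ "\<lambda>_. ?v z"]\<close>)
  have sp: "cost (\<rho> t) ?v \<le> 1" if t: "t \<in> {0<..<T}" for t
  proof -
    have t': "t \<in> {0..T}" using t by auto
    have "cost (\<rho> t) ?v = (1 / T)\<^sup>2 * cost (\<rho> t) (\<lambda>z. y z - x z)"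
      by (intro cost_scale mz pos[OF t'])
    also have "\<dots> \<le> (1 / T)\<^sup>2 * (1 * cost ?m (\<lambda>z. y z - x z))"
      by (intro mult_left_mono cost_antimono mz mpos pos[OF t']) (use conv[OF t'] in auto)
    also have "\<dots> \<le> (1 / T)\<^sup>2 * (1 * T\<^sup>2)"
      using T(2) by (intro mult_left_mono) (auto simp: ell_def dest: sqrt_le_D)
    also have "\<dots> = 1" using T(1) by (simp add: power_divide)
    finally show ?thesis .
  qed
  show ?thesis
    unfolding arc_def
  proof (intro conjI exI[of _ \<rho>] exI[of _ "{}"])
    show "\<rho> 0 = x" "\<rho> T = y" using T(1) by (auto simp: \<rho>_def)
    show "\<forall>t\<in>{0<..<T} - {}. \<exists>v. (\<forall>z. ((\<lambda>s. \<rho> s z) has_real_derivative v z) (at t)) \<and> cost (\<rho> t) v \<le> 1"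
      by (intro ballI exI[of _ ?v] conjI allI der sp) auto
  qed (use T(1) dens pos pw in auto)
qed

lemma arc_join:
  assumes "arc x y S" "arc y z T"
  shows "arc x z (S + T)"
proof -
  obtain \<alpha> F where S: "0 < S" and ends: "\<alpha> 0 = x" "\<alpha> S = y"
    and dens: "\<And>t. t \<in> {0..S} \<Longrightarrow> \<alpha> t \<in> densities \<pi>" "\<And>t u. t \<in> {0..S} \<Longrightarrow> 0 < \<alpha> t u"
    and pw: "\<And>u. (\<lambda>t. \<alpha> t u) piecewise_C1_differentiable_on {0..S}"
    and F: "finite F"
    and speed: "\<And>t. t \<in> {0<..<S} - F \<Longrightarrow> \<exists>v.
        (\<forall>u. ((\<lambda>s. \<alpha> s u) has_real_derivative v u) (at t)) \<and> cost (\<alpha> t) v \<le> 1"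
    using assms(1) unfolding arc_def by blast
  obtain \<beta> G where T: "0 < T" and ends': "\<beta> 0 = y" "\<beta> T = z"
    and dens': "\<And>t. t \<in> {0..T} \<Longrightarrow> \<beta> t \<in> densities \<pi>" "\<And>t u. t \<in> {0..T} \<Longrightarrow> 0 < \<beta> t u"
    and pw': "\<And>u. (\<lambda>t. \<beta> t u) piecewise_C1_differentiable_on {0..T}"
    and G: "finite G"
    and speed': "\<And>t. t \<in> {0<..<T} - G \<Longrightarrow> \<exists>v.
        (\<forall>u. ((\<lambda>s. \<beta> s u) has_real_derivative v u) (at t)) \<and> cost (\<beta> t) v \<le> 1"
    using assms(2) unfolding arc_def by blast
  define \<rho> where "\<rho> = (\<lambda>t. if t \<le> S then \<alpha> t else \<beta> (t - S))"
  have shift: "(\<lambda>t. \<beta> (t - S) u) piecewise_C1_differentiable_on {S..S + T}" for u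
  proof -
    have "((\<lambda>t. \<beta> t u) \<circ> (\<lambda>x. 1 *\<^sub>R x + (- S))) piecewise_C1_differentiable_on {S..S + T}"
      by (rule piecewise_C1_differentiable_affine)
        (rule piecewise_C1_differentiable_on_subset[OF pw'[of u]], auto)
    then show ?thesis by (simp add: o_def)
  qed
  have pw'': "(\<lambda>t. \<rho> t u) piecewise_C1_differentiable_on {0..S + T}" for u
  proof -
    have "(\<lambda>t. if t \<le> S then \<alpha> t u else \<beta> (t - S) u) piecewise_C1_differentiable_on {0..S + T}"
      by (intro piecewise_C1_differentiable_cases pw shift) (use S T ends ends' in auto)
    moreover have "(\<lambda>t. if t \<le> S then \<alpha> t u else \<beta> (t - S) u) = (\<lambda>t. \<rho> t u)"
      by (auto simp: \<rho>_def)
    ultimately show ?thesis by simp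
  qed
  have sp: "\<exists>v. (\<forall>u. ((\<lambda>s. \<rho> s u) has_real_derivative v u) (at t)) \<and> cost (\<rho> t) v \<le> 1"
    if t: "t \<in> {0<..<S + T} - ({S} \<union> F \<union> (\<lambda>t. t + S) ` G)" for t
  proof (cases "t < S")
    case True
    then obtain v where v: "\<And>u. ((\<lambda>s. \<alpha> s u) has_real_derivative v u) (at t)" "cost (\<alpha> t) v \<le> 1"
      using speed[of t] t by auto
    have "((\<lambda>s. \<rho> s u) has_real_derivative v u) (at t)" for u
      by (rule has_field_derivative_transform_within_open[OF v(1), where S = "{..<S}"])
        (use True in \<open>auto simp: \<rho>_def\<close>)
    then show ?thesis using v(2) True by (auto simp: \<rho>_def)
  next
    case False
    then have tS: "S < t" using t by auto
    have "t - S \<in> {0<..<T} - G"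
      using t tS by (force simp: image_iff)
    then obtain v where v: "\<And>u. ((\<lambda>s. \<beta> s u) has_real_derivative v u) (at (t - S))" "cost (\<beta> (t - S)) v \<le> 1"
      using speed' by blast
    have "((\<lambda>s. \<beta> (s - S) u) has_real_derivative v u) (at t)" for u
    proof -
      have "((\<lambda>s. s - S) has_real_derivative 1) (at t)" by (auto intro!: derivative_eq_intros)
      from DERIV_chain2[OF v(1) this] show ?thesis by simp
    qed
    then have "((\<lambda>s. \<rho> s u) has_real_derivative v u) (at t)" for u
      by (rule has_field_derivative_transform_within_open[where S = "{S<..}"])
        (use tS in \<open>auto simp: \<rho>_def\<close>)
    then show ?thesis using v(2) tS by (auto simp: \<rho>_def)
  qed
  show ?thesis
    unfolding arc_def
  proof (intro conjI exI[of _ \<rho>] exI[of _ "{S} \<union> F \<union> (\<lambda>t. t + S) ` G"])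
    show "\<rho> 0 = x" "\<rho> (S + T) = z" using S T ends ends' by (auto simp: \<rho>_def)
    show "\<forall>t\<in>{0..S + T}. \<rho> t \<in> densities \<pi> \<and> (\<forall>u. 0 < \<rho> t u)"
      using dens dens' by (auto simp: \<rho>_def)
    show "0 < S + T" using S T by simp
  qed (use F G pw'' sp in auto)
qed

subsection \<open>Polygonal chains\<close>

definition chain :: "real \<Rightarrow> ('a \<Rightarrow> real) \<Rightarrow> ('a \<Rightarrow> real) \<Rightarrow> real \<Rightarrow> bool" where
  "chain s x y L \<longleftrightarrow> (\<exists>n z. z 0 = x \<and> z n = y \<and> (\<forall>i\<le>n. z i \<in> region s) \<and>
     (\<Sum>i<n. ell (z i) (z (Suc i))) \<le> L)"

text \<open>An arc has positive length, but a link of a chain may be degenerate; \<open>\<eta>\<close> is added to every link,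
  and once more for a chain without links.\<close>

lemma chain_arc:
  assumes "0 < s" "\<forall>i\<le>n. z i \<in> region s" "0 < \<eta>"
  shows "arc (z 0) (z n) ((\<Sum>i<n. ell (z i) (z (Suc i))) + (real n + 1) * \<eta>)"
  using assms(2)
proof (induction n)
  case 0
  have "ell (z 0) (z 0) = 0"
    by (simp add: ell_def cost_def inner_def)
  then show ?case using 0 assms by (intro arc_segment[of _ s]) auto
next
  case (Suc n)
  let ?e = "ell (z n) (z (Suc n)) + \<eta>"
  have "0 \<le> ell (z n) (z (Suc n))" using Suc.prems assms(1) by (intro ell_nonneg[of _ s]) auto
  then have "arc (z n) (z (Suc n)) ?e"
    using Suc.prems assms by (intro arc_segment[of _ s]) auto
  from arc_join[OF Suc.IH this] show ?case
    using Suc.prems by (simp add: algebra_simps)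
qed

lemma chain_dist:
  assumes "chain s x y L" "0 < s"
  shows "\<W> x y \<le> L"
proof -
  obtain n z where z: "z 0 = x" "z n = y" "\<forall>i\<le>n. z i \<in> region s"
    and L: "(\<Sum>i<n. ell (z i) (z (Suc i))) \<le> L"
    using assms(1) unfolding chain_def by blast
  show ?thesis
  proof (rule field_le_epsilon)
    fix e :: real assume "0 < e"
    then have "arc x y ((\<Sum>i<n. ell (z i) (z (Suc i))) + (real n + 1) * (e / (real n + 1)))"
      using chain_arc[OF assms(2) z(3), of "e / (real n + 1)"] z by simp
    from arc_dist[OF this] L show "\<W> x y \<le> L + e" by simp
  qed
qed

lemma chain_le: "chain s x y L \<Longrightarrow> L \<le> L' \<Longrightarrow> chain s x y L'"
  unfolding chain_def by (elim exE conjE) (intro exI conjI, assumption+, rule order_trans)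

lemma chain_segment: "x \<in> region s \<Longrightarrow> y \<in> region s \<Longrightarrow> ell x y \<le> L \<Longrightarrow> chain s x y L"
  unfolding chain_def
  by (intro exI[of _ 1] exI[of _ "\<lambda>i. if i = 0 then x else y"]) auto

lemma chain_trans:
  assumes "chain s x y L" "chain s y w L'"
  shows "chain s x w (L + L')"
proof -
  obtain n z where z: "z 0 = x" "z n = y" "\<forall>i\<le>n. z i \<in> region s"
    "(\<Sum>i<n. ell (z i) (z (Suc i))) \<le> L"
    using assms(1) unfolding chain_def by blast
  obtain m z' where z': "z' 0 = y" "z' m = w" "\<forall>i\<le>m. z' i \<in> region s"
    "(\<Sum>i<m. ell (z' i) (z' (Suc i))) \<le> L'"
    using assms(2) unfolding chain_def by blast
  define u where "u = (\<lambda>i. if i \<le> n then z i else z' (i - n))"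
  have u2: "u (n + i) = z' i" for i using z(2) z'(1) by (auto simp: u_def)
  have "(\<Sum>i<n + m. ell (u i) (u (Suc i)))
      = (\<Sum>i<n. ell (u i) (u (Suc i))) + (\<Sum>i<m. ell (u (n + i)) (u (Suc (n + i))))"
    by (induction m) auto
  also have "\<dots> \<le> L + L'"
  proof (intro add_mono)
    have "(\<Sum>i<n. ell (u i) (u (Suc i))) = (\<Sum>i<n. ell (z i) (z (Suc i)))"
      by (intro sum.cong refl) (auto simp: u_def)
    then show "(\<Sum>i<n. ell (u i) (u (Suc i))) \<le> L" using z(4) by simp
    have "(\<Sum>i<m. ell (u (n + i)) (u (Suc (n + i)))) = (\<Sum>i<m. ell (z' i) (z' (Suc i)))"
      using u2 u2[of "Suc i" for i] by (intro sum.cong refl) (metis add_Suc_right)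
    then show "(\<Sum>i<m. ell (u (n + i)) (u (Suc (n + i)))) \<le> L'" using z'(4) by simp
  qed
  finally have "(\<Sum>i<n + m. ell (u i) (u (Suc i))) \<le> L + L'" .
  moreover have "u 0 = x" "u (n + m) = w" using z z' u2 by (auto simp: u_def)
  moreover have "u i \<in> region s" if "i \<le> n + m" for i
    using that z(3) z'(3) by (auto simp: u_def)
  ultimately show ?thesis unfolding chain_def by blast
qed

lemma chain_commute:
  assumes "chain s x y L" "0 < s"
  shows "chain s y x L"
proof -
  obtain n z where z: "z 0 = x" "z n = y" "\<forall>i\<le>n. z i \<in> region s"
    "(\<Sum>i<n. ell (z i) (z (Suc i))) \<le> L"
    using assms(1) unfolding chain_def by blast
  have "(\<Sum>i<n. ell (z (n - i)) (z (n - Suc i))) = (\<Sum>i<n. ell (z (Suc (n - Suc i))) (z (n - Suc i)))"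
    by (intro sum.cong refl) (auto simp: Suc_diff_Suc)
  also have "\<dots> = (\<Sum>i<n. ell (z (Suc i)) (z i))"
    by (rule sum.nat_diff_reindex)
  also have "\<dots> = (\<Sum>i<n. ell (z i) (z (Suc i)))"
    by (intro sum.cong refl ell_commute[of _ s]) (use z(3) assms(2) in auto)
  finally show ?thesis
    unfolding chain_def using z by (intro exI[of _ n] exI[of _ "\<lambda>i. z (n - i)"]) auto
qed

subsection \<open>Cutting a curve into a chain\<close>

text \<open>A crude upper bound for all \<open>1 / \<pi> z\<close>, and hence for the values of a density.\<close>

definition pi_ratio :: real where
  "pi_ratio = (\<Sum>z\<in>UNIV. 1 / \<pi> z)"

lemma inverse_pi_le: "1 / \<pi> z \<le> pi_ratio"
  unfolding pi_ratio_def by (intro member_le_sum) (auto simp: pi_nonneg)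

lemma pi_ratio_pos: "0 < pi_ratio"
  using inverse_pi_le[of undefined] pi_pos[of undefined]
  by (meson divide_pos_pos less_le_trans zero_less_one)

lemma density_le: "\<rho> \<in> densities \<pi> \<Longrightarrow> \<rho> z \<le> pi_ratio"
proof -
  assume \<rho>: "\<rho> \<in> densities \<pi>"
  then have "\<pi> z * \<rho> z \<le> 1"
    using member_le_sum[of z UNIV "\<lambda>z. \<pi> z * \<rho> z"] by (auto simp: densities_def pi_nonneg)
  then have "\<rho> z \<le> 1 / \<pi> z" using pi_pos[of z] by (simp add: field_simps)
  then show ?thesis using inverse_pi_le[of z] by linarith
qed

lemma act_indicator_le:
  assumes "\<rho> \<in> densities \<pi>"
  shows "\<A> \<rho> (\<lambda>w. if w = z then 1 else 0) \<le> 1/2"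
proof -
  let ?e = "\<lambda>w. if w = z then 1 else (0::real)"
  have "Gam Q ?e w \<le> 1" for w
  proof -
    have "Gam Q ?e w \<le> (\<Sum>y\<in>UNIV. 1 * Q w y)"
      unfolding Gam_def by (intro sum_mono mult_right_mono) (auto simp: Q_nonneg)
    then show ?thesis by (simp add: Q_sum)
  qed
  moreover have "0 \<le> \<rho> w" for w using assms by (simp add: densities_def)
  ultimately have "inner (Gam Q ?e) \<rho> \<le> mean \<rho>"
    unfolding inner_def by (intro sum_mono mult_right_mono) (auto simp: pi_nonneg)
  then show ?thesis
    using act_le_Gam[of \<rho> ?e] assms by (simp add: inner_one_density densities_def)
qed

text \<open>A curve of small action cannot leave a neighbourhood of its starting point, not even towards the
  boundary where the metric degenerates. The test functions are multiples of the indicator of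
  \<open>z\<close>, and this indicator has action at most \<open>1/2\<close> at every density.\<close>

lemma curve_confined:
  assumes adm: "admissible Q \<pi> x y \<rho> f" and w: "0 \<le> w"
    and action: "path_action \<rho> f < ennreal (w\<^sup>2)"
    and t: "t \<in> {0..1}"
  shows "\<bar>\<rho> t z - x z\<bar> \<le> pi_ratio * w"
proof -
  define d where "d = (\<rho> t z - x z) * \<pi> z"
  let ?e = "\<lambda>w. if w = z then 1 else (0::real)"
  \<comment> \<open>The factor \<open>2 d\<close> maximises \<open>2 \<lambda> d - \<lambda>\<^sup>2 / 2\<close> over \<open>\<lambda>\<close>.\<close>
  let ?\<phi> = "\<lambda>w. (2 * d) * ?e w"
  have x0: "\<rho> 0 = x" using adm by (simp add: admissible_def)
  have "ennreal (\<Sum>i<1. 2 * inner ?\<phi> (\<lambda>z. \<rho> (real (Suc i) * t) z - \<rho> (real i * t) z)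
        - (2 * d\<^sup>2) * (real (Suc i) * t - real i * t))
    \<le> path_action \<rho> f"
  proof (rule action_lower_bound[OF adm])
    show "mono (\<lambda>i. real i * t)" using t by (intro monoI mult_right_mono) auto
    fix i :: nat and s assume "i < 1" "s \<in> {real i * t..real (Suc i) * t}"
    then have "\<rho> s \<in> densities \<pi>" using adm t by (auto simp: admissible_def)
    then have "(2 * d)\<^sup>2 * \<A> (\<rho> s) ?e \<le> (2 * d)\<^sup>2 * (1/2)"
      by (intro mult_left_mono act_indicator_le) auto
    then show "\<A> (\<rho> s) ?\<phi> \<le> 2 * d\<^sup>2"
      unfolding act_scale by (simp add: power_mult_distrib)
  qed (use t in auto)
  also note action
  finally have "2 * inner ?\<phi> (\<lambda>u. \<rho> t u - x u) - 2 * d\<^sup>2 * t < w\<^sup>2"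
    by (auto simp: x0 dest!: ennreal_lessD)
  moreover have "inner ?\<phi> (\<lambda>u. \<rho> t u - x u) = 2 * d\<^sup>2"
  proof -
    have "inner ?\<phi> (\<lambda>u. \<rho> t u - x u) = 2 * d * inner ?e (\<lambda>u. \<rho> t u - x u)"
      by (rule inner_scale_left)
    also have "inner ?e (\<lambda>u. \<rho> t u - x u) = (\<Sum>u\<in>UNIV. if u = z then (\<rho> t u - x u) * \<pi> u else 0)"
      unfolding inner_def by (intro sum.cong refl) auto
    finally show ?thesis by (simp add: d_def power2_eq_square)
  qed
  moreover have "d\<^sup>2 * t \<le> d\<^sup>2 * 1" using t by (intro mult_left_mono) auto
  ultimately have "2 * d\<^sup>2 \<le> w\<^sup>2" by linarith
  then have "d\<^sup>2 \<le> w\<^sup>2" using zero_le_power2[of d] by linarith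
  then have "\<bar>d\<bar> \<le> w" using w by (simp add: abs_le_square_iff[symmetric])
  then have "\<bar>\<rho> t z - x z\<bar> * \<pi> z \<le> w"
    using pi_pos[of z] by (simp add: d_def abs_mult)
  then have "\<bar>\<rho> t z - x z\<bar> \<le> (1 / \<pi> z) * w"
    using pi_pos[of z] by (simp add: pos_le_divide_eq)
  also have "\<dots> \<le> pi_ratio * w" by (intro mult_right_mono inverse_pi_le w)
  finally show ?thesis .
qed

lemma short_curve:
  assumes x: "x \<in> region s" and y: "y \<in> region s" and s: "0 < s" and w: "\<W> x y < w"
  obtains \<rho> f where "admissible Q \<pi> x y \<rho> f"
    "path_action \<rho> f < ennreal (w\<^sup>2)"
proof -
  have "arc x y (ell x y + 1)"
    using ell_nonneg[OF x y s] by (intro arc_segment[OF x y s]) auto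
  then obtain \<rho>\<^sub>0 f\<^sub>0 where "admissible Q \<pi> x y \<rho>\<^sub>0 f\<^sub>0"
    "path_action \<rho>\<^sub>0 f\<^sub>0 \<le> ennreal ((ell x y + 1)\<^sup>2)"
    by (rule arc_admissible)
  then have "path_action \<rho>\<^sub>0 f\<^sub>0 < top"
    by (metis ennreal_less_top order_le_less_trans)
  from transport_dist_lessE[OF \<open>admissible Q \<pi> x y \<rho>\<^sub>0 f\<^sub>0\<close> this w] that show thesis .
qed

text \<open>Lower bound for \<open>\<W>\<close> at small distances. For \<open>w > W\<close>, a curve of action below \<open>w\<^sup>2\<close>
  stays so close to \<open>x\<close> that all its densities are at most \<open>(1 + pi_ratio * w / s) x\<close>; test with the potential of \<open>y - x\<close>, divided by this
  factor.\<close>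

lemma cost_le_dist:
  assumes x: "x \<in> region s" and y: "y \<in> region s" and s: "0 < s"
  defines "W \<equiv> \<W> x y"
  shows "cost x (\<lambda>z. y z - x z) \<le> (1 + pi_ratio * W / s) * W\<^sup>2"
proof -
  let ?v = "\<lambda>z. y z - x z"
  have xpos: "0 < x z" for z by (rule region_pos[OF x s])
  have mz: "mean ?v = 0" by (rule region_diff_mean_zero[OF x y])
  have bound: "cost x ?v \<le> (1 + pi_ratio * w / s) * w\<^sup>2" if w: "W < w" for w
  proof -
    have w0: "0 < w" using w transport_dist_nonneg[of x y] by (simp add: W_def)
    obtain \<rho> f where adm: "admissible Q \<pi> x y \<rho> f"
      and action: "path_action \<rho> f < ennreal (w\<^sup>2)"
      using short_curve[OF x y s w[unfolded W_def]] by blast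
    define l where "l = 1 + pi_ratio * w / s"
    have l: "0 < l" using pi_ratio_pos w0 s by (simp add: l_def add_pos_pos)
    let ?\<psi> = "potential x ?v"
    let ?\<phi> = "\<lambda>z. (1 / l) * ?\<psi> z"
    have fl: "flow x ?\<psi> = ?v" by (intro flow_potential xpos mz)
    have ends: "\<rho> 0 = x" "\<rho> 1 = y" using adm by (auto simp: admissible_def)
    have "ennreal (\<Sum>i<1. 2 * inner ?\<phi> (\<lambda>z. \<rho> (real (Suc i)) z - \<rho> (real i) z)
          - (cost x ?v / l) * (real (Suc i) - real i))
      \<le> path_action \<rho> f"
    proof (rule action_lower_bound[OF adm])
      show "mono real" by (intro monoI) auto
      fix i :: nat and t assume "i < 1" "t \<in> {real i..real (Suc i)}"
      then have t: "t \<in> {0..1}" by auto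
      have "\<rho> t z \<le> l * x z" for z
      proof -
        have "\<rho> t z \<le> x z + pi_ratio * w"
          using curve_confined[OF adm less_imp_le[OF w0] action t, of z] by linarith
        also have "pi_ratio * w = (pi_ratio * w / s) * s" using s by simp
        also have "\<dots> \<le> (pi_ratio * w / s) * x z"
          using x s pi_ratio_pos w0 by (intro mult_left_mono) (auto simp: region_def)
        finally show ?thesis by (simp add: l_def algebra_simps)
      qed
      then have "\<A> (\<rho> t) ?\<psi> \<le> l * \<A> x ?\<psi>"
        using adm t l by (intro act_le_scaled) (auto simp: admissible_def densities_def)
      then have "\<A> (\<rho> t) ?\<psi> \<le> l * cost x ?v"
        using cost_eq_act[of x, OF xpos fl] by simp
      then have "(1 / l)\<^sup>2 * \<A> (\<rho> t) ?\<psi> \<le> (1 / l)\<^sup>2 * (l * cost x ?v)"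
        by (intro mult_left_mono) auto
      then show "\<A> (\<rho> t) ?\<phi> \<le> cost x ?v / l"
        unfolding act_scale using l by (simp add: power2_eq_square)
    qed auto
    also note action
    finally have "2 * inner ?\<phi> ?v - cost x ?v / l < w\<^sup>2"
      by (auto simp: ends dest!: ennreal_lessD)
    moreover have "inner ?\<phi> ?v = cost x ?v / l"
      unfolding inner_scale_left cost_def by simp
    ultimately have "cost x ?v / l < w\<^sup>2" by simp
    then have "cost x ?v < l * w\<^sup>2" using l by (simp add: pos_divide_less_eq mult.commute)
    then show ?thesis unfolding l_def by simp
  qed
  show ?thesis
  proof (rule tendsto_lowerbound)
    show "((\<lambda>w. (1 + pi_ratio * w / s) * w\<^sup>2) \<longlongrightarrow> (1 + pi_ratio * W / s) * W\<^sup>2) (at_right W)"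
      using s by (intro tendsto_intros) auto
    show "\<forall>\<^sub>F w in at_right W. cost x ?v \<le> (1 + pi_ratio * w / s) * w\<^sup>2"
      using bound by (intro eventually_at_right_less[THEN eventually_mono])
  qed simp
qed

text \<open>Sampling a nearly optimal curve at the times \<open>i / n\<close>. On each time interval the densities are at
  most \<open>l\<close> times the minimum of the two sampled densities, and testing with the potential of the increment bounds
  the action from below by \<open>n / l\<close> times the sum of the squared lengths of the links. The
  number \<open>e\<close> is the room that the curve needs to stay in \<open>region s\<close>.\<close>

lemma fine_chain:
  assumes x: "x \<in> region (s + e)" and y: "y \<in> region (s + e)" and s: "0 < s" and e: "0 \<le> e"
    and w: "\<W> x y < w" "pi_ratio * w \<le> e" and h: "0 < h"
  obtains n z where "z 0 = x" "z n = y" "\<And>i. i \<le> n \<Longrightarrow> z i \<in> region s"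
    "\<And>i u. i < n \<Longrightarrow> \<bar>z (Suc i) u - z i u\<bar> \<le> h"
    "(\<Sum>i<n. ell (z i) (z (Suc i))) \<le> w"
proof -
  have w0: "0 < w" using w transport_dist_nonneg[of x y] by linarith
  obtain \<rho> f where adm: "admissible Q \<pi> x y \<rho> f"
    and action: "path_action \<rho> f < ennreal (w\<^sup>2)"
    using short_curve[OF x y _ w(1)] s e by auto
  have ends: "\<rho> 0 = x" "\<rho> 1 = y" using adm by (auto simp: admissible_def)
  have reg: "\<rho> t \<in> region s" if t: "t \<in> {0..1}" for t
  proof -
    have "s \<le> \<rho> t z" for z
      using curve_confined[OF adm less_imp_le[OF w0] action t, of z] w(2) x
      by (force simp: region_def dest: spec[of _ z])
    then show ?thesis using adm t by (simp add: region_def admissible_def)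
  qed
  obtain a where a: "0 \<le> a" "path_action \<rho> f = ennreal a"
    using action by (cases "path_action \<rho> f") auto
  have aw: "a < w\<^sup>2" using action a by (simp add: ennreal_less_iff)
  \<comment> \<open>The oscillation \<open>h'\<close> on a time interval is chosen so small that the loss \<open>l = 1 + h' / s\<close> is
    absorbed by the gap between the action \<open>a\<close> and \<open>w\<^sup>2\<close>.\<close>
  define h' where "h' = min h (s * (w\<^sup>2 - a) / (a + 1))"
  define l where "l = 1 + h' / s"
  have h': "0 < h'" "h' \<le> h" using h s aw a(1) by (auto simp: h'_def)
  have l: "1 < l" using h' s by (simp add: l_def)
  have la: "l * a \<le> w\<^sup>2"
  proof -
    have "h' / s * a \<le> (w\<^sup>2 - a) / (a + 1) * a"
    proof (rule mult_right_mono)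
      have "h' \<le> s * (w\<^sup>2 - a) / (a + 1)" by (simp add: h'_def)
      then show "h' / s \<le> (w\<^sup>2 - a) / (a + 1)" using s by (simp add: field_simps)
    qed (rule a)
    also have "\<dots> = (w\<^sup>2 - a) * (a / (a + 1))" by simp
    also have "\<dots> \<le> (w\<^sup>2 - a) * 1" using aw a(1) by (intro mult_left_mono) auto
    finally show ?thesis by (simp add: l_def algebra_simps)
  qed
  have "\<exists>d>0. \<forall>t\<in>{0..1}. \<forall>t'\<in>{0..1}. dist t' t < d \<longrightarrow> dist (\<rho> t' z) (\<rho> t z) < h'" for z
  proof -
    have "uniformly_continuous_on {0..1} (\<lambda>t. \<rho> t z)"
      using adm by (intro compact_uniformly_continuous) (auto simp: admissible_def piecewise_C1_differentiable_on_def)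
    then show ?thesis using h'(1) unfolding uniformly_continuous_on_def by blast
  qed
  then obtain d where d: "\<And>z. 0 < d z"
    "\<And>z t t'. t \<in> {0..1} \<Longrightarrow> t' \<in> {0..1} \<Longrightarrow> dist t' t < d z \<Longrightarrow> dist (\<rho> t' z) (\<rho> t z) < h'"
    by metis
  obtain m where m: "inverse (real (Suc m)) < Min (range d)"
    using reals_Archimedean[of "Min (range d)"] d(1) by auto
  define n where "n = Suc m"
  have n: "0 < n" "1 / real n < d z" for z
    using m d(1) by (auto simp: n_def inverse_eq_divide)
  define z where "z = (\<lambda>i. \<rho> (real i / real n))"
  have t01: "real i / real n \<in> {0..1}" if "i \<le> n" for i
    using that n(1) by auto
  have close: "\<bar>\<rho> t u - \<rho> t' u\<bar> \<le> h'" if "t \<in> {0..1}" "t' \<in> {0..1}" "\<bar>t - t'\<bar> \<le> 1 / real n" for t t' u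
    using d(2)[OF that(2,1), of u] that(3) n(2)[of u] by (auto simp: dist_real_def)
  have zreg: "z i \<in> region s" if "i \<le> n" for i
    unfolding z_def by (rule reg[OF t01[OF that]])
  have step: "\<bar>z (Suc i) u - z i u\<bar> \<le> h'" if "i < n" for i u
    unfolding z_def using that n(1) by (intro close t01) (auto simp: field_simps)
  let ?m = "\<lambda>i u. min (z i u) (z (Suc i) u)"
  let ?v = "\<lambda>i u. z (Suc i) u - z i u"
  let ?c = "\<lambda>i. cost (?m i) (?v i)"
  let ?\<psi> = "\<lambda>i. potential (?m i) (?v i)"
  let ?\<phi> = "\<lambda>i u. (real n / l) * ?\<psi> i u"
  have mpos: "0 < ?m i u" if "i < n" for i u
    using region_pos[OF zreg s, of i u] region_pos[OF zreg s, of "Suc i" u] that by simp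
  have mz: "mean (?v i) = 0" if "i < n" for i
    using that by (intro region_diff_mean_zero[of _ s _ s] zreg) auto
  have fl: "flow (?m i) (?\<psi> i) = ?v i" if "i < n" for i
    by (intro flow_potential mpos mz that)
  have "ennreal (\<Sum>i<n. 2 * inner (?\<phi> i) (\<lambda>u. \<rho> (real (Suc i) / real n) u - \<rho> (real i / real n) u)
        - (real n)\<^sup>2 / l * ?c i * (real (Suc i) / real n - real i / real n))
    \<le> path_action \<rho> f"
  proof (rule action_lower_bound[OF adm])
    show "mono (\<lambda>i. real i / real n)" by (intro monoI divide_right_mono) auto
    fix i t assume i: "i < n" and t: "t \<in> {real i / real n..real (Suc i) / real n}"
    have i': "real i / real n \<in> {0..1}" "real (Suc i) / real n \<in> {0..1}" using i by (intro t01; simp)+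
    have t': "t \<in> {0..1}" using t i' unfolding atLeastAtMost_iff by linarith
    have gap: "real (Suc i) / real n - real i / real n = 1 / real n" by (simp add: add_divide_distrib)
    have "\<rho> t u \<le> l * ?m i u" for u
    proof -
      have "\<rho> t u \<le> ?m i u + h'"
        using close[OF t' i'(1), of u] close[OF t' i'(2), of u] t gap by (auto simp: z_def)
      also have "h' = h' / s * s" using s by simp
      also have "\<dots> \<le> h' / s * ?m i u"
        using zreg[of i] zreg[of "Suc i"] i s h'(1) by (intro mult_left_mono) (auto simp: region_def)
      finally show ?thesis by (simp add: l_def algebra_simps)
    qed
    then have "\<A> (\<rho> t) (?\<psi> i) \<le> l * \<A> (?m i) (?\<psi> i)"
      using reg[OF t'] l s by (intro act_le_scaled) (auto simp: region_def densities_def)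
    also have "\<A> (?m i) (?\<psi> i) = ?c i"
      by (rule cost_eq_act[symmetric, OF mpos[OF i] fl[OF i]])
    finally have "(real n / l)\<^sup>2 * \<A> (\<rho> t) (?\<psi> i) \<le> (real n / l)\<^sup>2 * (l * ?c i)"
      by (intro mult_left_mono) auto
    then show "\<A> (\<rho> t) (?\<phi> i) \<le> (real n)\<^sup>2 / l * ?c i"
      unfolding act_scale using l by (simp add: power2_eq_square)
  qed (use n in auto)
  moreover have "2 * inner (?\<phi> i) (\<lambda>u. \<rho> (real (Suc i) / real n) u - \<rho> (real i / real n) u)
        - (real n)\<^sup>2 / l * ?c i * (real (Suc i) / real n - real i / real n) = real n / l * ?c i" for i
  proof -
    have gap: "real (Suc i) / real n - real i / real n = 1 / real n" by (simp add: add_divide_distrib)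
    have "inner (?\<phi> i) (\<lambda>u. \<rho> (real (Suc i) / real n) u - \<rho> (real i / real n) u) = real n / l * ?c i"
      unfolding inner_scale_left cost_def z_def by simp
    then show ?thesis unfolding gap using n(1) by (simp add: power2_eq_square)
  qed
  ultimately have "(\<Sum>i<n. real n / l * ?c i) \<le> a"
    unfolding a(2) using a(1) by (simp add: ennreal_le_iff)
  then have sum: "real n * (\<Sum>i<n. ?c i) \<le> l * a"
    unfolding sum_distrib_left[symmetric] using l by (simp add: pos_divide_le_eq mult.commute)
  have "(\<Sum>i<n. 1 * ell (z i) (z (Suc i)))\<^sup>2 \<le> (\<Sum>i<n. 1\<^sup>2) * (\<Sum>i<n. (ell (z i) (z (Suc i)))\<^sup>2)"
    by (rule Cauchy_Schwarz_ineq_sum)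
  also have "(\<Sum>i<n. (ell (z i) (z (Suc i)))\<^sup>2) = (\<Sum>i<n. ?c i)"
    by (intro sum.cong refl) (simp add: ell_def real_sqrt_pow2[OF cost_nonneg[OF mpos mz]])
  also have "(\<Sum>i<n. 1\<^sup>2) * (\<Sum>i<n. ?c i) = real n * (\<Sum>i<n. ?c i)" by simp
  also have "\<dots> \<le> w\<^sup>2" using sum la by linarith
  finally have "(\<Sum>i<n. ell (z i) (z (Suc i))) \<le> w"
    unfolding mult_1 by (rule power2_le_imp_le) (use w0 in simp)
  moreover have "z 0 = x" "z n = y" using ends n(1) by (auto simp: z_def)
  moreover have "\<bar>z (Suc i) u - z i u\<bar> \<le> h" if "i < n" for i u
    using step[OF that, of u] h'(2) by linarith
  ultimately show thesis using zreg that by blast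
qed

section \<open>Geodesics\<close>

lemma ell_le_sup_norm:
  assumes s: "0 < s"
  obtains C where "0 < C" and
    "\<forall>x\<in>region s. \<forall>y\<in>region s. \<forall>h. (\<forall>z. \<bar>y z - x z\<bar> \<le> h) \<longrightarrow> ell x y \<le> C * h"
proof -
  obtain C where C: "0 < C" and bound:
    "\<forall>\<rho> v s h. 0 < s \<longrightarrow> (\<forall>x. s \<le> \<rho> x) \<longrightarrow> mean v = 0 \<longrightarrow> (\<forall>x. \<bar>v x\<bar> \<le> h) \<longrightarrow>
       cost \<rho> v \<le> C\<^sup>2 * h\<^sup>2 / s"
    by (rule cost_le_sup_norm)
  show thesis
  proof
    show "0 < C / sqrt s" using C s by simp
    show "\<forall>x\<in>region s. \<forall>y\<in>region s. \<forall>h. (\<forall>z. \<bar>y z - x z\<bar> \<le> h) \<longrightarrow> ell x y \<le> C / sqrt s * h"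
    proof (intro ballI allI impI)
      fix x y h assume x: "x \<in> region s" and y: "y \<in> region s" and h: "\<forall>z. \<bar>y z - x z\<bar> \<le> h"
      have h0: "0 \<le> h" using h[rule_format, of undefined] by simp
      have "cost (\<lambda>z. min (x z) (y z)) (\<lambda>z. y z - x z) \<le> C\<^sup>2 * h\<^sup>2 / s"
        by (intro bound[rule_format] s h[rule_format] region_diff_mean_zero[OF x y])
          (use x y in \<open>auto simp: region_def\<close>)
      then have "ell x y \<le> sqrt (C\<^sup>2 * h\<^sup>2 / s)"
        unfolding ell_def by (rule real_sqrt_le_mono)
      also have "\<dots> = C / sqrt s * h"
        using C h0 by (simp add: real_sqrt_divide real_sqrt_mult)
      finally show "ell x y \<le> C / sqrt s * h" .
    qed
  qed
qed

lemma dist_less_imp_chain: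
  assumes "x \<in> region (s + e)" "y \<in> region (s + e)" "0 < s" "0 \<le> e"
    "\<W> x y < w" "pi_ratio * w \<le> e"
  shows "chain s x y w"
  proof -
  obtain n z where "z 0 = x" "z n = y" "\<And>i. i \<le> n \<Longrightarrow> z i \<in> region s"
    "\<And>i u. i < n \<Longrightarrow> \<bar>z (Suc i) u - z i u\<bar> \<le> 1" "(\<Sum>i<n. ell (z i) (z (Suc i))) \<le> w"
    using fine_chain[OF assms zero_less_one] by blast
  then show ?thesis unfolding chain_def by blast
qed

text \<open>Chooses an upper approximation \<open>w\<close> of a distance for which nearly optimal curves still stay in the
  region.\<close>

lemma less_cutoff:
  assumes "pi_ratio * d < e" "0 < \<eta>"
  obtains w where "d < w" "w \<le> d + \<eta>" "pi_ratio * w \<le> e"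
proof
  let ?w = "min (d + \<eta>) (e / pi_ratio)"
  show "d < ?w" using assms pi_ratio_pos by (simp add: pos_less_divide_eq mult.commute)
  show "?w \<le> d + \<eta>" by simp
  have "pi_ratio * ?w \<le> pi_ratio * (e / pi_ratio)"
    using pi_ratio_pos by (intro mult_left_mono) auto
  then show "pi_ratio * ?w \<le> e" using pi_ratio_pos by simp
qed

text \<open>The triangle inequality is local: the distances are so small that nearly optimal curves can be cut
  into chains of strictly positive densities, and chains can be joined.\<close>

lemma dist_triangle:
  assumes x: "x \<in> region (s + e)" and y: "y \<in> region (s + e)" and u: "u \<in> region (s + e)"
    and s: "0 < s" "0 \<le> e"
    and xy: "pi_ratio * \<W> x y < e" and yu: "pi_ratio * \<W> y u < e"
  shows "\<W> x u \<le> \<W> x y + \<W> y u"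
proof (rule field_le_epsilon)
  fix \<eta> :: real assume "0 < \<eta>"
  then have \<eta>: "0 < \<eta> / 2" by simp
  obtain w where w: "\<W> x y < w" "w \<le> \<W> x y + \<eta> / 2" "pi_ratio * w \<le> e"
    by (rule less_cutoff[OF xy \<eta>])
  obtain w' where w': "\<W> y u < w'" "w' \<le> \<W> y u + \<eta> / 2" "pi_ratio * w' \<le> e"
    by (rule less_cutoff[OF yu \<eta>])
  have "chain s x u (w + w')"
    by (rule chain_trans[OF dist_less_imp_chain[OF x y s w(1,3)] dist_less_imp_chain[OF y u s w'(1,3)]])
  from chain_dist[OF this s(1)] w(2) w'(2)
  show "\<W> x u \<le> \<W> x y + \<W> y u + \<eta>" by simp
qed

lemma dist_commute_le:
  assumes x: "x \<in> region (s + e)" and y: "y \<in> region (s + e)" and s: "0 < s" "0 \<le> e"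
    and xy: "pi_ratio * \<W> x y < e"
  shows "\<W> y x \<le> \<W> x y"
proof (rule field_le_epsilon)
  fix \<eta> :: real assume \<eta>: "0 < \<eta>"
  obtain w where w: "\<W> x y < w" "w \<le> \<W> x y + \<eta>" "pi_ratio * w \<le> e"
    by (rule less_cutoff[OF xy \<eta>])
  from chain_dist[OF chain_commute[OF dist_less_imp_chain[OF x y s w(1,3)] s(1)] s(1)] w(2)
  show "\<W> y x \<le> \<W> x y + \<eta>" by simp
qed

lemma chain_between:
  assumes z: "\<And>i. i \<le> n \<Longrightarrow> z i \<in> region s" and ij: "i \<le> j" "j \<le> n"
  shows "chain s (z i) (z j) ((\<Sum>k<j. ell (z k) (z (Suc k))) - (\<Sum>k<i. ell (z k) (z (Suc k))))"
proof -
  have "(\<Sum>k<i + m. ell (z k) (z (Suc k)))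
      = (\<Sum>k<i. ell (z k) (z (Suc k))) + (\<Sum>k<m. ell (z (i + k)) (z (i + Suc k)))" for m
    by (induction m) auto
  from this[of "j - i"] show ?thesis
    unfolding chain_def using z ij
    by (intro exI[of _ "j - i"] exI[of _ "\<lambda>k. z (i + k)"]) auto
qed

text \<open>Parametrise a fine, almost minimal chain by arc length, as a step function.\<close>

lemma almost_geodesic:
  assumes x: "x \<in> region (s + e)" and y: "y \<in> region (s + e)" and s: "0 < s" "0 \<le> e"
    and w: "\<W> x y < w" "pi_ratio * w \<le> e" and \<eta>: "0 < \<eta>"
  obtains \<gamma> where "\<gamma> 0 = x" "\<gamma> 1 = y" "\<And>t. t \<in> {0..1::real} \<Longrightarrow> \<gamma> t \<in> region s"
    "\<And>a b. 0 \<le> a \<Longrightarrow> a \<le> b \<Longrightarrow> b \<le> 1 \<Longrightarrow> chain s (\<gamma> a) (\<gamma> b) ((b - a) * w + \<eta>)"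
proof -
  obtain C where C: "0 < C" and
    ell: "\<forall>x\<in>region s. \<forall>y\<in>region s. \<forall>h. (\<forall>z. \<bar>y z - x z\<bar> \<le> h) \<longrightarrow> ell x y \<le> C * h"
    by (rule ell_le_sup_norm[OF s(1)])
  obtain n z where ends: "z 0 = x" "z n = y" and reg: "\<And>i. i \<le> n \<Longrightarrow> z i \<in> region s"
    and step: "\<And>i u. i < n \<Longrightarrow> \<bar>z (Suc i) u - z i u\<bar> \<le> \<eta> / C"
    and len: "(\<Sum>i<n. ell (z i) (z (Suc i))) \<le> w"
    by (rule fine_chain[OF x y s w, of "\<eta> / C"]) (use C \<eta> in auto)
  define p where "p = (\<lambda>i. \<Sum>k<i. ell (z k) (z (Suc k)))"
  have small: "ell (z i) (z (Suc i)) \<le> \<eta>" if "i < n" for i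
  proof -
    have "ell (z i) (z (Suc i)) \<le> C * (\<eta> / C)"
      by (intro ell[rule_format] reg step that) (use that in auto)
    then show ?thesis using C by simp
  qed
  have p0: "0 \<le> p n"
    unfolding p_def by (intro sum_nonneg ell_nonneg[of _ s] reg s) auto
  \<comment> \<open>\<open>p i\<close> is the length of the first \<open>i\<close> links. Time \<open>t\<close> is sent to a vertex whose arc length is
    \<open>t * p n\<close> up to the length of one link; the end points are prescribed because degenerate links
    make the vertex ambiguous.\<close>
  have "\<exists>i\<le>n. t * p n \<le> p i \<and> p i \<le> t * p n + \<eta> \<and> (t = 0 \<longrightarrow> i = 0) \<and> (t = 1 \<longrightarrow> i = n)"
    if t: "t \<in> {0..1}" for t
  proof (cases "t = 1")
    case True
    then show ?thesis using \<eta> by auto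
  next
    case False
    define i where "i = (LEAST i. t * p n \<le> p i)"
    have ex: "t * p n \<le> p n" using t p0 by (simp add: mult_left_le_one_le)
    have i: "t * p n \<le> p i" "i \<le> n"
      unfolding i_def using LeastI[of "\<lambda>i. t * p n \<le> p i", OF ex] Least_le[of "\<lambda>i. t * p n \<le> p i", OF ex]
      by auto
    have "p i \<le> t * p n + \<eta>"
    proof (cases i)
      case 0
      then show ?thesis using t p0 \<eta> by (simp add: p_def add_nonneg_nonneg)
    next
      case (Suc j)
      then have "\<not> t * p n \<le> p j" using not_less_Least[of j "\<lambda>i. t * p n \<le> p i"] by (simp add: i_def)
      then show ?thesis using Suc small[of j] i(2) by (simp add: p_def)
    qed
    moreover have "i = 0" if "t = 0"
      using Least_le[of "\<lambda>i. t * p n \<le> p i" 0] that by (simp add: i_def p_def)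
    ultimately show ?thesis using i False by blast
  qed
  then obtain idx where idx: "\<And>t. t \<in> {0..1} \<Longrightarrow> idx t \<le> n \<and> t * p n \<le> p (idx t) \<and>
      p (idx t) \<le> t * p n + \<eta> \<and> (t = 0 \<longrightarrow> idx t = 0) \<and> (t = 1 \<longrightarrow> idx t = n)"
    by metis
  show thesis
  proof (rule that[of "\<lambda>t. z (idx t)"])
    show "z (idx 0) = x" "z (idx 1) = y" using idx[of 0] idx[of 1] ends by auto
    show "z (idx t) \<in> region s" if "t \<in> {0..1}" for t using idx[OF that] reg by blast
    fix a b :: real assume ab: "0 \<le> a" "a \<le> b" "b \<le> 1"
    have ia: "idx a \<le> n" "a * p n \<le> p (idx a)" "p (idx a) \<le> a * p n + \<eta>" using idx[of a] ab by auto
    have ib: "idx b \<le> n" "b * p n \<le> p (idx b)" "p (idx b) \<le> b * p n + \<eta>" using idx[of b] ab by auto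
    have w': "(b - a) * p n \<le> (b - a) * w" using len ab by (intro mult_left_mono) (auto simp: p_def)
    have nn: "0 \<le> (b - a) * p n" using ab p0 by simp
    show "chain s (z (idx a)) (z (idx b)) ((b - a) * w + \<eta>)"
    proof (cases "idx a \<le> idx b")
      case True
      have "chain s (z (idx a)) (z (idx b)) (p (idx b) - p (idx a))"
        unfolding p_def by (rule chain_between[OF reg True ib(1)])
      then show ?thesis
        by (rule chain_le) (use ia ib w' in \<open>auto simp: algebra_simps\<close>)
    next
      case False
      then have "chain s (z (idx b)) (z (idx a)) (p (idx a) - p (idx b))"
        unfolding p_def using ia(1) by (intro chain_between[of n z s "idx b" "idx a"] reg) auto
      then have "chain s (z (idx a)) (z (idx b)) (p (idx a) - p (idx b))"
        by (rule chain_commute) (rule s)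
      then show ?thesis
        by (rule chain_le) (use ia ib w' nn in \<open>auto simp: algebra_simps\<close>)
    qed
  qed
qed

text \<open>A cluster point of almost geodesic step functions. Its points are joined by short segments to points
  of a step function with large index, so that the upper bound passes to the limit.\<close>

lemma geodesic_upper:
  assumes x: "x \<in> region (s + e)" and y: "y \<in> region (s + e)" and s: "0 < s" "0 \<le> e"
    and D: "pi_ratio * \<W> x y < e"
  obtains \<gamma> where "\<gamma> 0 = x" "\<gamma> 1 = y" "\<And>t. t \<in> {0..1::real} \<Longrightarrow> \<gamma> t \<in> region s"
    "\<And>a b. 0 \<le> a \<Longrightarrow> a \<le> b \<Longrightarrow> b \<le> 1 \<Longrightarrow>
       \<W> (\<gamma> a) (\<gamma> b) \<le> (b - a) * \<W> x y"
proof -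
  let ?D = "\<W> x y"
  obtain C where C: "0 < C" and
    ell: "\<forall>x\<in>region s. \<forall>y\<in>region s. \<forall>h. (\<forall>z. \<bar>y z - x z\<bar> \<le> h) \<longrightarrow> ell x y \<le> C * h"
    by (rule ell_le_sup_norm[OF s(1)])
  have "\<exists>g. g 0 = x \<and> g 1 = y \<and> (\<forall>t\<in>{0..1::real}. g t \<in> region s) \<and>
    (\<forall>a b. 0 \<le> a \<longrightarrow> a \<le> b \<longrightarrow> b \<le> 1 \<longrightarrow> chain s (g a) (g b) ((b - a) * ?D + 2 / (real k + 1)))" for k
  proof -
    let ?\<eta> = "1 / (real k + 1)"
    have \<eta>: "0 < ?\<eta>" by simp
    obtain w where w: "?D < w" "w \<le> ?D + ?\<eta>" "pi_ratio * w \<le> e"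
      by (rule less_cutoff[OF D \<eta>])
    obtain g where g: "g 0 = x" "g 1 = y" "\<And>t. t \<in> {0..1::real} \<Longrightarrow> g t \<in> region s"
      "\<And>a b. 0 \<le> a \<Longrightarrow> a \<le> b \<Longrightarrow> b \<le> 1 \<Longrightarrow> chain s (g a) (g b) ((b - a) * w + ?\<eta>)"
      by (rule almost_geodesic[OF x y s w(1,3) \<eta>]) blast
    have "chain s (g a) (g b) ((b - a) * ?D + 2 / (real k + 1))" if ab: "0 \<le> a" "a \<le> b" "b \<le> 1" for a b
    proof (rule chain_le[OF g(4)[OF ab]])
      have "(b - a) * w \<le> (b - a) * (?D + ?\<eta>)" using ab w by (intro mult_left_mono) auto
      also have "\<dots> \<le> (b - a) * ?D + 1 * ?\<eta>"
        unfolding distrib_left using ab \<eta> by (intro add_left_mono mult_right_mono) auto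
      finally show "(b - a) * w + ?\<eta> \<le> (b - a) * ?D + 2 / (real k + 1)" by simp
    qed
    then show ?thesis using g(1-3) by blast
  qed
  then obtain g where g: "\<And>k. g k 0 = x" "\<And>k. g k 1 = y"
    "\<And>k t. t \<in> {0..1::real} \<Longrightarrow> g k t \<in> region s"
    "\<And>k a b. 0 \<le> a \<Longrightarrow> a \<le> b \<Longrightarrow> b \<le> 1 \<Longrightarrow> chain s (g k a) (g k b) ((b - a) * ?D + 2 / (real k + 1))"
    by metis
  \<comment> \<open>Extension to all times by clamping, as the compactness argument works on the whole line.\<close>
  define g' where "g' = (\<lambda>k t. g k (max 0 (min 1 t)))"
  have "\<bar>g' k t z\<bar> \<le> pi_ratio" for k t z
  proof -
    have r: "g' k t \<in> region s" unfolding g'_def by (rule g(3)) auto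
    then have "0 \<le> g' k t z" using s by (auto simp: region_def densities_def)
    then show ?thesis using r density_le[of "g' k t" z] by (simp add: region_def)
  qed
  then obtain \<gamma> where \<gamma>': "\<forall>t u \<epsilon> N. 0 < \<epsilon> \<longrightarrow>
    (\<exists>k\<ge>N. \<forall>z. \<bar>g' k t z - \<gamma> t z\<bar> < \<epsilon> \<and> \<bar>g' k u z - \<gamma> u z\<bar> < \<epsilon>)"
    by (rule cluster_function)
  have \<gamma>: "\<exists>k\<ge>N. \<forall>z. \<bar>g k t z - \<gamma> t z\<bar> < \<epsilon> \<and> \<bar>g k u z - \<gamma> u z\<bar> < \<epsilon>"
    if "0 < \<epsilon>" "t \<in> {0..1}" "u \<in> {0..1}" for t u \<epsilon> N
    using \<gamma>'[rule_format, OF that(1), of N t u] that(2,3) by (auto simp: g'_def max_def min_def)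
  have reg: "\<gamma> t \<in> region s" if t: "t \<in> {0..1}" for t
  proof -
    have lower: "s \<le> \<gamma> t z" for z
    proof (rule field_le_epsilon)
      fix \<epsilon> :: real assume "0 < \<epsilon>"
      then obtain k where k: "\<bar>g k t z - \<gamma> t z\<bar> < \<epsilon>" using \<gamma>[OF _ t t] by blast
      have "s \<le> g k t z" using g(3)[OF t] by (simp add: region_def)
      then show "s \<le> \<gamma> t z + \<epsilon>" using k by linarith
    qed
    have "\<bar>mean (\<gamma> t) - 1\<bar> \<le> 0 + \<epsilon>" if \<epsilon>: "0 < \<epsilon>" for \<epsilon>
    proof -
      obtain k where k: "\<And>z. \<bar>g k t z - \<gamma> t z\<bar> < \<epsilon>" using \<gamma>[OF \<epsilon> t t] by blast
      have "mean (g k t) = 1" using g(3)[OF t] by (simp add: region_def inner_one_density)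
      then have "\<bar>mean (\<gamma> t) - 1\<bar> = \<bar>mean (\<lambda>z. \<gamma> t z - g k t z)\<bar>"
        by (simp add: inner_diff_right)
      also have "\<dots> \<le> (\<Sum>z\<in>UNIV. \<epsilon> * \<pi> z)"
        unfolding inner_def
      proof (intro order_trans[OF sum_abs] sum_mono)
        fix z
        have "\<bar>\<gamma> t z - g k t z\<bar> * \<pi> z \<le> \<epsilon> * \<pi> z"
          using k[of z] by (intro mult_right_mono pi_nonneg) linarith
        then show "\<bar>1 * (\<gamma> t z - g k t z) * \<pi> z\<bar> \<le> \<epsilon> * \<pi> z"
          by (simp add: abs_mult pi_nonneg)
      qed
      also have "\<dots> = \<epsilon>" by (simp add: pi_sum flip: sum_distrib_left)
      finally show ?thesis by simp
    qed
    then have "\<bar>mean (\<gamma> t) - 1\<bar> \<le> 0" by (rule field_le_epsilon)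
    then have "(\<Sum>z\<in>UNIV. \<pi> z * \<gamma> t z) = 1" by (simp add: inner_def mult.commute)
    moreover have "0 \<le> \<gamma> t z" for z using lower[of z] s by linarith
    ultimately show ?thesis using lower by (simp add: region_def densities_def)
  qed
  have ends: "\<gamma> 0 = x" "\<gamma> 1 = y"
  proof -
    have "\<bar>g 0 t z - \<gamma> t z\<bar> \<le> 0" if t: "t \<in> {0, 1}" for t z
    proof (rule field_le_epsilon)
      have t01: "t \<in> {0..1}" using t by auto
      fix \<epsilon> :: real assume "0 < \<epsilon>"
      then obtain k where k: "\<bar>g k t z - \<gamma> t z\<bar> < \<epsilon>" using \<gamma>[of \<epsilon> t t 0] t01 by blast
      have "g k t = g 0 t" using t g(1,2) by auto
      then show "\<bar>g 0 t z - \<gamma> t z\<bar> \<le> 0 + \<epsilon>" using k by simp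
    qed
    then have "g 0 t z = \<gamma> t z" if "t \<in> {0, 1}" for t z using that by fastforce
    then show "\<gamma> 0 = x" "\<gamma> 1 = y" using g(1,2) by (metis ext insertCI)+
  qed
  have upper: "\<W> (\<gamma> a) (\<gamma> b) \<le> (b - a) * ?D" if ab: "0 \<le> a" "a \<le> b" "b \<le> 1" for a b
  proof (rule field_le_epsilon)
    fix \<eta> :: real assume \<eta>: "0 < \<eta>"
    have a01: "a \<in> {0..1}" and b01: "b \<in> {0..1}" using ab by auto
    obtain N where N: "4 / \<eta> < real N" using reals_Archimedean2 by blast
    obtain k where k: "k \<ge> N" "\<And>z. \<bar>g k a z - \<gamma> a z\<bar> < \<eta> / (4 * C)" "\<And>z. \<bar>g k b z - \<gamma> b z\<bar> < \<eta> / (4 * C)"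
      using \<gamma>[of "\<eta> / (4 * C)" a b N] \<eta> C a01 b01 by auto
    have e1: "chain s (\<gamma> a) (g k a) (\<eta> / 4)"
    proof (rule chain_segment[OF reg[OF a01] g(3)[OF a01]])
      have "ell (\<gamma> a) (g k a) \<le> C * (\<eta> / (4 * C))"
        by (intro ell[rule_format] reg g(3) a01 less_imp_le k(2))
      then show "ell (\<gamma> a) (g k a) \<le> \<eta> / 4" using C by simp
    qed
    have e2: "chain s (g k b) (\<gamma> b) (\<eta> / 4)"
    proof (rule chain_segment[OF g(3)[OF b01] reg[OF b01]])
      have "ell (g k b) (\<gamma> b) \<le> C * (\<eta> / (4 * C))"
        by (intro ell[rule_format] reg g(3) b01 less_imp_le) (use k(3) in \<open>simp add: abs_minus_commute\<close>)
      then show "ell (g k b) (\<gamma> b) \<le> \<eta> / 4" using C by simp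
    qed
    have "chain s (\<gamma> a) (\<gamma> b) (\<eta> / 4 + (((b - a) * ?D + 2 / (real k + 1)) + \<eta> / 4))"
      by (rule chain_trans[OF e1 chain_trans[OF g(4)[OF ab] e2]])
    from chain_dist[OF this s(1)]
    have "\<W> (\<gamma> a) (\<gamma> b) \<le> (b - a) * ?D + 2 / (real k + 1) + \<eta> / 2" by simp
    moreover have "2 / (real k + 1) \<le> \<eta> / 2"
    proof -
      have "4 / \<eta> < real k + 1" using N k(1) by linarith
      then have "4 < \<eta> * (real k + 1)" using \<eta> by (simp add: pos_divide_less_eq mult.commute)
      then show ?thesis by (simp add: pos_divide_le_eq)
    qed
    ultimately show "\<W> (\<gamma> a) (\<gamma> b) \<le> (b - a) * ?D + \<eta>" by linarith
  qed
  show thesis by (rule that[OF ends reg upper])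
qed

text \<open>The upper bound for the distances on the limit curve is an equality: the three distances along
  \<open>\<gamma> 0\<close>, \<open>\<gamma> a\<close>, \<open>\<gamma> b\<close>, \<open>\<gamma> 1\<close> add up to at least \<open>\<W> x y\<close>. One margin \<open>e\<close> keeps \<open>\<gamma>\<close> away from the
  boundary, the other one is used by the triangle inequality on \<open>\<gamma>\<close>.\<close>

lemma geodesic_exists:
  assumes x: "x \<in> region (s + 2 * e)" and y: "y \<in> region (s + 2 * e)" and s: "0 < s" "0 < e"
    and D: "pi_ratio * \<W> x y < e"
  obtains \<gamma> where "constant_speed_geodesic Q \<pi> \<gamma>" "\<gamma> 0 = x" "\<gamma> 1 = y"
    "\<And>t. t \<in> {0..1} \<Longrightarrow> \<gamma> t \<in> region (s + e)"
proof -
  let ?d = "\<W>" and ?D = "\<W> x y"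
  have D0: "0 \<le> ?D" by (rule transport_dist_nonneg)
  obtain \<gamma> where ends: "\<gamma> 0 = x" "\<gamma> 1 = y" and reg: "\<And>t. t \<in> {0..1::real} \<Longrightarrow> \<gamma> t \<in> region (s + e)"
    and upper: "\<And>a b. 0 \<le> a \<Longrightarrow> a \<le> b \<Longrightarrow> b \<le> 1 \<Longrightarrow> ?d (\<gamma> a) (\<gamma> b) \<le> (b - a) * ?D"
    by (rule geodesic_upper[of x "s + e" e y]) (use x y s D in \<open>auto simp: add.assoc\<close>)
  have small: "pi_ratio * ?d (\<gamma> a) (\<gamma> b) < e" if "0 \<le> a" "a \<le> b" "b \<le> 1" for a b
  proof -
    have "?d (\<gamma> a) (\<gamma> b) \<le> 1 * ?D"
      using upper[OF that] that D0 by (intro order_trans[OF upper[OF that]] mult_right_mono) auto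
    then have "pi_ratio * ?d (\<gamma> a) (\<gamma> b) \<le> pi_ratio * ?D"
      using pi_ratio_pos by (intro mult_left_mono) auto
    then show ?thesis using D by linarith
  qed
  have eq: "?d (\<gamma> a) (\<gamma> b) = (b - a) * ?D" if ab: "0 \<le> a" "a \<le> b" "b \<le> 1" for a b
  proof -
    have r: "\<gamma> 0 \<in> region (s + e)" "\<gamma> a \<in> region (s + e)" "\<gamma> b \<in> region (s + e)" "\<gamma> 1 \<in> region (s + e)"
      using ab by (auto intro!: reg)
    have "?d (\<gamma> 0) (\<gamma> 1) \<le> ?d (\<gamma> 0) (\<gamma> a) + ?d (\<gamma> a) (\<gamma> 1)"
      by (rule dist_triangle[OF r(1,2,4)]) (use s small ab in auto)
    moreover have "?d (\<gamma> a) (\<gamma> 1) \<le> ?d (\<gamma> a) (\<gamma> b) + ?d (\<gamma> b) (\<gamma> 1)"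
      by (rule dist_triangle[OF r(2,3,4)]) (use s small ab in auto)
    moreover have "?d (\<gamma> 0) (\<gamma> a) \<le> (a - 0) * ?D" "?d (\<gamma> b) (\<gamma> 1) \<le> (1 - b) * ?D"
      using ab upper[of 0 a] upper[of b 1] ends by auto
    ultimately have "?D \<le> a * ?D + ?d (\<gamma> a) (\<gamma> b) + (1 - b) * ?D" using ends by simp
    then have "(b - a) * ?D \<le> ?d (\<gamma> a) (\<gamma> b)" by (simp add: algebra_simps)
    then show ?thesis using upper[OF ab] by linarith
  qed
  have sym: "?d (\<gamma> b) (\<gamma> a) = ?d (\<gamma> a) (\<gamma> b)" if ab: "0 \<le> a" "a \<le> b" "b \<le> 1" for a b
  proof -
    have r: "\<gamma> a \<in> region (s + e)" "\<gamma> b \<in> region (s + e)" using ab by (auto intro!: reg)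
    have 1: "?d (\<gamma> b) (\<gamma> a) \<le> ?d (\<gamma> a) (\<gamma> b)"
      by (rule dist_commute_le[OF r]) (use s small ab in auto)
    then have "pi_ratio * ?d (\<gamma> b) (\<gamma> a) \<le> pi_ratio * ?d (\<gamma> a) (\<gamma> b)"
      using pi_ratio_pos by (intro mult_left_mono) auto
    then have "pi_ratio * ?d (\<gamma> b) (\<gamma> a) < e" using small[OF ab] by linarith
    then have "?d (\<gamma> a) (\<gamma> b) \<le> ?d (\<gamma> b) (\<gamma> a)"
      by (intro dist_commute_le[OF r(2,1)]) (use s in auto)
    then show ?thesis using 1 by linarith
  qed
  have "constant_speed_geodesic Q \<pi> \<gamma>"
    unfolding constant_speed_geodesic_def
  proof (intro conjI ballI)
    fix a b :: real assume "a \<in> {0..1}" "b \<in> {0..1}"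
    then show "?d (\<gamma> a) (\<gamma> b) = \<bar>a - b\<bar> * ?d (\<gamma> 0) (\<gamma> 1)"
      using eq[of a b] eq[of b a] sym[of b a] ends by (cases "a \<le> b") auto
  qed (use reg in \<open>auto simp: region_def\<close>)
  then show thesis using that ends reg by blast
qed

section \<open>One explicit Euler step of the heat flow\<close>

lemma laplacian_eq_flow: "laplacian Q f z = - flow (\<lambda>_. 1) f z"
  by (simp add: laplacian_def flow_def hat_def log_mean_def algebra_simps flip: sum_negf)

lemma laplacian_commute: "inner \<phi> (laplacian Q f) = inner (laplacian Q \<phi>) f"
proof -
  have "laplacian Q g = (\<lambda>z. - 1 * flow (\<lambda>_. 1) g z)" for g
    by (simp add: fun_eq_iff laplacian_eq_flow)
  then show ?thesis
    using inner_flow_commute[of \<phi> "\<lambda>_. 1" f]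
    by (simp only: inner_scale_right inner_scale_left inner_commute[of "flow _ \<phi>" f])
qed

text \<open>The heat equation is the gradient flow of the entropy.\<close>

lemma flow_ln:
  assumes pos: "\<And>z. 0 < \<rho> z"
  shows "flow \<rho> (\<lambda>z. ln (\<rho> z)) z = - laplacian Q \<rho> z"
proof -
  have "hat \<rho> z y * (ln (\<rho> z) - ln (\<rho> y)) = \<rho> z - \<rho> y" for y
    unfolding hat_def by (intro log_mean_mult_diff_ln pos)
  then have "flow \<rho> (\<lambda>z. ln (\<rho> z)) z = (\<Sum>y\<in>UNIV. (\<rho> z - \<rho> y) * Q z y)"
    by (simp only: flow_def)
  then show ?thesis
    by (simp add: laplacian_def left_diff_distrib flip: sum_negf)
qed

text \<open>The potential of \<open>v - t \<Delta>\<rho>\<close> is that of \<open>v\<close> plus \<open>t log \<rho>\<close>.\<close>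

lemma cost_minus_drift:
  assumes pos: "\<And>z. 0 < \<rho> z" and mz: "mean v = 0"
  shows "cost \<rho> (\<lambda>z. v z - t * laplacian Q \<rho> z) =
    cost \<rho> v + 2 * t * inner (\<lambda>z. ln (\<rho> z)) v + t\<^sup>2 * \<A> \<rho> (\<lambda>z. ln (\<rho> z))"
proof -
  let ?\<psi> = "potential \<rho> v" and ?l = "\<lambda>z. ln (\<rho> z)"
  have fl: "flow \<rho> ?\<psi> = v" by (intro flow_potential pos mz)
  have fl': "flow \<rho> (\<lambda>z. ?\<psi> z - (- t) * ?l z) = (\<lambda>z. v z - t * laplacian Q \<rho> z)"
    unfolding flow_diff flow_scale fl using flow_ln[of \<rho>, OF pos] by (simp add: fun_eq_iff)
  have "cost \<rho> (\<lambda>z. v z - t * laplacian Q \<rho> z) = \<A> \<rho> (\<lambda>z. ?\<psi> z - (- t) * ?l z)"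
    by (rule cost_eq_act[OF pos fl'])
  also have "\<dots> = \<A> \<rho> ?\<psi> - 2 * inner ?\<psi> (flow \<rho> (\<lambda>z. (- t) * ?l z)) + \<A> \<rho> (\<lambda>z. (- t) * ?l z)"
    by (rule act_diff)
  also have "inner ?\<psi> (flow \<rho> (\<lambda>z. (- t) * ?l z)) = - t * inner ?l v"
    unfolding inner_flow_commute[of ?\<psi>] fl by (rule inner_scale_left)
  also have "\<A> \<rho> (\<lambda>z. (- t) * ?l z) = t\<^sup>2 * \<A> \<rho> ?l"
    unfolding act_scale by simp
  finally show ?thesis using cost_eq_act[OF pos fl] by simp
qed

text \<open>The linear approximation of a convex function lies below it; the derivative of \<open>a log a\<close> is
  \<open>1 + log a\<close>, and the constant \<open>1\<close> does not see a difference of densities.\<close>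

lemma entropy_tangent:
  assumes x: "x \<in> region s" and y: "y \<in> region s" and s: "0 < s"
  shows "inner (\<lambda>z. ln (x z)) (\<lambda>z. y z - x z) \<le> rel_entropy \<pi> y - rel_entropy \<pi> x"
proof -
  have "inner (\<lambda>z. ln (x z)) (\<lambda>z. y z - x z) + mean (\<lambda>z. y z - x z)
      = (\<Sum>z\<in>UNIV. (ln (x z) * (y z - x z) + (y z - x z)) * \<pi> z)"
    by (simp add: inner_def algebra_simps sum.distrib sum_subtractf)
  also have "\<dots> \<le> (\<Sum>z\<in>UNIV. (y z * ln (y z) - x z * ln (x z)) * \<pi> z)"
  proof (intro sum_mono mult_right_mono pi_nonneg)
    fix z
    have p: "0 < x z" "0 < y z" using region_pos x y s by auto
    have "ln (x z / y z) \<le> x z / y z - 1" using p by (intro ln_le_minus_one) auto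
    then have "y z * (ln (x z) - ln (y z)) \<le> y z * (x z / y z - 1)"
      using p by (intro mult_left_mono) (auto simp: ln_div)
    also have "\<dots> = x z - y z" using p by (simp add: algebra_simps)
    finally show "ln (x z) * (y z - x z) + (y z - x z) \<le> y z * ln (y z) - x z * ln (x z)"
      by (simp add: algebra_simps)
  qed
  also have "\<dots> = rel_entropy \<pi> y - rel_entropy \<pi> x"
    by (simp add: rel_entropy_def algebra_simps sum_subtractf)
  finally show ?thesis using region_diff_mean_zero[OF x y] by simp
qed

text \<open>The left-hand side is the Fisher information. It is bounded in the interior and occurs as
  coefficient of a term of order \<open>t\<^sup>2\<close>.\<close>

lemma fisher_le:
  assumes x: "x \<in> region s" and s: "0 < s"
  shows "\<A> x (\<lambda>z. ln (x z)) \<le> (ln pi_ratio - ln s)\<^sup>2"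
proof -
  let ?l = "\<lambda>z. ln (x z)"
  have l: "ln s \<le> ?l z" "?l z \<le> ln pi_ratio" for z
    using x s density_le[of x z] region_pos[OF x s, of z] by (auto simp: region_def)
  have "Gam Q ?l z \<le> (ln pi_ratio - ln s)\<^sup>2" for z
  proof -
    have "Gam Q ?l z \<le> (\<Sum>y\<in>UNIV. (ln pi_ratio - ln s)\<^sup>2 * Q z y)"
      unfolding Gam_def
    proof (intro sum_mono mult_right_mono Q_nonneg)
      fix y
      have "\<bar>?l y - ?l z\<bar> \<le> ln pi_ratio - ln s" using l[of y] l[of z] by (auto simp: abs_le_iff)
      then show "(?l y - ?l z)\<^sup>2 \<le> (ln pi_ratio - ln s)\<^sup>2" by (auto simp: abs_le_square_iff[symmetric])
    qed
    then show ?thesis by (simp add: Q_sum flip: sum_distrib_left)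
  qed
  then have "inner (Gam Q ?l) x \<le> inner (\<lambda>_. (ln pi_ratio - ln s)\<^sup>2 * 1) x"
    unfolding inner_def using x by (intro sum_mono mult_right_mono) (auto simp: pi_nonneg region_def densities_def)
  also have "\<dots> = (ln pi_ratio - ln s)\<^sup>2"
    unfolding inner_scale_left using x by (simp add: inner_one_density region_def)
  finally have "inner (Gam Q ?l) x \<le> (ln pi_ratio - ln s)\<^sup>2" .
  moreover have "\<A> x ?l \<le> 1/2 * inner (Gam Q ?l) x"
    using x by (intro act_le_Gam) (simp add: region_def densities_def)
  ultimately show ?thesis using zero_le_power2[of "ln pi_ratio - ln s"] by linarith
qed

text \<open>One explicit Euler step for \<open>\<partial>\<^sub>t f = \<Delta> f\<close>. For \<open>0 \<le> t \<le> 1\<close> it is again a reversible Markov operator.\<close>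

definition euler :: "real \<Rightarrow> ('a \<Rightarrow> real) \<Rightarrow> 'a \<Rightarrow> real" where
  "euler t f z = f z + t * laplacian Q f z"

lemma euler_convex: "euler t f z = (1 - t) * f z + t * (\<Sum>y\<in>UNIV. f y * Q z y)"
proof -
  have "laplacian Q f z = (\<Sum>y\<in>UNIV. f y * Q z y) - f z * (\<Sum>y\<in>UNIV. Q z y)"
    unfolding laplacian_def by (simp add: left_diff_distrib sum_subtractf sum_distrib_left)
  then show ?thesis by (simp add: euler_def Q_sum left_diff_distrib right_diff_distrib)
qed

lemma euler_bounds:
  assumes t: "0 \<le> t" "t \<le> 1" and f: "\<And>z. f z \<in> {a..b}"
  shows "euler t f z \<in> {a..b}"
proof -
  have c: "(\<Sum>y\<in>UNIV. c * Q z y) = c" for c by (simp add: Q_sum flip: sum_distrib_left)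
  have "(\<Sum>y\<in>UNIV. a * Q z y) \<le> (\<Sum>y\<in>UNIV. f y * Q z y)" "(\<Sum>y\<in>UNIV. f y * Q z y) \<le> (\<Sum>y\<in>UNIV. b * Q z y)"
    using f by (auto intro!: sum_mono mult_right_mono Q_nonneg)
  then have "t * a \<le> t * (\<Sum>y\<in>UNIV. f y * Q z y)" "t * (\<Sum>y\<in>UNIV. f y * Q z y) \<le> t * b"
    unfolding c using t by (auto intro: mult_left_mono)
  moreover have "(1 - t) * a \<le> (1 - t) * f z" "(1 - t) * f z \<le> (1 - t) * b"
    using f[of z] t by (auto intro: mult_left_mono)
  moreover have "(1 - t) * a + t * a = a" "(1 - t) * b + t * b = b" by (auto simp: algebra_simps)
  ultimately show ?thesis unfolding euler_convex atLeastAtMost_iff by linarith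
qed

lemma euler_abs_le:
  assumes "0 \<le> t" "t \<le> 1" "\<And>z. \<bar>f z\<bar> \<le> h"
  shows "\<bar>euler t f z\<bar> \<le> h"
  using euler_bounds[of t f "- h" h z] assms by (auto simp: abs_le_iff minus_le_iff)

lemma euler_commute: "inner \<phi> (euler t f) = inner (euler t \<phi>) f"
proof -
  have "euler t g = (\<lambda>z. g z + t * laplacian Q g z)" for g by (simp add: fun_eq_iff euler_def)
  then show ?thesis
    by (simp only: inner_add_right inner_add_left inner_scale_right inner_scale_left laplacian_commute)
qed

lemma euler_one: "euler t (\<lambda>_. 1) = (\<lambda>_. 1)"
  by (simp add: fun_eq_iff euler_def laplacian_def)

lemma euler_region:
  assumes t: "0 \<le> t" "t \<le> 1" and x: "x \<in> region s" and s: "0 < s"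
  shows "euler t x \<in> region s"
proof -
  have "x z \<in> {s..pi_ratio}" for z using x density_le[of x z] by (simp add: region_def)
  then have b: "euler t x z \<in> {s..pi_ratio}" for z by (intro euler_bounds t)
  have "mean (euler t x) = 1"
    unfolding euler_commute euler_one using x by (simp add: inner_one_density region_def)
  moreover have "0 \<le> euler t x z" for z using b[of z] s by auto
  ultimately show ?thesis using b by (auto simp: region_def densities_def inner_def mult.commute)
qed

lemma abs_laplacian_density_le:
  assumes "x \<in> densities \<pi>"
  shows "\<bar>laplacian Q x z\<bar> \<le> pi_ratio"
proof -
  have "\<bar>laplacian Q x z\<bar> \<le> (\<Sum>y\<in>UNIV. pi_ratio * Q z y)"
    unfolding laplacian_def
  proof (intro order_trans[OF sum_abs] sum_mono)
    fix y
    have "\<bar>x y - x z\<bar> \<le> pi_ratio"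
      using density_le[OF assms, of y] density_le[OF assms, of z] assms
      by (force simp: densities_def abs_le_iff dest: spec[of _ y] spec[of _ z])
    then show "\<bar>(x y - x z) * Q z y\<bar> \<le> pi_ratio * Q z y"
      by (simp add: abs_mult Q_nonneg mult_right_mono)
  qed
  then show ?thesis by (simp add: Q_sum flip: sum_distrib_left)
qed

lemma abs_diff_le_dist:
  assumes x: "x \<in> region s" and y: "y \<in> region s" and s: "0 < s"
  shows "\<bar>y z - x z\<bar> \<le> pi_ratio * \<W> x y"
proof (rule field_le_epsilon)
  fix e :: real assume e: "0 < e"
  let ?w = "\<W> x y + e / pi_ratio"
  have w: "\<W> x y < ?w" using e pi_ratio_pos by simp
  obtain \<rho> f where adm: "admissible Q \<pi> x y \<rho> f"
    and action: "path_action \<rho> f < ennreal (?w\<^sup>2)"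
    by (rule short_curve[OF x y s w])
  have "\<bar>\<rho> 1 z - x z\<bar> \<le> pi_ratio * ?w"
    by (rule curve_confined[OF adm _ action])
      (use e pi_ratio_pos transport_dist_nonneg[of x y] in auto)
  then show "\<bar>y z - x z\<bar> \<le> pi_ratio * \<W> x y + e"
    using adm pi_ratio_pos by (simp add: admissible_def distrib_left)
qed

text \<open>First variation of the distance when one end point makes an Euler step. The factors \<open>1 + r\<close>
  account for changing the reference density.\<close>

lemma ell_euler_le:
  assumes x: "x \<in> region s" and y: "y \<in> region s" and s: "0 < s" and t: "0 \<le> t" "t \<le> 1"
  defines "W \<equiv> \<W> x y"
  assumes r: "pi_ratio * (W + t) / s \<le> r"
  shows "(ell (euler t x) y)\<^sup>2 \<le> (1 + r) * ((1 + r) * W\<^sup>2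
    + 2 * t * (rel_entropy \<pi> y - rel_entropy \<pi> x) + t\<^sup>2 * (ln pi_ratio - ln s)\<^sup>2)"
proof -
  have W0: "0 \<le> W" unfolding W_def by (rule transport_dist_nonneg)
  have xpos: "0 < x z" and ypos: "0 < y z" for z using region_pos x y s by auto
  have ex: "euler t x \<in> region s" by (rule euler_region[OF t x s])
  let ?m = "\<lambda>z. min (euler t x z) (y z)"
  let ?v = "\<lambda>z. y z - x z"
  have mpos: "0 < ?m z" for z using region_pos[OF ex s] ypos by simp
  have mz: "mean ?v = 0" by (rule region_diff_mean_zero[OF x y])
  have mz': "mean (\<lambda>z. y z - euler t x z) = 0" by (rule region_diff_mean_zero[OF ex y])
  have r': "0 \<le> pi_ratio * (W + t) / s" using W0 t s pi_ratio_pos by simp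
  have le: "x z \<le> (1 + r) * ?m z" for z
  proof -
    have "x z \<le> euler t x z + pi_ratio * t"
    proof -
      have "\<bar>t * laplacian Q x z\<bar> \<le> t * pi_ratio"
        using abs_laplacian_density_le[of x z] x t by (simp add: abs_mult mult_left_mono region_def)
      then show ?thesis unfolding euler_def by (simp add: abs_le_iff mult.commute)
    qed
    moreover have "x z \<le> y z + pi_ratio * W"
      using abs_diff_le_dist[OF x y s, of z] by (simp add: W_def abs_le_iff)
    moreover have "pi_ratio * t \<le> pi_ratio * (W + t)" "pi_ratio * W \<le> pi_ratio * (W + t)"
      using W0 t pi_ratio_pos by (auto intro: mult_left_mono)
    ultimately have "x z \<le> ?m z + pi_ratio * (W + t)" by (auto simp: min_def)
    also have "pi_ratio * (W + t) = pi_ratio * (W + t) / s * s" using s by simp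
    also have "\<dots> \<le> r * ?m z"
      using ex y r r' s by (intro mult_mono) (auto simp: region_def)
    finally show ?thesis by (simp add: algebra_simps)
  qed
  have "(ell (euler t x) y)\<^sup>2 = cost ?m (\<lambda>z. y z - euler t x z)"
    unfolding ell_def by (rule real_sqrt_pow2[OF cost_nonneg[OF mpos mz']])
  also have "\<dots> \<le> (1 + r) * cost x (\<lambda>z. y z - euler t x z)"
    by (rule cost_antimono[OF xpos mpos mz']) (use r r' le in auto)
  also have "cost x (\<lambda>z. y z - euler t x z) = cost x (\<lambda>z. ?v z - t * laplacian Q x z)"
    by (simp add: euler_def algebra_simps)
  also have "\<dots> = cost x ?v + 2 * t * inner (\<lambda>z. ln (x z)) ?v + t\<^sup>2 * \<A> x (\<lambda>z. ln (x z))"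
    by (rule cost_minus_drift[OF xpos mz])
  also have "(1 + r) * \<dots> \<le> (1 + r) * ((1 + r) * W\<^sup>2
    + 2 * t * (rel_entropy \<pi> y - rel_entropy \<pi> x) + t\<^sup>2 * (ln pi_ratio - ln s)\<^sup>2)"
  proof (intro mult_left_mono add_mono)
    have "pi_ratio * W / s \<le> pi_ratio * (W + t) / s"
      using s t pi_ratio_pos by (intro divide_right_mono mult_left_mono) auto
    then have "(1 + pi_ratio * W / s) * W\<^sup>2 \<le> (1 + r) * W\<^sup>2"
      using r by (intro mult_right_mono) auto
    with cost_le_dist[OF x y s] show "cost x ?v \<le> (1 + r) * W\<^sup>2" unfolding W_def by linarith
  qed (use t r r' entropy_tangent[OF x y s] fisher_le[OF x s] in auto)
  finally show ?thesis .
qed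

text \<open>Split a geodesic at the times \<open>\<tau>\<close> and \<open>1 - \<tau>\<close> and move only its end points. Convexity of the
  entropy along the geodesic bounds the sum of the two entropy increments by
  \<open>- \<kappa> \<tau> (1 - \<tau>) d\<^sup>2\<close>; after division by \<open>\<tau>\<close> this is the contraction rate.\<close>

lemma euler_contraction_raw:
  assumes curv: "entropic_curvature_ge Q \<pi> \<kappa>"
    and x: "x \<in> region (s + 2 * e)" and y: "y \<in> region (s + 2 * e)" and s: "0 < s" "0 < e"
    and D: "pi_ratio * \<W> x y < e"
    and t: "0 \<le> t" "t \<le> 1" and \<tau>: "0 < \<tau>" "2 * \<tau> \<le> 1"
  defines "d \<equiv> \<W> x y"
  defines "r \<equiv> pi_ratio * (\<tau> * d + t) / s"
  shows "(\<W> (euler t x) (euler t y))\<^sup>2 \<le>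
    (1 + r) * (2 * (1 + r) * \<tau> * d\<^sup>2 - 2 * \<kappa> * t * (1 - \<tau>) * d\<^sup>2
       + 2 * (t\<^sup>2 / \<tau>) * (ln pi_ratio - ln s)\<^sup>2) + (1 - 2 * \<tau>) * d\<^sup>2"
proof -
  let ?d = "\<W>" and ?H = "rel_entropy \<pi>" and ?C = "(ln pi_ratio - ln s)\<^sup>2"
  have d0: "0 \<le> d" unfolding d_def by (rule transport_dist_nonneg)
  obtain \<gamma> where geo: "constant_speed_geodesic Q \<pi> \<gamma>" and ends: "\<gamma> 0 = x" "\<gamma> 1 = y"
    and reg: "\<And>t. t \<in> {0..1} \<Longrightarrow> \<gamma> t \<in> region (s + e)"
    by (rule geodesic_exists[OF x y s D]) blast
  have dist: "?d (\<gamma> a) (\<gamma> b) = \<bar>a - b\<bar> * d" if "a \<in> {0..1}" "b \<in> {0..1}" for a b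
    using geo that ends unfolding constant_speed_geodesic_def d_def by auto
  have conv: "?H (\<gamma> a) \<le> (1 - a) * ?H x + a * ?H y - \<kappa> / 2 * a * (1 - a) * d\<^sup>2" if "a \<in> {0..1}" for a
    using curv geo that ends unfolding entropic_curvature_ge_def d_def by blast
  let ?p = "\<gamma> \<tau>" and ?q = "\<gamma> (1 - \<tau>)"
  have \<tau>01: "\<tau> \<in> {0..1}" "1 - \<tau> \<in> {0..1}" using \<tau> by auto
  have dx: "?d x ?p = \<tau> * d" "?d y ?q = \<tau> * d" "?d ?p ?q = (1 - 2 * \<tau>) * d"
    using dist[of 0 \<tau>] dist[of 1 "1 - \<tau>"] dist[of \<tau> "1 - \<tau>"] ends \<tau> \<tau>01 by (auto simp: abs_if)
  have x': "x \<in> region s" and y': "y \<in> region s" using x y s by (auto elim: region_mono)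
  have p: "?p \<in> region (s + e)" "?q \<in> region (s + e)" using reg \<tau>01 by auto
  have p': "?p \<in> region s" "?q \<in> region s" using p s by (auto elim: region_mono)
  have ex: "euler t x \<in> region s" and ey: "euler t y \<in> region s"
    using euler_region[OF t] x' y' s by auto
  define A where "A = ell (euler t x) ?p"
  define B where "B = ell (euler t y) ?q"
  have A: "A\<^sup>2 \<le> (1 + r) * ((1 + r) * (\<tau> * d)\<^sup>2 + 2 * t * (?H ?p - ?H x) + t\<^sup>2 * ?C)"
    using ell_euler_le[OF x' p'(1) s(1) t, of r] by (simp add: A_def dx r_def)
  have B: "B\<^sup>2 \<le> (1 + r) * ((1 + r) * (\<tau> * d)\<^sup>2 + 2 * t * (?H ?q - ?H y) + t\<^sup>2 * ?C)"
    using ell_euler_le[OF y' p'(2) s(1) t, of r] by (simp add: B_def dx r_def)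
  have mid: "pi_ratio * ?d ?p ?q < e"
  proof -
    have "pi_ratio * ((1 - 2 * \<tau>) * d) \<le> pi_ratio * (1 * d)"
      using \<tau> d0 pi_ratio_pos by (intro mult_left_mono mult_right_mono) auto
    then show ?thesis using D by (simp add: dx d_def)
  qed
  have "?d (euler t x) (euler t y) \<le> A + (1 - 2 * \<tau>) * d + B"
  proof (rule field_le_epsilon)
    fix \<eta> :: real assume \<eta>: "0 < \<eta>"
    obtain w where w: "?d ?p ?q < w" "w \<le> ?d ?p ?q + \<eta>" "pi_ratio * w \<le> e"
      by (rule less_cutoff[OF mid \<eta>])
    have c1: "chain s (euler t x) ?p A" by (rule chain_segment[OF ex p'(1)]) (simp add: A_def)
    have c2: "chain s ?p ?q w"
      by (rule dist_less_imp_chain[OF p s(1) less_imp_le[OF s(2)] w(1,3)])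
    have "chain s (euler t y) ?q B" by (rule chain_segment[OF ey p'(2)]) (simp add: B_def)
    then have c3: "chain s ?q (euler t y) B" by (rule chain_commute[OF _ s(1)])
    show "?d (euler t x) (euler t y) \<le> A + (1 - 2 * \<tau>) * d + B + \<eta>"
      using chain_dist[OF chain_trans[OF c1 chain_trans[OF c2 c3]] s(1)] w(2) dx(3) by linarith
  qed
  then have "(?d (euler t x) (euler t y))\<^sup>2 \<le> (A + (1 - 2 * \<tau>) * d + B)\<^sup>2"
    by (intro power_mono transport_dist_nonneg)
  also have "\<dots> \<le> A\<^sup>2 / \<tau> + (1 - 2 * \<tau>) * d\<^sup>2 + B\<^sup>2 / \<tau>"
    by (rule weighted_square_le[OF \<tau>])
  also have "\<dots> = (A\<^sup>2 + B\<^sup>2) / \<tau> + (1 - 2 * \<tau>) * d\<^sup>2" by (simp add: add_divide_distrib)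
  also have "\<dots> \<le> (1 + r) * (2 * (1 + r) * \<tau> * d\<^sup>2 - 2 * \<kappa> * t * (1 - \<tau>) * d\<^sup>2 + 2 * (t\<^sup>2 / \<tau>) * ?C)
      + (1 - 2 * \<tau>) * d\<^sup>2"
  proof (rule add_right_mono)
    have r0: "0 \<le> 1 + r" using \<tau> d0 t s pi_ratio_pos by (simp add: r_def)
    have "(?H ?p - ?H x) + (?H ?q - ?H y) \<le> - (\<kappa> * \<tau> * (1 - \<tau>) * d\<^sup>2)"
    proof -
      define q where "q = \<kappa> * \<tau> * (1 - \<tau>) * d\<^sup>2"
      have "\<kappa> / 2 * \<tau> * (1 - \<tau>) * d\<^sup>2 = q / 2" "\<kappa> / 2 * (1 - \<tau>) * (1 - (1 - \<tau>)) * d\<^sup>2 = q / 2"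
        by (auto simp: q_def)
      with conv[OF \<tau>01(1)] conv[OF \<tau>01(2)] have
        "?H ?p \<le> (1 - \<tau>) * ?H x + \<tau> * ?H y - q / 2"
        "?H ?q \<le> \<tau> * ?H x + (1 - \<tau>) * ?H y - q / 2" by simp_all
      then show ?thesis unfolding q_def[symmetric] by (simp add: algebra_simps)
    qed
    then have "2 * t * ((?H ?p - ?H x) + (?H ?q - ?H y)) \<le> 2 * t * - (\<kappa> * \<tau> * (1 - \<tau>) * d\<^sup>2)"
      using t by (intro mult_left_mono) auto
    then have "(1 + r) * (2 * (1 + r) * (\<tau> * d)\<^sup>2 + 2 * t * ((?H ?p - ?H x) + (?H ?q - ?H y)) + 2 * t\<^sup>2 * ?C)
      \<le> (1 + r) * (2 * (1 + r) * (\<tau> * d)\<^sup>2 + 2 * t * - (\<kappa> * \<tau> * (1 - \<tau>) * d\<^sup>2) + 2 * t\<^sup>2 * ?C)"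
      using r0 by (intro mult_left_mono) auto
    then have "A\<^sup>2 + B\<^sup>2 \<le> (1 + r) * (2 * (1 + r) * (\<tau> * d)\<^sup>2 + 2 * t * - (\<kappa> * \<tau> * (1 - \<tau>) * d\<^sup>2) + 2 * t\<^sup>2 * ?C)"
      using A B by (simp add: algebra_simps)
    also have "\<dots> = \<tau> * ((1 + r) * (2 * (1 + r) * \<tau> * d\<^sup>2 - 2 * \<kappa> * t * (1 - \<tau>) * d\<^sup>2 + 2 * (t\<^sup>2 / \<tau>) * ?C))"
    proof -
      define u where "u = t\<^sup>2 / \<tau>"
      have t2: "t\<^sup>2 = \<tau> * u" using \<tau> by (simp add: u_def)
      show ?thesis
        unfolding u_def[symmetric] unfolding t2 by (simp add: power2_eq_square algebra_simps)
    qed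
    finally show "(A\<^sup>2 + B\<^sup>2) / \<tau> \<le> (1 + r) * (2 * (1 + r) * \<tau> * d\<^sup>2 - 2 * \<kappa> * t * (1 - \<tau>) * d\<^sup>2
        + 2 * (t\<^sup>2 / \<tau>) * ?C)"
      using \<tau> by (simp add: pos_divide_le_eq mult.commute)
  qed
  finally show ?thesis .
qed

text \<open>In the preceding bound the factor \<open>1 + r\<close> is \<open>1 + O(\<tau> + t)\<close>, so the error terms are of the orders
  \<open>\<tau>\<^sup>2\<close>, \<open>\<tau> t\<close> and \<open>t\<^sup>2 / \<tau>\<close>. With \<open>\<tau> = sqrt (\<mu> t)\<close> all of them are at most a multiple of \<open>\<mu> t\<close>
  for small \<open>t\<close>, uniformly over the region.\<close>

lemma euler_contraction:
  assumes curv: "entropic_curvature_ge Q \<pi> \<kappa>" and s: "0 < s" "0 < e" and \<epsilon>: "0 < \<epsilon>"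
  obtains t\<^sub>0 where "0 < t\<^sub>0" "t\<^sub>0 \<le> 1"
    "\<forall>t x y. 0 \<le> t \<longrightarrow> t \<le> t\<^sub>0 \<longrightarrow> x \<in> region (s + 2 * e) \<longrightarrow> y \<in> region (s + 2 * e) \<longrightarrow>
       pi_ratio * \<W> x y < e \<longrightarrow>
       (\<W> (euler t x) (euler t y))\<^sup>2
         \<le> (1 - 2 * \<kappa> * t) * (\<W> x y)\<^sup>2 + \<epsilon> * t"
proof -
  let ?C = "(ln pi_ratio - ln s)\<^sup>2"
  define D where "D = e / pi_ratio"
  define c where "c = pi_ratio * (D + 1) / s"
  \<comment> \<open>\<open>D\<close> bounds the distance, \<open>c * \<tau>\<close> bounds \<open>r\<close>, and \<open>K * \<mu> * t\<close> bounds the sum of the three error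
    terms.\<close>
  define K where "K = 4 * c * (2 + 2 * c) * D\<^sup>2 + 2 * \<bar>\<kappa>\<bar> * (1 + 2 * c) * D\<^sup>2 + 2 * (1 + 2 * c) * ?C"
  define \<mu> where "\<mu> = min 1 (\<epsilon> / (K + 1))"
  define t\<^sub>0 where "t\<^sub>0 = \<mu> ^ 3 / 16"
  have D0: "0 < D" using s pi_ratio_pos by (simp add: D_def)
  have c0: "0 \<le> c" using D0 s pi_ratio_pos by (simp add: c_def)
  have K0: "0 \<le> K" using c0 by (simp add: K_def)
  have \<mu>: "0 < \<mu>" "\<mu> \<le> 1" using \<epsilon> K0 by (auto simp: \<mu>_def)
  have K\<mu>: "K * \<mu> \<le> \<epsilon>"
  proof -
    have "K * \<mu> \<le> (K + 1) * (\<epsilon> / (K + 1))" using K0 \<epsilon> \<mu> by (intro mult_mono) (auto simp: \<mu>_def)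
    then show ?thesis using K0 by simp
  qed
  have \<mu>3: "\<mu> ^ 3 \<le> 1" using \<mu> by (intro power_le_one) auto
  have main: "(\<W> (euler t x) (euler t y))\<^sup>2
      \<le> (1 - 2 * \<kappa> * t) * (\<W> x y)\<^sup>2 + \<epsilon> * t"
    if t: "0 \<le> t" "t \<le> t\<^sub>0" and x: "x \<in> region (s + 2 * e)" and y: "y \<in> region (s + 2 * e)"
      and small: "pi_ratio * \<W> x y < e" for t x y
  proof (cases "t = 0")
    case True
    have "euler 0 f = f" for f by (simp add: fun_eq_iff euler_def)
    then show ?thesis using True by simp
  next
    case False
    then have t': "0 < t" "t \<le> 1" "16 * t \<le> \<mu> ^ 3" using t \<mu>3 by (auto simp: t\<^sub>0_def)
    define \<tau> where "\<tau> = sqrt (\<mu> * t)"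
    have \<tau>2: "\<tau>\<^sup>2 = \<mu> * t" using \<mu> t' by (simp add: \<tau>_def)
    have \<tau>0: "0 < \<tau>" using \<mu> t' by (simp add: \<tau>_def)
    have \<tau>\<mu>: "\<tau> \<le> \<mu>\<^sup>2 / 4"
    proof (rule power2_le_imp_le)
      have "\<mu> * (16 * t) \<le> \<mu> * \<mu> ^ 3" using \<mu> t' by (intro mult_left_mono) auto
      then show "\<tau>\<^sup>2 \<le> (\<mu>\<^sup>2 / 4)\<^sup>2"
        unfolding \<tau>2 power_divide by (simp add: power2_eq_square power3_eq_cube mult_ac)
    qed simp
    have \<mu>2: "\<mu>\<^sup>2 \<le> \<mu>" using \<mu> by (simp add: power2_eq_square mult_left_le)
    have \<tau>4: "\<tau> \<le> 1 / 4" "\<tau> \<le> \<mu>" using \<tau>\<mu> \<mu>2 \<mu> by linarith+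
    have t\<tau>: "t \<le> \<mu> * \<tau>"
    proof (rule power2_le_imp_le)
      have "t * t \<le> t * \<mu> ^ 3" using t' by (intro mult_left_mono) auto
      then show "t\<^sup>2 \<le> (\<mu> * \<tau>)\<^sup>2"
        unfolding power_mult_distrib \<tau>2 by (simp add: power2_eq_square power3_eq_cube mult_ac)
    qed (use \<mu> \<tau>0 in simp)
    have t\<tau>1: "t \<le> \<tau>" using t\<tau> \<mu> \<tau>0 by (meson mult_left_le_one_le less_imp_le order_trans)
    define d where "d = \<W> x y"
    define r where "r = pi_ratio * (\<tau> * d + t) / s"
    have d: "0 \<le> d" "d \<le> D"
      using small pi_ratio_pos transport_dist_nonneg[of x y]
      by (auto simp: d_def D_def pos_le_divide_eq mult.commute)
    have d2: "d\<^sup>2 \<le> D\<^sup>2" using d by (intro power_mono)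
    have r0: "0 \<le> r" using d \<tau>0 t' s pi_ratio_pos by (simp add: r_def)
    have r\<tau>: "r \<le> c * \<tau>"
    proof -
      have "\<tau> * d + t \<le> \<tau> * D + \<tau>" using d \<tau>0 t\<tau>1 by (intro add_mono mult_left_mono) auto
      then have "pi_ratio * (\<tau> * d + t) / s \<le> pi_ratio * ((D + 1) * \<tau>) / s"
        using pi_ratio_pos s by (intro divide_right_mono mult_left_mono) (auto simp: algebra_simps)
      then show ?thesis by (simp add: r_def c_def)
    qed
    have rc: "r \<le> c" using r\<tau> \<tau>4 c0 mult_left_mono[of \<tau> 1 c] by simp
    have "(\<W> (euler t x) (euler t y))\<^sup>2 \<le>
      (1 + r) * (2 * (1 + r) * \<tau> * d\<^sup>2 - 2 * \<kappa> * t * (1 - \<tau>) * d\<^sup>2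
       + 2 * (t\<^sup>2 / \<tau>) * ?C) + (1 - 2 * \<tau>) * d\<^sup>2"
      using euler_contraction_raw[OF curv x y s small t(1) t'(2) \<tau>0] \<tau>4 by (simp add: d_def r_def)
    also have "\<dots> = (1 - 2 * \<kappa> * t) * d\<^sup>2 + 2 * \<tau> * (r * (2 + r)) * d\<^sup>2
        + 2 * \<kappa> * t * (\<tau> - r + r * \<tau>) * d\<^sup>2 + 2 * (1 + r) * (t\<^sup>2 / \<tau>) * ?C"
    proof -
      define u where "u = t\<^sup>2 / \<tau>"
      show ?thesis unfolding u_def[symmetric] by (simp add: algebra_simps)
    qed
    also have "2 * \<tau> * (r * (2 + r)) * d\<^sup>2 \<le> 2 * \<tau> * (c * \<tau> * (2 + c)) * D\<^sup>2"
      using \<tau>0 r0 c0 r\<tau> rc d2 by (intro mult_mono) auto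
    also have "2 * \<tau> * (c * \<tau> * (2 + c)) * D\<^sup>2 = 2 * c * (2 + c) * D\<^sup>2 * (\<mu> * t)"
      unfolding \<tau>2[symmetric] by (simp add: power2_eq_square)
    also have "2 * \<kappa> * t * (\<tau> - r + r * \<tau>) * d\<^sup>2 \<le> 2 * \<bar>\<kappa>\<bar> * t * ((1 + 2 * c) * \<mu>) * D\<^sup>2"
    proof -
      have "r * \<tau> \<le> r * 1" using r0 \<tau>4 by (intro mult_left_mono) auto
      moreover have "0 \<le> r * \<tau>" using r0 \<tau>0 by simp
      ultimately have "\<bar>\<tau> - r + r * \<tau>\<bar> \<le> \<tau> + r"
        using \<tau>0 r0 unfolding abs_le_iff by linarith
      also have "\<dots> \<le> (1 + c) * \<tau>" using r\<tau> by (simp add: algebra_simps)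
      also have "\<dots> \<le> (1 + 2 * c) * \<mu>" using c0 \<tau>0 \<tau>4 by (intro mult_mono) auto
      finally have m: "\<bar>\<tau> - r + r * \<tau>\<bar> \<le> (1 + 2 * c) * \<mu>" .
      have "2 * \<kappa> * t * (\<tau> - r + r * \<tau>) * d\<^sup>2 \<le> \<bar>2 * \<kappa> * t * (\<tau> - r + r * \<tau>) * d\<^sup>2\<bar>" by simp
      also have "\<dots> = 2 * \<bar>\<kappa>\<bar> * t * \<bar>\<tau> - r + r * \<tau>\<bar> * d\<^sup>2" using t' by (simp add: abs_mult)
      also have "\<dots> \<le> 2 * \<bar>\<kappa>\<bar> * t * ((1 + 2 * c) * \<mu>) * D\<^sup>2"
        using t' m d2 c0 \<mu> by (intro mult_mono) auto
      finally show ?thesis .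
    qed
    also have "2 * (1 + r) * (t\<^sup>2 / \<tau>) * ?C \<le> 2 * (1 + 2 * c) * (\<mu> * t) * ?C"
    proof (intro mult_right_mono mult_mono)
      have "t * t \<le> t * (\<mu> * \<tau>)" using t' t\<tau> by (intro mult_left_mono) auto
      then show "t\<^sup>2 / \<tau> \<le> \<mu> * t" using \<tau>0 by (simp add: pos_divide_le_eq power2_eq_square mult_ac)
    qed (use rc c0 r0 \<tau>0 \<mu> t' in auto)
    also have "(1 - 2 * \<kappa> * t) * d\<^sup>2 + 2 * c * (2 + c) * D\<^sup>2 * (\<mu> * t)
        + 2 * \<bar>\<kappa>\<bar> * t * ((1 + 2 * c) * \<mu>) * D\<^sup>2 + 2 * (1 + 2 * c) * (\<mu> * t) * ?C
      \<le> (1 - 2 * \<kappa> * t) * d\<^sup>2 + (K * \<mu>) * t"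
    proof -
      have "0 \<le> (4 * c + 6 * c\<^sup>2) * D\<^sup>2 * (\<mu> * t)" using c0 \<mu> t' by simp
      then show ?thesis by (simp add: K_def algebra_simps power2_eq_square)
    qed
    also have "\<dots> \<le> (1 - 2 * \<kappa> * t) * d\<^sup>2 + \<epsilon> * t"
      using K\<mu> t' by (intro add_left_mono mult_right_mono) auto
    finally show ?thesis by (simp add: d_def)
  qed
  show thesis
  proof
    show "0 < t\<^sub>0" "t\<^sub>0 \<le> 1" using \<mu> \<mu>3 by (auto simp: t\<^sub>0_def)
  qed (use main in blast)
qed

section \<open>From Euler steps to the heat flow\<close>

lemma laplacian_sum:
  "laplacian Q (\<lambda>z. \<Sum>k\<in>A. c k * g k z) z = (\<Sum>k\<in>A. c k * laplacian Q (g k) z)"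
proof -
  have "laplacian Q (\<lambda>z. \<Sum>k\<in>A. c k * g k z) z = (\<Sum>y\<in>UNIV. \<Sum>k\<in>A. c k * ((g k y - g k z) * Q z y))"
    unfolding laplacian_def
    by (intro sum.cong refl) (simp add: sum_distrib_left sum_distrib_right algebra_simps flip: sum_subtractf)
  also have "\<dots> = (\<Sum>k\<in>A. c k * laplacian Q (g k) z)"
    unfolding laplacian_def sum_distrib_left by (rule sum.swap)
  finally show ?thesis .
qed

lemma euler_power_binomial:
  "N < M \<Longrightarrow> (euler t ^^ N) f = (\<lambda>z. \<Sum>k<M. (real (N choose k) * t ^ k) * (laplacian Q ^^ k) f z)"
proof (induction N arbitrary: M)
  case 0
  then obtain M' where "M = Suc M'" by (cases M) auto
  then show ?case by (simp add: sum.lessThan_Suc_shift del: sum.lessThan_Suc)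
next
  case (Suc N)
  then obtain M' where M: "M = Suc M'" and M': "N < M'" by (cases M) auto
  let ?L = "\<lambda>k. (laplacian Q ^^ k) f"
  have "(euler t ^^ Suc N) f z = (\<Sum>k<M. (real (Suc N choose k) * t ^ k) * ?L k z)" for z
  proof -
    have "(euler t ^^ Suc N) f z = (\<Sum>k<M'. (real (N choose k) * t ^ k) * ?L k z)
        + t * (\<Sum>k<M'. (real (N choose k) * t ^ k) * ?L (Suc k) z)"
    proof -
      have "(euler t ^^ Suc N) f z = (euler t ^^ N) f z + t * laplacian Q ((euler t ^^ N) f) z"
        by (simp add: euler_def[of t "(euler t ^^ N) f"])
      then show ?thesis unfolding Suc.IH[OF M'] laplacian_sum by simp
    qed
    also have "(\<Sum>k<M'. (real (N choose k) * t ^ k) * ?L k z) = (\<Sum>k<M. (real (N choose k) * t ^ k) * ?L k z)"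
      using M' by (simp add: M binomial_eq_0)
    also have "\<dots> = ?L 0 z + (\<Sum>k<M'. (real (N choose Suc k) * t ^ Suc k) * ?L (Suc k) z)"
      unfolding M sum.lessThan_Suc_shift by simp
    also have "t * (\<Sum>k<M'. (real (N choose k) * t ^ k) * ?L (Suc k) z)
        = (\<Sum>k<M'. (real (N choose k) * t ^ Suc k) * ?L (Suc k) z)"
      by (simp add: sum_distrib_left mult_ac)
    also have "?L 0 z + (\<Sum>k<M'. (real (N choose Suc k) * t ^ Suc k) * ?L (Suc k) z)
        + (\<Sum>k<M'. (real (N choose k) * t ^ Suc k) * ?L (Suc k) z)
        = ?L 0 z + (\<Sum>k<M'. (real (Suc N choose Suc k) * t ^ Suc k) * ?L (Suc k) z)"
      unfolding add.assoc sum.distrib[symmetric]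
      by (intro arg_cong2[where f = "(+)"] sum.cong refl) (simp add: algebra_simps)
    also have "\<dots> = (\<Sum>k<M. (real (Suc N choose k) * t ^ k) * ?L k z)"
      unfolding M sum.lessThan_Suc_shift by simp
    finally show ?thesis .
  qed
  then show ?case by blast
qed

lemma abs_laplacian_power_le:
  assumes "\<And>z. \<bar>f z\<bar> \<le> S"
  shows "\<bar>(laplacian Q ^^ k) f z\<bar> \<le> 2 ^ k * S"
proof (induction k arbitrary: z)
  case (Suc k)
  let ?g = "(laplacian Q ^^ k) f"
  have "\<bar>laplacian Q ?g z\<bar> \<le> (\<Sum>y\<in>UNIV. (2 * (2 ^ k * S)) * Q z y)"
    unfolding laplacian_def[of Q ?g]
  proof (intro order_trans[OF sum_abs] sum_mono)
    fix y
    have "\<bar>?g y - ?g z\<bar> \<le> 2 * (2 ^ k * S)" using Suc.IH[of y] Suc.IH[of z] by linarith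
    then show "\<bar>(?g y - ?g z) * Q z y\<bar> \<le> 2 * (2 ^ k * S) * Q z y"
      by (simp add: abs_mult Q_nonneg mult_right_mono)
  qed
  also have "\<dots> = 2 ^ Suc k * S" by (simp add: Q_sum flip: sum_distrib_left)
  finally show ?case by simp
qed (use assms in simp)

lemma binomial_scaled_tendsto:
  "(\<lambda>N. real (N choose k) * (T / real N) ^ k) \<longlonglongrightarrow> T ^ k / fact k"
proof -
  have "(\<lambda>N. T ^ k / fact k * (\<Prod>i<k. 1 - real i * inverse (real N))) \<longlonglongrightarrow> T ^ k / fact k * (\<Prod>i<k. 1 - real i * 0)"
    by (intro tendsto_intros tendsto_inverse_0_at_top filterlim_real_sequentially)
  moreover have "\<forall>\<^sub>F N in sequentially.
      T ^ k / fact k * (\<Prod>i<k. 1 - real i * inverse (real N)) = real (N choose k) * (T / real N) ^ k"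
    using eventually_gt_at_top[of 0]
  proof eventually_elim
    case (elim N)
    have "real (N choose k) = (\<Prod>i<k. real N - real i) / fact k"
      using gbinomial_prod_rev[of "real N" k] by (simp add: binomial_gbinomial atLeast0LessThan)
    also have "(\<Prod>i<k. real N - real i) = (\<Prod>i<k. real N * (1 - real i * inverse (real N)))"
      using elim by (intro prod.cong refl) (simp add: right_diff_distrib)
    also have "\<dots> = real N ^ k * (\<Prod>i<k. 1 - real i * inverse (real N))"
      by (simp add: prod.distrib)
    finally show ?case using elim by (simp add: power_divide)
  qed
  ultimately show ?thesis by (simp add: tendsto_cong)
qed

text \<open>Expand the power binomially and pass to the limit term by term; the exponential series dominates
  by Tannery's theorem.\<close>

lemma euler_power_tendsto_heat:
  assumes T: "0 \<le> T"
  shows "(\<lambda>N. (euler (T / real N) ^^ N) f z) \<longlonglongrightarrow> heat Q T f z"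
proof -
  let ?L = "\<lambda>k. (laplacian Q ^^ k) f z"
  define S where "S = (\<Sum>z\<in>UNIV. \<bar>f z\<bar>)"
  have S: "\<bar>f z\<bar> \<le> S" for z unfolding S_def by (intro member_le_sum) auto
  define a where "a = (\<lambda>k N. real (N choose k) * (T / real N) ^ k * ?L k)"
  have le: "real (N choose k) * (T / real N) ^ k \<le> T ^ k / fact k" for k N
  proof (cases "N = 0")
    case True
    then show ?thesis using T by (cases k) auto
  next
    case False
    have "real (N choose k) * fact k \<le> real N ^ k"
      using binomial_fact_pow[of N k] by (metis of_nat_fact of_nat_le_iff of_nat_mult of_nat_power)
    then have "real (N choose k) * fact k * T ^ k \<le> real N ^ k * T ^ k"
      using T by (intro mult_right_mono) auto
    then show ?thesis using False by (simp add: power_divide field_simps)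
  qed
  have "eventually (\<lambda>n. summable (\<lambda>k. norm (a k n))) sequentially \<and>
      summable (\<lambda>n. norm (T ^ n / fact n * ?L n)) \<and>
      ((\<lambda>n. suminf (\<lambda>k. a k n)) \<longlonglongrightarrow> suminf (\<lambda>n. T ^ n / fact n * ?L n))"
  proof (rule tannerys_theorem)
    show "(\<lambda>n. a k n) \<longlonglongrightarrow> T ^ k / fact k * ?L k" for k
      unfolding a_def by (intro tendsto_mult binomial_scaled_tendsto tendsto_const)
    have "norm (a k n) \<le> (2 * T) ^ k / fact k * S" for k n
    proof -
      have "norm (a k n) \<le> (T ^ k / fact k) * (2 ^ k * S)"
        unfolding a_def real_norm_def abs_mult[of _ "?L k"]
        using le[of n k] T by (intro mult_mono abs_laplacian_power_le S) (auto simp: abs_mult)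
      then show ?thesis by (simp add: power_mult_distrib mult_ac)
    qed
    then show "eventually (\<lambda>(k, n). norm (a k n) \<le> (2 * T) ^ k / fact k * S) (at_top \<times>\<^sub>F sequentially)"
      by (intro always_eventually) auto
    show "summable (\<lambda>k. (2 * T) ^ k / fact k * S)"
      using summable_exp[of "2 * T"] by (intro summable_mult2) (simp add: divide_inverse mult.commute)
  qed simp
  moreover have "suminf (\<lambda>k. a k N) = (euler (T / real N) ^^ N) f z" for N
  proof -
    have "suminf (\<lambda>k. a k N) = (\<Sum>k<Suc N. a k N)"
      by (intro suminf_finite) (auto simp: a_def binomial_eq_0)
    then show ?thesis by (simp add: euler_power_binomial[of N "Suc N"] a_def del: sum.lessThan_Suc)
  qed
  ultimately show ?thesis by (simp add: heat_def)
qed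

lemma euler_power_inner_tendsto:
  assumes "0 \<le> T"
  shows "(\<lambda>N. inner ((euler (T / real N) ^^ N) f) v) \<longlonglongrightarrow> inner (heat Q T f) v"
  unfolding inner_def by (intro tendsto_intros euler_power_tendsto_heat assms)

lemma euler_power_commute: "inner \<phi> ((euler t ^^ n) f) = inner ((euler t ^^ n) \<phi>) f"
proof (induction n arbitrary: \<phi>)
  case (Suc n)
  then have "inner \<phi> ((euler t ^^ Suc n) f) = inner ((euler t ^^ n) (euler t \<phi>)) f"
    by (simp add: euler_commute)
  then show ?case by (simp add: funpow_swap1)
qed simp

lemma euler_add_scaled: "euler t (\<lambda>z. x z + h * v z) = (\<lambda>z. euler t x z + h * euler t v z)"
  by (simp add: fun_eq_iff euler_convex algebra_simps sum.distrib sum_distrib_left)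

lemma euler_power_add_scaled:
  "(euler t ^^ n) (\<lambda>z. x z + h * v z) = (\<lambda>z. (euler t ^^ n) x z + h * (euler t ^^ n) v z)"
  by (induction n) (simp_all add: euler_add_scaled)

lemma euler_diff: "euler t y z - euler t x z = euler t (\<lambda>z. y z - x z) z"
  using fun_cong[OF euler_add_scaled[of t y "-1" x], of z] by simp

lemma heat_nonneg:
  assumes "0 \<le> T" "\<And>z. 0 \<le> f z"
  shows "0 \<le> heat Q T f z"
proof (rule tendsto_lowerbound[OF euler_power_tendsto_heat[OF assms(1)]])
  obtain M :: nat where M: "T < real M" using reals_Archimedean2 by blast
  show "\<forall>\<^sub>F N in sequentially. 0 \<le> (euler (T / real N) ^^ N) f z"
    using eventually_ge_at_top[of "max 1 M"]
  proof eventually_elim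
    case (elim N)
    have t: "0 \<le> T / real N" "T / real N \<le> 1" using elim M assms(1) by auto
    define S where "S = (\<Sum>z\<in>UNIV. \<bar>f z\<bar>)"
    have "f z \<in> {0..S}" for z
      using assms(2)[of z] member_le_sum[of z UNIV "\<lambda>z. \<bar>f z\<bar>"] by (auto simp: S_def)
    then have "(euler (T / real N) ^^ n) f z \<in> {0..S}" for n z
    proof (induction n arbitrary: z)
      case (Suc n)
      then show ?case using euler_bounds[OF t Suc.IH] by simp
    qed simp
    then have "(euler (T / real N) ^^ N) f z \<in> {0..S}" .
    then show ?case by simp
  qed
qed simp

text \<open>The errors of the \<open>N\<close> steps add up to at most \<open>\<epsilon> T exp(2 \<bar>\<kappa>\<bar> T)\<close>. The Euler steps preserve the region
  and do not increase the sup-norm distance, so that the contraction applies at every step.\<close>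

lemma iterated_contraction:
  assumes curv: "entropic_curvature_ge Q \<pi> \<kappa>" and s: "0 < s" "0 < e" and T: "0 \<le> T"
    and near: "\<And>x y. x \<in> region (s + 2 * e) \<Longrightarrow> y \<in> region (s + 2 * e) \<Longrightarrow> \<forall>z. \<bar>y z - x z\<bar> \<le> h \<Longrightarrow>
      pi_ratio * \<W> x y < e"
    and x: "x \<in> region (s + 2 * e)" and y: "y \<in> region (s + 2 * e)" and xy: "\<And>z. \<bar>y z - x z\<bar> \<le> h"
    and \<eta>: "0 < \<eta>"
  shows "\<forall>\<^sub>F N in sequentially.
    (\<W> ((euler (T / real N) ^^ N) x) ((euler (T / real N) ^^ N) y))\<^sup>2
      \<le> exp (- 2 * \<kappa> * T) * (\<W> x y)\<^sup>2 + \<eta>"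
proof -
  define \<epsilon> where "\<epsilon> = \<eta> / (T * exp (2 * \<bar>\<kappa>\<bar> * T) + 1)"
  have den: "0 < T * exp (2 * \<bar>\<kappa>\<bar> * T) + 1" using T by (intro add_nonneg_pos) auto
  have \<epsilon>: "0 < \<epsilon>" using \<eta> den by (simp add: \<epsilon>_def)
  have \<epsilon>T: "\<epsilon> * T * exp (2 * \<bar>\<kappa>\<bar> * T) \<le> \<eta>"
  proof -
    have "\<epsilon> * (T * exp (2 * \<bar>\<kappa>\<bar> * T)) \<le> \<epsilon> * (T * exp (2 * \<bar>\<kappa>\<bar> * T) + 1)"
      using \<epsilon> by (intro mult_left_mono) auto
    then show ?thesis using den by (simp add: \<epsilon>_def mult.assoc)
  qed
  obtain t\<^sub>0 where t0: "0 < t\<^sub>0" "t\<^sub>0 \<le> 1" and contr: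
    "\<forall>t x y. 0 \<le> t \<longrightarrow> t \<le> t\<^sub>0 \<longrightarrow> x \<in> region (s + 2 * e) \<longrightarrow> y \<in> region (s + 2 * e) \<longrightarrow>
       pi_ratio * \<W> x y < e \<longrightarrow>
       (\<W> (euler t x) (euler t y))\<^sup>2
         \<le> (1 - 2 * \<kappa> * t) * (\<W> x y)\<^sup>2 + \<epsilon> * t"
    by (rule euler_contraction[OF curv s \<epsilon>])
  have lim: "(\<lambda>N. c * T * inverse (real N)) \<longlonglongrightarrow> c * T * 0" for c
    by (intro tendsto_intros tendsto_inverse_0_at_top filterlim_real_sequentially)
  have "\<forall>\<^sub>F N in sequentially. 1 * T * inverse (real N) < t\<^sub>0"
    using order_tendstoD(2)[OF lim[of 1], of t\<^sub>0] t0 by simp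
  moreover have "\<forall>\<^sub>F N in sequentially. 2 * \<bar>\<kappa>\<bar> * T * inverse (real N) < 1"
    using order_tendstoD(2)[OF lim[of "2 * \<bar>\<kappa>\<bar>"], of 1] by simp
  ultimately show ?thesis
    using eventually_gt_at_top[of 0]
  proof eventually_elim
    case (elim N)
    define \<tau> where "\<tau> = T / real N"
    have \<tau>: "0 \<le> \<tau>" "\<tau> \<le> t\<^sub>0" "\<tau> \<le> 1" "2 * \<bar>\<kappa>\<bar> * \<tau> \<le> 1"
      using elim T t0 by (auto simp: \<tau>_def divide_inverse mult_ac)
    have N\<tau>: "real N * \<tau> = T" using elim by (simp add: \<tau>_def)
    define a where "a = 1 - 2 * \<kappa> * \<tau>"
    define b where "b = exp (2 * \<bar>\<kappa>\<bar> * \<tau>)"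
    have k\<tau>: "- (\<bar>\<kappa>\<bar> * \<tau>) \<le> \<kappa> * \<tau>" "\<kappa> * \<tau> \<le> \<bar>\<kappa>\<bar> * \<tau>"
      using \<tau> mult_right_mono[of "- \<bar>\<kappa>\<bar>" \<kappa> \<tau>] mult_right_mono[of \<kappa> "\<bar>\<kappa>\<bar>" \<tau>] by auto
    have a0: "0 \<le> a" using k\<tau> \<tau> by (simp add: a_def)
    have ab: "a \<le> b"
      using exp_ge_add_one_self[of "2 * \<bar>\<kappa>\<bar> * \<tau>"] k\<tau> unfolding a_def b_def by linarith
    have b1: "1 \<le> b" using \<tau> by (simp add: b_def)
    have a_exp: "a \<le> exp (- 2 * \<kappa> * \<tau>)"
      using exp_ge_add_one_self[of "- 2 * \<kappa> * \<tau>"] by (simp add: a_def)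
    let ?x = "\<lambda>j. (euler \<tau> ^^ j) x" and ?y = "\<lambda>j. (euler \<tau> ^^ j) y"
    let ?u = "\<lambda>j. (\<W> (?x j) (?y j))\<^sup>2"
    have s2e: "0 < s + 2 * e" using s by simp
    have "?x j \<in> region (s + 2 * e) \<and> ?y j \<in> region (s + 2 * e) \<and> (\<forall>z. \<bar>?y j z - ?x j z\<bar> \<le> h) \<and>
        ?u j \<le> a ^ j * ?u 0 + \<epsilon> * \<tau> * real j * b ^ j" for j
    proof (induction j)
      case (Suc j)
      then have IH: "?x j \<in> region (s + 2 * e)" "?y j \<in> region (s + 2 * e)" "\<And>z. \<bar>?y j z - ?x j z\<bar> \<le> h"
        "?u j \<le> a ^ j * ?u 0 + \<epsilon> * \<tau> * real j * b ^ j" by auto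
      have 1: "?x (Suc j) \<in> region (s + 2 * e)" "?y (Suc j) \<in> region (s + 2 * e)"
        using euler_region[OF \<tau>(1,3) IH(1) s2e] euler_region[OF \<tau>(1,3) IH(2) s2e] by auto
      have 2: "\<bar>?y (Suc j) z - ?x (Suc j) z\<bar> \<le> h" for z
        using euler_abs_le[OF \<tau>(1,3) IH(3)] by (simp add: euler_diff)
      have "?u (Suc j) \<le> a * ?u j + \<epsilon> * \<tau>"
        using contr[rule_format, OF \<tau>(1,2) IH(1,2) near[OF IH(1,2)]] IH(3) by (simp add: a_def)
      also have "\<dots> \<le> a * (a ^ j * ?u 0 + \<epsilon> * \<tau> * real j * b ^ j) + \<epsilon> * \<tau>"
        using IH(4) a0 by (intro add_right_mono mult_left_mono)
      also have "\<dots> = a ^ Suc j * ?u 0 + a * (\<epsilon> * \<tau> * real j * b ^ j) + \<epsilon> * \<tau> * 1"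
        by (simp add: algebra_simps)
      also have "a * (\<epsilon> * \<tau> * real j * b ^ j) \<le> b * (\<epsilon> * \<tau> * real j * b ^ j)"
        using ab \<epsilon> \<tau> b1 by (intro mult_right_mono) auto
      also have "\<epsilon> * \<tau> * 1 \<le> \<epsilon> * \<tau> * b ^ Suc j"
        using \<epsilon> \<tau> b1 by (intro mult_left_mono one_le_power) auto
      also have "a ^ Suc j * ?u 0 + b * (\<epsilon> * \<tau> * real j * b ^ j) + \<epsilon> * \<tau> * b ^ Suc j
          = a ^ Suc j * ?u 0 + \<epsilon> * \<tau> * real (Suc j) * b ^ Suc j"
        by (simp add: algebra_simps)
      finally show ?case using 1 2 by auto
    qed (use x y xy in auto)
    then have "?u N \<le> a ^ N * ?u 0 + \<epsilon> * \<tau> * real N * b ^ N" by blast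
    also have "a ^ N * ?u 0 \<le> exp (- 2 * \<kappa> * \<tau>) ^ N * ?u 0"
      using a0 a_exp by (intro mult_right_mono power_mono) auto
    also have "exp (- 2 * \<kappa> * \<tau>) ^ N = exp (- 2 * \<kappa> * T)"
      unfolding exp_of_nat_mult[symmetric] N\<tau>[symmetric] by (simp add: mult_ac)
    also have "\<epsilon> * \<tau> * real N * b ^ N = \<epsilon> * T * exp (2 * \<bar>\<kappa>\<bar> * T)"
      unfolding b_def exp_of_nat_mult[symmetric] N\<tau>[symmetric] by (simp add: mult_ac)
    finally show ?case using \<epsilon>T by (simp add: \<tau>_def)
  qed
qed

section \<open>The gradient estimate\<close>

text \<open>Contraction for the infinitesimally close densities \<open>\<rho>\<close> and \<open>\<rho> + h v\<close>, divided by \<open>h\<^sup>2\<close> and tested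
  with \<open>l f\<close>. Replacing \<open>\<W>\<close> by the norm at \<open>\<rho>\<close> costs factors \<open>1 + O(h)\<close>. First \<open>N\<close> tends to
  infinity for fixed \<open>h\<close>, then \<open>h\<close> to zero.\<close>

lemma heat_dual_estimate:
  assumes curv: "entropic_curvature_ge Q \<pi> \<kappa>" and \<rho>: "\<rho> \<in> region (4 * d)" and d: "0 < d"
    and mz: "mean v = 0" and T: "0 \<le> T"
  shows "2 * l * inner (heat Q T f) v - l\<^sup>2 * (1/2 * inner (heat Q T (Gam Q f)) \<rho>)
    \<le> exp (- 2 * \<kappa> * T) * cost \<rho> v"
proof -
  obtain C where C: "0 < C" and
    ell: "\<forall>x\<in>region d. \<forall>y\<in>region d. \<forall>h. (\<forall>z. \<bar>y z - x z\<bar> \<le> h) \<longrightarrow> ell x y \<le> C * h"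
    by (rule ell_le_sup_norm[OF d])
  define V where "V = (\<Sum>z\<in>UNIV. \<bar>v z\<bar>) + 1"
  have V0: "0 < V" unfolding V_def by (intro add_nonneg_pos sum_nonneg) auto
  have V: "\<bar>v z\<bar> \<le> V" for z
    using member_le_sum[of z UNIV "\<lambda>z. \<bar>v z\<bar>"] by (simp add: V_def)
  define h\<^sub>1 where "h\<^sub>1 = min (d / V) (d / (2 * pi_ratio * C * V))"
  have h1: "0 < h\<^sub>1" using d V0 C pi_ratio_pos by (simp add: h\<^sub>1_def)
  define c where "c = pi_ratio * (C * V) / d"
  let ?k = "exp (- 2 * \<kappa> * T)"
  let ?F = "2 * l * inner (heat Q T f) v - l\<^sup>2 * (1/2 * inner (heat Q T (Gam Q f)) \<rho>)"
  have \<rho>3: "\<rho> \<in> region (d + 2 * d)" using \<rho> d by (auto elim: region_mono)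
  have dist_near: "\<W> x y \<le> C * (h * V)"
    if "x \<in> region (d + 2 * d)" "y \<in> region (d + 2 * d)" "\<forall>z. \<bar>y z - x z\<bar> \<le> h * V" for x y h
  proof -
    have r: "x \<in> region d" "y \<in> region d" using that d by (auto elim: region_mono)
    have "ell x y \<le> C * (h * V)" using ell[rule_format, OF r] that(3) by blast
    from chain_dist[OF chain_segment[OF r this] d] show ?thesis .
  qed
  have bound: "?F \<le> (1 + c * h) * (?k * ((1 + h * V / d) * cost \<rho> v) + h)" if h: "0 < h" "h < h\<^sub>1" for h
  proof -
    define \<sigma> where "\<sigma> = (\<lambda>z. \<rho> z + h * v z)"
    have hV: "h * V \<le> d"
    proof -
      have "h \<le> d / V" using h by (simp add: h\<^sub>1_def)
      then show ?thesis using V0 by (simp add: pos_le_divide_eq)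
    qed
    have hC: "pi_ratio * (C * (h * V)) < d"
    proof -
      have "h \<le> d / (2 * pi_ratio * C * V)" using h by (simp add: h\<^sub>1_def)
      then have "h * (2 * pi_ratio * C * V) \<le> d" using V0 C pi_ratio_pos by (simp add: pos_le_divide_eq)
      moreover have "0 < h * (pi_ratio * C * V)" using h V0 C pi_ratio_pos by simp
      ultimately show ?thesis by (simp add: mult_ac)
    qed
    have hv: "\<bar>h * v z\<bar> \<le> h * V" for z using V[of z] h by (simp add: abs_mult)
    have \<sigma>: "\<sigma> \<in> region (d + 2 * d)"
    proof -
      have low: "d + 2 * d \<le> \<sigma> z" for z
        using hv[of z] hV \<rho> by (force simp: \<sigma>_def region_def abs_le_iff dest: spec[of _ z])
      moreover have "0 \<le> \<sigma> z" for z using low[of z] d by linarith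
      moreover have "mean \<sigma> = 1"
        unfolding \<sigma>_def inner_add_right inner_scale_right mz
        using \<rho> by (simp add: inner_one_density region_def)
      ultimately show ?thesis by (simp add: region_def densities_def inner_def mult.commute)
    qed
    have diff: "\<bar>\<sigma> z - \<rho> z\<bar> \<le> h * V" for z using hv[of z] by (simp add: \<sigma>_def)
    have near: "pi_ratio * \<W> x y < d"
      if "x \<in> region (d + 2 * d)" "y \<in> region (d + 2 * d)" "\<forall>z. \<bar>y z - x z\<bar> \<le> h * V" for x y
    proof -
      have "pi_ratio * \<W> x y \<le> pi_ratio * (C * (h * V))"
        using dist_near[OF that] pi_ratio_pos by (intro mult_left_mono) auto
      then show ?thesis using hC by linarith
    qed
    \<comment> \<open>The error \<open>h ^ 3\<close> is negligible after division by \<open>h\<^sup>2\<close>.\<close>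
    have "0 < h ^ 3" using h by simp
    from iterated_contraction[OF curv d d T near \<rho>3 \<sigma> diff this]
    have ev: "\<forall>\<^sub>F N in sequentially.
      (\<W> ((euler (T / real N) ^^ N) \<rho>) ((euler (T / real N) ^^ N) \<sigma>))\<^sup>2
        \<le> ?k * (\<W> \<rho> \<sigma>)\<^sup>2 + h ^ 3" by blast
    have \<rho>pos: "0 < \<rho> z" for z using region_pos[OF \<rho>3] d by simp
    have \<sigma>pos: "0 < \<sigma> z" for z using region_pos[OF \<sigma>] d by simp
    have W0: "(\<W> \<rho> \<sigma>)\<^sup>2 \<le> h\<^sup>2 * ((1 + h * V / d) * cost \<rho> v)"
    proof -
      let ?m = "\<lambda>z. min (\<rho> z) (\<sigma> z)"
      have s3: "0 < d + 2 * d" using d by simp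
      have "\<W> \<rho> \<sigma> \<le> ell \<rho> \<sigma>"
        by (rule chain_dist[OF chain_segment[OF \<rho>3 \<sigma> order_refl] s3])
      then have "(\<W> \<rho> \<sigma>)\<^sup>2 \<le> (ell \<rho> \<sigma>)\<^sup>2"
        by (intro power_mono transport_dist_nonneg)
      also have "\<dots> = cost ?m (\<lambda>z. \<sigma> z - \<rho> z)"
        unfolding ell_def
        by (intro real_sqrt_pow2 cost_nonneg region_diff_mean_zero[OF \<rho>3 \<sigma>]) (simp add: \<rho>pos \<sigma>pos)
      also have "\<dots> \<le> (1 + h * V / d) * cost \<rho> (\<lambda>z. \<sigma> z - \<rho> z)"
      proof (rule cost_antimono[OF \<rho>pos _ region_diff_mean_zero[OF \<rho>3 \<sigma>]])
        show "0 < ?m z" for z by (simp add: \<rho>pos \<sigma>pos)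
        show "0 < 1 + h * V / d" using h V0 d by (simp add: add_pos_pos)
        fix z
        have md: "d \<le> ?m z" using \<rho>3 \<sigma> d by (force simp: region_def dest: spec[of _ z])
        have "\<rho> z \<le> ?m z + h * V" using diff[of z] h V0 by (auto simp: min_def abs_le_iff)
        also have "h * V = h * V / d * d" using d by simp
        also have "\<dots> \<le> h * V / d * ?m z" using md h V0 d by (intro mult_left_mono) auto
        finally show "\<rho> z \<le> (1 + h * V / d) * ?m z" by (simp add: algebra_simps)
      qed
      also have "cost \<rho> (\<lambda>z. \<sigma> z - \<rho> z) = h\<^sup>2 * cost \<rho> v"
        unfolding \<sigma>_def using cost_scale[of \<rho> v h, OF \<rho>pos mz] by simp
      finally show ?thesis by (simp add: mult_ac)
    qed
    let ?G = "\<lambda>N. 2 * l * inner ((euler (T / real N) ^^ N) f) v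
        - l\<^sup>2 * (1/2 * inner ((euler (T / real N) ^^ N) (Gam Q f)) \<rho>)"
    have "\<forall>\<^sub>F N in sequentially. ?G N \<le> (1 + c * h) * (?k * ((1 + h * V / d) * cost \<rho> v) + h)"
      using ev eventually_ge_at_top[of "nat \<lceil>T\<rceil> + 1"]
    proof eventually_elim
      case (elim N)
      define t where "t = T / real N"
      have t: "0 \<le> t" "t \<le> 1"
      proof -
        have "nat \<lceil>T\<rceil> \<le> N" using elim(2) by linarith
        then have "T \<le> real N" using real_nat_ceiling_ge[of T] by linarith
        then show "0 \<le> t" "t \<le> 1" using T elim(2) by (auto simp: t_def)
      qed
      let ?E = "euler t ^^ N"
      have s3: "0 < d + 2 * d" using d by simp
      have it: "(euler t ^^ n) x \<in> region (d + 2 * d)" if "x \<in> region (d + 2 * d)" for n x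
        by (induction n) (use that euler_region[OF t _ s3] in auto)
      have \<sigma>E: "?E \<sigma> = (\<lambda>z. ?E \<rho> z + h * ?E v z)" unfolding \<sigma>_def by (rule euler_power_add_scaled)
      have itd: "\<bar>(euler t ^^ n) (\<lambda>z. h * v z) z\<bar> \<le> h * V" for n z
      proof (induction n arbitrary: z)
        case (Suc n)
        then show ?case using euler_abs_le[OF t Suc.IH] by simp
      qed (use hv in simp)
      have hE: "(\<lambda>z. h * ?E v z) = ?E (\<lambda>z. h * v z)"
      proof -
        have "(euler t ^^ n) (\<lambda>_. 0) = (\<lambda>_. 0)" for n
          by (induction n) (auto simp: euler_def laplacian_def fun_eq_iff)
        then show ?thesis
          using euler_power_add_scaled[where t = t and n = N and x = "\<lambda>_. 0" and h = h and v = v]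
          by simp
      qed
      have Ereg: "?E \<rho> \<in> region (d + 2 * d)" "?E \<sigma> \<in> region (d + 2 * d)"
        using it \<rho>3 \<sigma> by auto
      have Epos: "0 < ?E \<rho> z" for z using region_pos[OF Ereg(1) s3] .
      have Emz: "mean (?E v) = 0"
      proof -
        have "(euler t ^^ n) (\<lambda>_. 1) = (\<lambda>_. 1)" for n by (induction n) (auto simp: euler_one)
        then show ?thesis using mz by (simp add: euler_power_commute)
      qed
      define W where "W = \<W> (?E \<rho>) (?E \<sigma>)"
      have Wle: "W \<le> C * (h * V)"
        unfolding W_def
      proof (rule dist_near[OF Ereg], rule allI)
        fix z show "\<bar>?E \<sigma> z - ?E \<rho> z\<bar> \<le> h * V"
          using itd[of N z] fun_cong[OF hE, of z] by (simp add: \<sigma>E)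
      qed
      have W2: "W\<^sup>2 \<le> ?k * (h\<^sup>2 * ((1 + h * V / d) * cost \<rho> v)) + h ^ 3"
      proof -
        have "W\<^sup>2 \<le> ?k * (\<W> \<rho> \<sigma>)\<^sup>2 + h ^ 3"
          using elim(1) unfolding W_def t_def .
        also have "\<dots> \<le> ?k * (h\<^sup>2 * ((1 + h * V / d) * cost \<rho> v)) + h ^ 3"
          by (intro add_right_mono mult_left_mono W0) auto
        finally show ?thesis .
      qed
      have "h\<^sup>2 * cost (?E \<rho>) (?E v) = cost (?E \<rho>) (\<lambda>z. ?E \<sigma> z - ?E \<rho> z)"
        unfolding \<sigma>E using cost_scale[of "?E \<rho>" "?E v" h, OF Epos Emz] by simp
      also have "\<dots> \<le> (1 + pi_ratio * W / (d + 2 * d)) * W\<^sup>2"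
        unfolding W_def by (rule cost_le_dist[OF Ereg s3])
      also have "\<dots> \<le> (1 + c * h) * W\<^sup>2"
      proof (rule mult_right_mono)
        have "pi_ratio * W / (d + 2 * d) \<le> pi_ratio * W / d"
          using d pi_ratio_pos transport_dist_nonneg
          by (intro divide_left_mono) (auto simp: W_def)
        also have "\<dots> \<le> pi_ratio * (C * (h * V)) / d"
          using d pi_ratio_pos Wle by (intro divide_right_mono mult_left_mono) auto
        also have "\<dots> = c * h" by (simp add: c_def)
        finally show "1 + pi_ratio * W / (d + 2 * d) \<le> 1 + c * h" by simp
      qed simp
      also have "\<dots> \<le> (1 + c * h) * (?k * (h\<^sup>2 * ((1 + h * V / d) * cost \<rho> v)) + h ^ 3)"
        using W2 C V0 d pi_ratio_pos h by (intro mult_left_mono) (auto simp: c_def)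
      also have "\<dots> = h\<^sup>2 * ((1 + c * h) * (?k * ((1 + h * V / d) * cost \<rho> v) + h))"
        by (simp add: algebra_simps power2_eq_square power3_eq_cube)
      finally have "cost (?E \<rho>) (?E v) \<le> (1 + c * h) * (?k * ((1 + h * V / d) * cost \<rho> v) + h)"
        using h by simp
      moreover have "2 * inner (\<lambda>z. l * f z) (?E v) - \<A> (?E \<rho>) (\<lambda>z. l * f z) \<le> cost (?E \<rho>) (?E v)"
        by (rule cost_dual[OF Epos Emz])
      moreover have "inner (\<lambda>z. l * f z) (?E v) = l * inner (?E f) v"
        unfolding inner_scale_left euler_power_commute ..
      moreover have "\<A> (?E \<rho>) (\<lambda>z. l * f z) \<le> l\<^sup>2 * (1/2 * inner (?E (Gam Q f)) \<rho>)"
        unfolding act_scale euler_power_commute[symmetric]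
        by (intro mult_left_mono act_le_Gam less_imp_le[OF Epos]) auto
      ultimately show ?case by (simp add: t_def)
    qed
    moreover have "?G \<longlonglongrightarrow> ?F"
      by (intro tendsto_intros euler_power_inner_tendsto T)
    ultimately show ?thesis
      by (intro tendsto_upperbound) auto
  qed
  show ?thesis
  proof (rule tendsto_lowerbound)
    have "((\<lambda>h. (1 + c * h) * (?k * ((1 + h * V / d) * cost \<rho> v) + h))
        \<longlongrightarrow> (1 + c * 0) * (?k * ((1 + 0 * V / d) * cost \<rho> v) + 0)) (at_right 0)"
      using d by (intro tendsto_intros) auto
    then show "((\<lambda>h. (1 + c * h) * (?k * ((1 + h * V / d) * cost \<rho> v) + h)) \<longlongrightarrow> ?k * cost \<rho> v) (at_right 0)"
      by simp
    show "\<forall>\<^sub>F h in at_right 0. ?F \<le> (1 + c * h) * (?k * ((1 + h * V / d) * cost \<rho> v) + h)"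
      using h1 by (intro eventually_at_rightI[of 0 h\<^sub>1] bound) auto
  qed simp
qed

lemma act_scale_density:
  assumes "0 < c" "\<And>z. 0 \<le> \<rho> z"
  shows "\<A> (\<lambda>z. c * \<rho> z) f = c * \<A> \<rho> f"
  using assms by (simp add: act_def hat_def log_mean_scale sum_distrib_left mult_ac)

text \<open>The dual estimate with \<open>v = flow \<sigma> (P\<^sub>T f)\<close>, whose cost and whose pairing with \<open>P\<^sub>T f\<close> are both
  \<open>A(\<sigma>, P\<^sub>T f)\<close>, and with the optimal multiplier \<open>l = exp(-2 \<kappa> T)\<close>. Both sides are homogeneous in
  \<open>\<rho>\<close>, which reduces to densities.\<close>

lemma act_heat_le:
  assumes curv: "entropic_curvature_ge Q \<pi> \<kappa>" and pos: "\<And>z. 0 < \<rho> z" and T: "0 \<le> T"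
  shows "\<A> \<rho> (heat Q T f) \<le> exp (- 2 * \<kappa> * T) / 2 * inner (heat Q T (Gam Q f)) \<rho>"
proof -
  let ?g = "heat Q T f" and ?G = "heat Q T (Gam Q f)" and ?k = "exp (- 2 * \<kappa> * T)"
  define c where "c = mean \<rho>"
  define \<sigma> where "\<sigma> = (\<lambda>z. (1 / c) * \<rho> z)"
  have c: "0 < c"
    unfolding c_def inner_def by (intro sum_pos) (auto simp: pos pi_pos)
  have \<sigma>pos: "0 < \<sigma> z" for z using c pos by (simp add: \<sigma>_def)
  have "mean \<sigma> = 1" unfolding \<sigma>_def inner_scale_right using c by (simp add: c_def)
  then have dens: "\<sigma> \<in> densities \<pi>"
    by (simp add: densities_def inner_def mult.commute less_imp_le[OF \<sigma>pos])
  define d where "d = Min (range \<sigma>) / 4"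
  have d: "0 < d" using \<sigma>pos by (simp add: d_def)
  have reg: "\<sigma> \<in> region (4 * d)" using dens by (simp add: region_def d_def)
  let ?v = "flow \<sigma> ?g"
  have "cost \<sigma> ?v = \<A> \<sigma> ?g" by (rule cost_eq_act[OF \<sigma>pos refl])
  moreover have "inner ?g ?v = \<A> \<sigma> ?g" by (simp add: act_eq_inner_flow)
  ultimately have "2 * ?k * \<A> \<sigma> ?g - ?k\<^sup>2 * (1/2 * inner ?G \<sigma>) \<le> ?k * \<A> \<sigma> ?g"
    using heat_dual_estimate[OF curv reg d inner_one_flow[of \<sigma> ?g] T, of ?k f] by simp
  then have "?k * \<A> \<sigma> ?g \<le> ?k * (?k / 2 * inner ?G \<sigma>)"
    by (simp add: power2_eq_square)
  then have "\<A> \<sigma> ?g \<le> ?k / 2 * inner ?G \<sigma>" by (subst (asm) mult_le_cancel_left_pos) auto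
  then have "c * \<A> \<sigma> ?g \<le> c * (?k / 2 * inner ?G \<sigma>)" using c by (intro mult_left_mono) auto
  moreover have \<rho>: "(\<lambda>z. c * \<sigma> z) = \<rho>" using c by (simp add: \<sigma>_def)
  ultimately show ?thesis
    using act_scale_density[of c \<sigma> ?g, OF c less_imp_le[OF \<sigma>pos]] inner_scale_right[of ?G c \<sigma>]
    by (simp add: mult_ac)
qed

text \<open>Only the edges at \<open>x\<close> are kept. Each of them occurs in both directions, which cancels the factor
  \<open>1/2\<close> of the action.\<close>

lemma Gam_le_act:
  assumes \<epsilon>: "0 < \<epsilon>" and nn: "\<And>z. 0 \<le> \<rho> z" and x: "1 \<le> \<rho> x" and nb: "\<And>y. y \<noteq> x \<Longrightarrow> adjacent Q x y \<Longrightarrow> \<epsilon> \<le> \<rho> y"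
  shows "log_mean 1 \<epsilon> * (Gam Q g x * \<pi> x) \<le> \<A> \<rho> g"
proof -
  let ?F = "\<lambda>u w. (g w - g u)\<^sup>2 * hat \<rho> u w * Q u w * \<pi> u"
  have F0: "0 \<le> ?F u w" for u w
    unfolding hat_def by (intro mult_nonneg_nonneg) (auto simp: Q_nonneg pi_nonneg log_mean_nonneg nn)
  have Fsym: "?F u w = ?F w u" for u w
    using detailed_balance[of u w] by (simp add: mult.assoc hat_commute[of \<rho> u w] power2_commute[of "g u"])
  have lower: "log_mean 1 \<epsilon> * ((g w - g x)\<^sup>2 * Q x w * \<pi> x) \<le> ?F x w" for w
  proof (cases "w = x \<or> Q x w = 0")
    case False
    then have "adjacent Q x w" "w \<noteq> x" using Q_nonneg[of x w] by (auto simp: adjacent_def)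
    then have "log_mean 1 \<epsilon> \<le> hat \<rho> x w"
      unfolding hat_def using \<epsilon> x nb by (intro log_mean_mono) auto
    then have "log_mean 1 \<epsilon> * ((g w - g x)\<^sup>2 * Q x w * \<pi> x) \<le> hat \<rho> x w * ((g w - g x)\<^sup>2 * Q x w * \<pi> x)"
      by (intro mult_right_mono mult_nonneg_nonneg) (auto simp: Q_nonneg pi_nonneg)
    then show ?thesis by (simp add: mult_ac)
  qed auto
  have "log_mean 1 \<epsilon> * (Gam Q g x * \<pi> x) = (\<Sum>w\<in>UNIV. log_mean 1 \<epsilon> * ((g w - g x)\<^sup>2 * Q x w * \<pi> x))"
    by (simp add: Gam_def sum_distrib_left sum_distrib_right)
  also have "\<dots> \<le> (\<Sum>w\<in>UNIV. ?F x w)" by (intro sum_mono lower)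
  finally have 1: "log_mean 1 \<epsilon> * (Gam Q g x * \<pi> x) \<le> (\<Sum>w\<in>UNIV. ?F x w)" .
  have "(\<Sum>u\<in>UNIV. ?F x u) + (\<Sum>w\<in>UNIV. ?F x w) = (\<Sum>u\<in>UNIV. (if u = x then (\<Sum>w\<in>UNIV. ?F x w) else 0) + ?F u x)"
    by (simp add: sum.distrib Fsym[of _ x])
  also have "\<dots> \<le> (\<Sum>u\<in>UNIV. \<Sum>w\<in>UNIV. ?F u w)"
  proof (rule sum_mono)
    fix u
    have "?F u x \<le> (\<Sum>w\<in>UNIV. ?F u w)" by (rule member_le_sum) (auto simp: F0)
    then show "(if u = x then (\<Sum>w\<in>UNIV. ?F x w) else 0) + ?F u x \<le> (\<Sum>w\<in>UNIV. ?F u w)" by auto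
  qed
  also have "\<dots> = 2 * \<A> \<rho> g" by (simp add: act_def)
  finally show ?thesis using 1 by linarith
qed

text \<open>The function \<open>b\<close> concentrated at \<open>x\<close> and its neighbours has zeros; adding a small constant
  \<open>\<delta>\<close> makes it positive at the price of \<open>\<eta>\<close>.\<close>

lemma Gam_heat_le:
  assumes curv: "entropic_curvature_ge Q \<pi> \<kappa>" and t: "0 \<le> t" and \<epsilon>: "0 < \<epsilon>"
  shows "Gam Q (heat Q t f) x * \<pi> x \<le> exp (- 2 * \<kappa> * t) / (2 * log_mean 1 \<epsilon>) *
    (heat Q t (Gam Q f) x * \<pi> x + \<epsilon> * (\<Sum>y\<in>nbrs Q x. heat Q t (Gam Q f) y * \<pi> y))"
proof -
  let ?g = "heat Q t f" and ?G = "heat Q t (Gam Q f)" and ?k = "exp (- 2 * \<kappa> * t)"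
  let ?R = "?G x * \<pi> x + \<epsilon> * (\<Sum>y\<in>nbrs Q x. ?G y * \<pi> y)"
  define b where "b = (\<lambda>z. if z = x then 1 else if adjacent Q x z then \<epsilon> else 0)"
  have \<theta>: "0 < log_mean 1 \<epsilon>" using \<epsilon> by (intro log_mean_pos) auto
  have G0: "0 \<le> ?G z" for z
    by (intro heat_nonneg t) (auto simp: Gam_def Q_nonneg intro!: sum_nonneg)
  have b: "inner ?G b \<le> ?R"
  proof -
    have "inner ?G b \<le> (\<Sum>z\<in>UNIV. (if z = x then ?G x * \<pi> x else 0) + (if z \<in> nbrs Q x then \<epsilon> * (?G z * \<pi> z) else 0))"
      unfolding inner_def
    proof (rule sum_mono)
      fix z
      have "0 \<le> \<epsilon> * (?G z * \<pi> z)" using \<epsilon> G0 pi_nonneg by simp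
      then show "?G z * b z * \<pi> z \<le> (if z = x then ?G x * \<pi> x else 0) + (if z \<in> nbrs Q x then \<epsilon> * (?G z * \<pi> z) else 0)"
        by (auto simp: b_def nbrs_def)
    qed
    also have "\<dots> = ?R"
      by (simp add: sum.distrib sum_distrib_left sum.If_cases)
    finally show ?thesis .
  qed
  have "log_mean 1 \<epsilon> * (Gam Q ?g x * \<pi> x) \<le> ?k / 2 * ?R + \<eta>" if \<eta>: "0 < \<eta>" for \<eta>
  proof -
    define I where "I = ?k / 2 * inner ?G (\<lambda>_. 1)"
    have I0: "0 \<le> I" unfolding I_def inner_def by (intro mult_nonneg_nonneg sum_nonneg) (auto simp: G0 pi_nonneg)
    define \<delta> where "\<delta> = \<eta> / (I + 1)"
    have \<delta>: "0 < \<delta>" using \<eta> I0 by (simp add: \<delta>_def)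
    let ?\<rho> = "\<lambda>z. b z + \<delta> * 1"
    have b0: "0 \<le> b z" for z using \<epsilon> by (simp add: b_def)
    have pos: "0 < ?\<rho> z" for z using b0[of z] \<delta> by simp
    have "log_mean 1 \<epsilon> * (Gam Q ?g x * \<pi> x) \<le> \<A> ?\<rho> ?g"
      by (intro Gam_le_act \<epsilon> less_imp_le[OF pos]) (use \<delta> in \<open>auto simp: b_def\<close>)
    also have "\<dots> \<le> ?k / 2 * inner ?G ?\<rho>" by (rule act_heat_le[OF curv pos t])
    also have "inner ?G ?\<rho> = inner ?G b + \<delta> * inner ?G (\<lambda>_. 1)"
      unfolding inner_add_right inner_scale_right ..
    also have "?k / 2 * (inner ?G b + \<delta> * inner ?G (\<lambda>_. 1)) = ?k / 2 * inner ?G b + \<delta> * I"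
      by (simp add: I_def algebra_simps)
    also have "\<dots> \<le> ?k / 2 * ?R + \<eta>"
    proof (intro add_mono mult_left_mono b)
      have "\<delta> * I \<le> \<delta> * (I + 1)" using \<delta> by simp
      then show "\<delta> * I \<le> \<eta>" using I0 by (simp add: \<delta>_def)
    qed simp
    finally show ?thesis .
  qed
  then have "log_mean 1 \<epsilon> * (Gam Q ?g x * \<pi> x) \<le> ?k / 2 * ?R" by (rule field_le_epsilon)
  then show ?thesis using \<theta> by (simp add: field_simps)
qed

end

theorem theorem1p2:
  fixes Q :: "'a::finite \<Rightarrow> 'a \<Rightarrow> real" and \<pi> :: "'a \<Rightarrow> real" and \<kappa> :: real
    and x :: 'a and f :: "'a \<Rightarrow> real" and t \<epsilon> :: real
  assumes "markov_kernel Q"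
    and "irreducible_kernel Q"
    and "stationary_distribution Q \<pi>"
    and "reversible Q \<pi>"
    and "entropic_curvature_ge Q \<pi> \<kappa>"
    and "0 \<le> t"
    and "0 < \<epsilon>"
  shows "Gam Q (heat Q t f) x * \<pi> x \<le>
    exp (- 2 * \<kappa> * t) / (2 * log_mean 1 \<epsilon>) *
      (heat Q t (Gam Q f) x * \<pi> x + \<epsilon> * (\<Sum>y\<in>nbrs Q x. heat Q t (Gam Q f) y * \<pi> y))"
proof -
  interpret reversible_chain Q \<pi> using assms by unfold_locales
  show ?thesis using assms by (intro Gam_heat_le)
qed

end
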